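(* Let $\mathcal{E}=\mathrm{Psh}(\mathbb{C})$ be the category of presheaves on a small category $\mathbb{C}$, equipped with a functorial cylinder $I\otimes(-)$ with contractions and connections such that $I\otimes(-)$ has a right adjoint. Assume that (C1) $I\otimes(-)$ preserves pullback squares, and (C2) the natural transformations $\delta^k\otimes(-)\colon\mathrm{Id}\to I\otimes(-)$, $k\in\{0,1\}$, are cartesian. Let $\mathcal{M}$ be a full subcategory of $\mathcal{E}^\to_{\mathrm{cart}}$ such that: (M1) the elements of $\mathcal{M}$ are monomorphisms; (M2) for every $X\in\mathcal{E}$ the unique map $0\to X$ is in $\mathcal{M}$; (M3) the elements of $\mathcal{M}$ are closed under pullback; (M4) the elements of $\mathcal{M}$ are closed under Leibniz product $\delta^k\hat\otimes(-)$ with the endpoint inclusions, $k\in\{0,1\}$; (M5) the category $\mathcal{M}$ has colimits and the inclusion $\mathcal{M}\to\mathcal{E}^\to_{\mathrm{cart}}$ preserves them. Let $f\colon X\to Y$ be a map in $\mathcal{E}$, let $P_Y$ be the $\mathcal{M}$-partial map classifier relative to $Y$, and let $\eta_X\colon X\to P_YX$ be the canonical map in $\mathcal{E}_{/Y}$. Then giving the structure of a uniform trivial fibration (i.e. of a right $\mathcal{M}$-map) on $f$ is equivalent to giving a diagonal filler $P_YX\to X$ for the square with top $\mathrm{id}_X\colon X\to X$, left side $\eta_X\colon X\to P_YX$, right side $f\colon X\to Y$ and bottom the structure map $P_YX\to Y$; that is, to giving a retraction of $\eta_X$ in $\mathcal{E}_{/Y}$.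
   Context: $\mathcal{E}^\to_{\mathrm{cart}}$ is the category of arrows of $\mathcal{E}$ and pullback squares. A functorial cylinder on $\mathcal{E}$ is an endofunctor $I\otimes(-)$ with natural transformations $\delta^0\otimes(-),\delta^1\otimes(-)\colon \mathrm{Id}\to I\otimes(-)$ (endpoint inclusions). It has contractions if there is a natural transformation $\varepsilon\otimes(-)\colon I\otimes(-)\to\mathrm{Id}$ with $(\varepsilon\otimes X)\circ(\delta^k\otimes X)=\mathrm{id}_X$ for $k=0,1$. It then has connections if for $k\in\{0,1\}$ there is a natural $c^k\otimes(-)\colon I\otimes I\otimes(-)\to I\otimes(-)$ such that $(c^k\otimes X)\circ(\delta^k\otimes I\otimes X)=(\delta^k\otimes X)\circ(\varepsilon\otimes X)=(c^k\otimes X)\circ(I\otimes\delta^k\otimes X)$ and $(c^k\otimes X)\circ(\delta^{1-k}\otimes I\otimes X)=\mathrm{id}_{I\otimes X}=(c^k\otimes X)\circ(I\otimes\delta^{1-k}\otimes X)$; here $\delta^k\otimes I\otimes X$ is the component at $I\otimes X$, and $I\otimes\delta^k\otimes X$ is $I\otimes(-)$ applied to the component at $X$. For $i\colon A\to B$ the Leibniz product $\delta^k\hat\otimes i\colon (I\otimes A)+_A B\to I\otimes B$ is the map out of the pushout of $\delta^k\otimes A$ and $i$ induced by $I\otimes i$ and $\delta^k\otimes B$. A right $\mathcal{M}$-map (uniform trivial fibration) is a map $f\colon X\to Y$ with a function $\phi$ assigning to each $m\colon A\to B$ in $\mathcal{M}$ and square $(s,t)\colon m\to f$ a diagonal filler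 $\phi(m,s,t)\colon B\to X$, such that for each pullback square $(a,b)\colon m\to m'$ between elements of $\mathcal{M}$ and each square $(s,t)\colon m'\to f$ one has $\phi(m',s,t)\circ b=\phi(m,s\circ a,t\circ b)$. Let $\Omega$ be the subobject classifier of $\mathcal{E}$ with $\top\colon1\to\Omega$. Let $K\rightarrowtail\Omega$ be the subobject with $K(x)$ the set of subobjects of the representable $\mathrm{y}(x)$ that are elements of $\mathcal{M}$, for $x\in\mathbb{C}$; $\top$ factors through a map $1\to K$, and this map classifies the maps in $\mathcal{M}$ (a map is in $\mathcal{M}$ iff it is a pullback of $1\to K$). For $Y\in\mathcal{E}$ let $t\colon Y\to K\times Y$ be the map induced by $Y\to1\to K$ and $\mathrm{id}_Y$, and $\pi\colon K\times Y\to Y$ the projection. Define $P_Y=\pi_!\circ t_*\colon\mathcal{E}_{/Y}\to\mathcal{E}_{/Y}$, where $t_*\colon\mathcal{E}_{/Y}\to\mathcal{E}_{/K\times Y}$ is the right adjoint of pullback $t^*$ and $\pi_!$ is composition with $\pi$. Since $t$ is monic, $t^*t_*\cong\mathrm{Id}$, so for $X\in\mathcal{E}_{/Y}$ there is a pullback square with left side $X\to Y$, bottom $t\colon Y\to K\times Y$, right side $P_YX\to K\times Y$ (the map $t_*X$), and top a map denoted $\eta_X\colon X\to P_YX$. *)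

theory Defs
  imports "HOL-Library.FuncSet"
begin

unbundle cardinal_syntax

section \<open>Categories, functors, limits and colimits\<close>

record ('o, 'a) cat =
  Obj :: "'o set"
  Arr :: "'a set"
  Dom :: "'a \<Rightarrow> 'o"
  Cod :: "'a \<Rightarrow> 'o"
  Ident :: "'o \<Rightarrow> 'a"
  Comp :: "'a \<Rightarrow> 'a \<Rightarrow> 'a"  (infixl "\<cdot>\<index>" 70)

definition hom :: "('o, 'a, 'z) cat_scheme \<Rightarrow> 'o \<Rightarrow> 'o \<Rightarrow> 'a set" where
  "hom C x y = {f \<in> Arr C. Dom C f = x \<and> Cod C f = y}"

definition category :: "('o, 'a, 'z) cat_scheme \<Rightarrow> bool" where
  "category C \<longleftrightarrow>
     (\<forall>f\<in>Arr C. Dom C f \<in> Obj C \<and> Cod C f \<in> Obj C) \<and>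
     (\<forall>x\<in>Obj C. Ident C x \<in> hom C x x) \<and>
     (\<forall>f\<in>Arr C. \<forall>g\<in>Arr C. Dom C g = Cod C f \<longrightarrow> g \<cdot>\<^bsub>C\<^esub> f \<in> hom C (Dom C f) (Cod C g)) \<and>
     (\<forall>f\<in>Arr C. f \<cdot>\<^bsub>C\<^esub> Ident C (Dom C f) = f \<and> Ident C (Cod C f) \<cdot>\<^bsub>C\<^esub> f = f) \<and>
     (\<forall>f\<in>Arr C. \<forall>g\<in>Arr C. \<forall>h\<in>Arr C. Dom C g = Cod C f \<longrightarrow> Dom C h = Cod C g \<longrightarrow>
        h \<cdot>\<^bsub>C\<^esub> (g \<cdot>\<^bsub>C\<^esub> f) = (h \<cdot>\<^bsub>C\<^esub> g) \<cdot>\<^bsub>C\<^esub> f)"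

definition full_subcat :: "('o, 'a) cat \<Rightarrow> 'o set \<Rightarrow> ('o, 'a) cat" where
  "full_subcat C S =
     C\<lparr>Obj := Obj C \<inter> S, Arr := {f \<in> Arr C. Dom C f \<in> S \<and> Cod C f \<in> S}\<rparr>"

definition inv_arr :: "('o, 'a, 'z) cat_scheme \<Rightarrow> 'a \<Rightarrow> 'a" where
  "inv_arr C h = (THE g. g \<in> hom C (Cod C h) (Dom C h) \<and>
     g \<cdot>\<^bsub>C\<^esub> h = Ident C (Dom C h) \<and> h \<cdot>\<^bsub>C\<^esub> g = Ident C (Cod C h))"

definition monic :: "('o, 'a, 'z) cat_scheme \<Rightarrow> 'a \<Rightarrow> bool" where
  "monic C m \<longleftrightarrow> m \<in> Arr C \<and>
     (\<forall>x. \<forall>u\<in>hom C x (Dom C m). \<forall>v\<in>hom C x (Dom C m). m \<cdot>\<^bsub>C\<^esub> u = m \<cdot>\<^bsub>C\<^esub> v \<longrightarrow> u = v)"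

definition is_initial :: "('o, 'a, 'z) cat_scheme \<Rightarrow> 'o \<Rightarrow> bool" where
  "is_initial C z \<longleftrightarrow> z \<in> Obj C \<and> (\<forall>x\<in>Obj C. \<exists>!h. h \<in> hom C z x)"

text \<open>\<open>comm_sq C m n s t\<close>: a square from \<open>m\<close> (left) to \<open>n\<close> (right) with top \<open>s\<close> and
  bottom \<open>t\<close>.\<close>

definition comm_sq :: "('o, 'a, 'z) cat_scheme \<Rightarrow> 'a \<Rightarrow> 'a \<Rightarrow> 'a \<Rightarrow> 'a \<Rightarrow> bool" where
  "comm_sq C m n s t \<longleftrightarrow> m \<in> Arr C \<and> n \<in> Arr C \<and>
     s \<in> hom C (Dom C m) (Dom C n) \<and> t \<in> hom C (Cod C m) (Cod C n) \<and>
     n \<cdot>\<^bsub>C\<^esub> s = t \<cdot>\<^bsub>C\<^esub> m"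

definition pullback_sq :: "('o, 'a, 'z) cat_scheme \<Rightarrow> 'a \<Rightarrow> 'a \<Rightarrow> 'a \<Rightarrow> 'a \<Rightarrow> bool" where
  "pullback_sq C m n s t \<longleftrightarrow> comm_sq C m n s t \<and>
     (\<forall>z. \<forall>u\<in>hom C z (Dom C n). \<forall>v\<in>hom C z (Cod C m). n \<cdot>\<^bsub>C\<^esub> u = t \<cdot>\<^bsub>C\<^esub> v \<longrightarrow>
        (\<exists>!w. w \<in> hom C z (Dom C m) \<and> s \<cdot>\<^bsub>C\<^esub> w = u \<and> m \<cdot>\<^bsub>C\<^esub> w = v))"

definition pushout_sq :: "('o, 'a, 'z) cat_scheme \<Rightarrow> 'a \<Rightarrow> 'a \<Rightarrow> 'a \<Rightarrow> 'a \<Rightarrow> bool" where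
  "pushout_sq C m n s t \<longleftrightarrow> comm_sq C m n s t \<and>
     (\<forall>z. \<forall>u\<in>hom C (Dom C n) z. \<forall>v\<in>hom C (Cod C m) z. u \<cdot>\<^bsub>C\<^esub> s = v \<cdot>\<^bsub>C\<^esub> m \<longrightarrow>
        (\<exists>!w. w \<in> hom C (Cod C n) z \<and> w \<cdot>\<^bsub>C\<^esub> n = u \<and> w \<cdot>\<^bsub>C\<^esub> t = v))"

record ('o, 'a, 'p, 'b) funct =
  FO :: "'o \<Rightarrow> 'p"
  FA :: "'a \<Rightarrow> 'b"

definition is_functor ::
  "('o, 'a) cat \<Rightarrow> ('p, 'b) cat \<Rightarrow> ('o, 'a, 'p, 'b) funct \<Rightarrow> bool" where
  "is_functor C D F \<longleftrightarrow>
     (\<forall>x\<in>Obj C. FO F x \<in> Obj D) \<and>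
     (\<forall>f\<in>Arr C. FA F f \<in> hom D (FO F (Dom C f)) (FO F (Cod C f))) \<and>
     (\<forall>x\<in>Obj C. FA F (Ident C x) = Ident D (FO F x)) \<and>
     (\<forall>f\<in>Arr C. \<forall>g\<in>Arr C. Dom C g = Cod C f \<longrightarrow>
        FA F (g \<cdot>\<^bsub>C\<^esub> f) = FA F g \<cdot>\<^bsub>D\<^esub> FA F f)"

definition id_funct :: "('o, 'a, 'o, 'a) funct" where
  "id_funct = \<lparr>FO = (\<lambda>x. x), FA = (\<lambda>f. f)\<rparr>"

definition comp_funct ::
  "('p, 'b, 'q, 'c) funct \<Rightarrow> ('o, 'a, 'p, 'b) funct \<Rightarrow> ('o, 'a, 'q, 'c) funct" where
  "comp_funct G F = \<lparr>FO = (\<lambda>x. FO G (FO F x)), FA = (\<lambda>f. FA G (FA F f))\<rparr>"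

definition nat_transf ::
  "('o, 'a) cat \<Rightarrow> ('p, 'b) cat \<Rightarrow> ('o, 'a, 'p, 'b) funct \<Rightarrow> ('o, 'a, 'p, 'b) funct
     \<Rightarrow> ('o \<Rightarrow> 'b) \<Rightarrow> bool" where
  "nat_transf C D F G \<alpha> \<longleftrightarrow> (\<forall>x\<in>Obj C. \<alpha> x \<in> hom D (FO F x) (FO G x)) \<and>
     (\<forall>f\<in>Arr C. FA G f \<cdot>\<^bsub>D\<^esub> \<alpha> (Dom C f) = \<alpha> (Cod C f) \<cdot>\<^bsub>D\<^esub> FA F f)"

definition cartesian_transf ::
  "('o, 'a) cat \<Rightarrow> ('p, 'b) cat \<Rightarrow> ('o, 'a, 'p, 'b) funct \<Rightarrow> ('o, 'a, 'p, 'b) funct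
     \<Rightarrow> ('o \<Rightarrow> 'b) \<Rightarrow> bool" where
  "cartesian_transf C D F G \<alpha> \<longleftrightarrow> nat_transf C D F G \<alpha> \<and>
     (\<forall>f\<in>Arr C. pullback_sq D (FA F f) (FA G f) (\<alpha> (Dom C f)) (\<alpha> (Cod C f)))"

definition preserves_pullbacks ::
  "('o, 'a) cat \<Rightarrow> ('p, 'b) cat \<Rightarrow> ('o, 'a, 'p, 'b) funct \<Rightarrow> bool" where
  "preserves_pullbacks C D F \<longleftrightarrow>
     (\<forall>m n s t. pullback_sq C m n s t \<longrightarrow> pullback_sq D (FA F m) (FA F n) (FA F s) (FA F t))"

text \<open>\<open>F : C \<rightarrow> D\<close> is left adjoint to \<open>G : D \<rightarrow> C\<close>, with unit \<open>\<eta>\<close> and counit \<open>\<epsilon>\<close>.\<close>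

definition adjunction ::
  "('o, 'a) cat \<Rightarrow> ('p, 'b) cat \<Rightarrow> ('o, 'a, 'p, 'b) funct \<Rightarrow> ('p, 'b, 'o, 'a) funct
     \<Rightarrow> ('o \<Rightarrow> 'a) \<Rightarrow> ('p \<Rightarrow> 'b) \<Rightarrow> bool" where
  "adjunction C D F G \<eta> \<epsilon> \<longleftrightarrow> is_functor C D F \<and> is_functor D C G \<and>
     nat_transf C C id_funct (comp_funct G F) \<eta> \<and>
     nat_transf D D (comp_funct F G) id_funct \<epsilon> \<and>
     (\<forall>x\<in>Obj C. \<epsilon> (FO F x) \<cdot>\<^bsub>D\<^esub> FA F (\<eta> x) = Ident D (FO F x)) \<and>
     (\<forall>y\<in>Obj D. FA G (\<epsilon> y) \<cdot>\<^bsub>C\<^esub> \<eta> (FO G y) = Ident C (FO G y))"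

definition has_right_adjoint ::
  "('o, 'a) cat \<Rightarrow> ('p, 'b) cat \<Rightarrow> ('o, 'a, 'p, 'b) funct \<Rightarrow> bool" where
  "has_right_adjoint C D F \<longleftrightarrow> (\<exists>G \<eta> \<epsilon>. adjunction C D F G \<eta> \<epsilon>)"

definition cocone ::
  "('j, 'i) cat \<Rightarrow> ('o, 'a) cat \<Rightarrow> ('j, 'i, 'o, 'a) funct \<Rightarrow> 'o \<Rightarrow> ('j \<Rightarrow> 'a) \<Rightarrow> bool" where
  "cocone J C D c \<kappa> \<longleftrightarrow> c \<in> Obj C \<and> (\<forall>j\<in>Obj J. \<kappa> j \<in> hom C (FO D j) c) \<and>
     (\<forall>u\<in>Arr J. \<kappa> (Cod J u) \<cdot>\<^bsub>C\<^esub> FA D u = \<kappa> (Dom J u))"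

definition is_colimit ::
  "('j, 'i) cat \<Rightarrow> ('o, 'a) cat \<Rightarrow> ('j, 'i, 'o, 'a) funct \<Rightarrow> 'o \<Rightarrow> ('j \<Rightarrow> 'a) \<Rightarrow> bool" where
  "is_colimit J C D c \<kappa> \<longleftrightarrow> cocone J C D c \<kappa> \<and>
     (\<forall>c' \<kappa>'. cocone J C D c' \<kappa>' \<longrightarrow>
        (\<exists>!h. h \<in> hom C c c' \<and> (\<forall>j\<in>Obj J. h \<cdot>\<^bsub>C\<^esub> \<kappa> j = \<kappa>' j)))"


section \<open>The universe of sets\<close>

text \<open>The category of sets consists of the subsets of a type \<open>'v\<close> whose cardinality is
  smaller than that of \<open>'v\<close>. The predicate \<open>universe\<close> says that the cardinality of \<open>'v\<close> is
  infinite, regular and a strong limit, so that these sets form, up to isomorphism, a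
  Grothendieck universe: \<open>'v\<close> is strongly inaccessible or countable, and in the latter case
  the small sets are the finite ones.\<close>

definition small :: "'v set \<Rightarrow> bool" where
  "small A \<longleftrightarrow> |A| <o |UNIV :: 'v set|"

definition universe :: "'v itself \<Rightarrow> bool" where
  "universe _ \<longleftrightarrow> infinite (UNIV :: 'v set) \<and> regularCard |UNIV :: 'v set| \<and>
     (\<forall>A :: 'v set. small A \<longrightarrow> |Pow A| <o |UNIV :: 'v set| )"

definition small_category :: "('v, 'v) cat \<Rightarrow> bool" where
  "small_category C \<longleftrightarrow> category C \<and> small (Obj C) \<and> small (Arr C)"

definition has_small_colimits :: "'v itself \<Rightarrow> ('o, 'a) cat \<Rightarrow> bool" where
  "has_small_colimits _ C \<longleftrightarrow>
     (\<forall>(J :: ('v, 'v) cat) D. small_category J \<longrightarrow> is_functor J C D \<longrightarrow>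
        (\<exists>c \<kappa>. is_colimit J C D c \<kappa>))"

definition preserves_small_colimits ::
  "'v itself \<Rightarrow> ('o, 'a) cat \<Rightarrow> ('p, 'b) cat \<Rightarrow> ('o, 'a, 'p, 'b) funct \<Rightarrow> bool" where
  "preserves_small_colimits _ C D F \<longleftrightarrow>
     (\<forall>(J :: ('v, 'v) cat) K c \<kappa>. small_category J \<longrightarrow> is_functor J C K \<longrightarrow>
        is_colimit J C K c \<kappa> \<longrightarrow>
        is_colimit J D (comp_funct F K) (FO F c) (\<lambda>j. FA F (\<kappa> j)))"


section \<open>Presheaves\<close>

text \<open>All data are extensional (\<open>undefined\<close> outside their domain), so that equality of
  presheaves and of natural transformations is the intended one.\<close>

record 'v psh =
  psh_ob :: "'v \<Rightarrow> 'v set"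
  psh_map :: "'v \<Rightarrow> 'v \<Rightarrow> 'v"

record 'v psh_arr =
  pa_dom :: "'v psh"
  pa_cod :: "'v psh"
  pa_comp :: "'v \<Rightarrow> 'v \<Rightarrow> 'v"

definition presheaf :: "('v, 'v) cat \<Rightarrow> 'v psh \<Rightarrow> bool" where
  "presheaf C F \<longleftrightarrow>
     psh_ob F \<in> extensional (Obj C) \<and> (\<forall>x\<in>Obj C. small (psh_ob F x)) \<and>
     psh_map F \<in> extensional (Arr C) \<and>
     (\<forall>f\<in>Arr C. psh_map F f \<in> psh_ob F (Cod C f) \<rightarrow>\<^sub>E psh_ob F (Dom C f)) \<and>
     (\<forall>x\<in>Obj C. \<forall>a\<in>psh_ob F x. psh_map F (Ident C x) a = a) \<and>
     (\<forall>f\<in>Arr C. \<forall>g\<in>Arr C. Dom C g = Cod C f \<longrightarrow>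
        (\<forall>a\<in>psh_ob F (Cod C g). psh_map F (g \<cdot>\<^bsub>C\<^esub> f) a = psh_map F f (psh_map F g a)))"

definition psh_morphism :: "('v, 'v) cat \<Rightarrow> 'v psh_arr \<Rightarrow> bool" where
  "psh_morphism C \<alpha> \<longleftrightarrow> presheaf C (pa_dom \<alpha>) \<and> presheaf C (pa_cod \<alpha>) \<and>
     pa_comp \<alpha> \<in> extensional (Obj C) \<and>
     (\<forall>x\<in>Obj C. pa_comp \<alpha> x \<in> psh_ob (pa_dom \<alpha>) x \<rightarrow>\<^sub>E psh_ob (pa_cod \<alpha>) x) \<and>
     (\<forall>f\<in>Arr C. \<forall>a\<in>psh_ob (pa_dom \<alpha>) (Cod C f).
        pa_comp \<alpha> (Dom C f) (psh_map (pa_dom \<alpha>) f a)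
          = psh_map (pa_cod \<alpha>) f (pa_comp \<alpha> (Cod C f) a))"

definition Psh :: "('v, 'v) cat \<Rightarrow> ('v psh, 'v psh_arr) cat" where
  "Psh C = \<lparr>Obj = {F. presheaf C F}, Arr = {\<alpha>. psh_morphism C \<alpha>},
     Dom = pa_dom, Cod = pa_cod,
     Ident = (\<lambda>F. \<lparr>pa_dom = F, pa_cod = F,
                pa_comp = (\<lambda>x\<in>Obj C. \<lambda>a\<in>psh_ob F x. a)\<rparr>),
     Comp = (\<lambda>\<beta> \<alpha>. \<lparr>pa_dom = pa_dom \<alpha>, pa_cod = pa_cod \<beta>,
                pa_comp = (\<lambda>x\<in>Obj C. \<lambda>a\<in>psh_ob (pa_dom \<alpha>) x.
                   pa_comp \<beta> x (pa_comp \<alpha> x a))\<rparr>)\<rparr>"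

definition yoneda :: "('v, 'v) cat \<Rightarrow> 'v \<Rightarrow> 'v psh" where
  "yoneda C x = \<lparr>psh_ob = (\<lambda>z\<in>Obj C. hom C z x),
     psh_map = (\<lambda>f\<in>Arr C. \<lambda>g\<in>hom C (Cod C f) x. g \<cdot>\<^bsub>C\<^esub> f)\<rparr>"

text \<open>The subpresheaf of \<open>F\<close> on the subsets \<open>U x\<close> of \<open>F x\<close> (which have to be stable under
  restriction), and its inclusion into \<open>F\<close>.\<close>

definition sub_psh :: "('v, 'v) cat \<Rightarrow> 'v psh \<Rightarrow> ('v \<Rightarrow> 'v set) \<Rightarrow> 'v psh" where
  "sub_psh C F U = \<lparr>psh_ob = (\<lambda>x\<in>Obj C. U x),
     psh_map = (\<lambda>f\<in>Arr C. restrict (psh_map F f) (U (Cod C f)))\<rparr>"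

definition sub_incl :: "('v, 'v) cat \<Rightarrow> 'v psh \<Rightarrow> ('v \<Rightarrow> 'v set) \<Rightarrow> 'v psh_arr" where
  "sub_incl C F U = \<lparr>pa_dom = sub_psh C F U, pa_cod = F,
     pa_comp = (\<lambda>x\<in>Obj C. \<lambda>a\<in>U x. a)\<rparr>"

definition terminal_psh :: "('v, 'v) cat \<Rightarrow> 'v psh" where
  "terminal_psh C = \<lparr>psh_ob = (\<lambda>x\<in>Obj C. {undefined}),
     psh_map = (\<lambda>f\<in>Arr C. \<lambda>a\<in>{undefined}. undefined)\<rparr>"

definition bang :: "('v, 'v) cat \<Rightarrow> 'v psh \<Rightarrow> 'v psh_arr" where
  "bang C F = \<lparr>pa_dom = F, pa_cod = terminal_psh C,
     pa_comp = (\<lambda>x\<in>Obj C. \<lambda>a\<in>psh_ob F x. undefined)\<rparr>"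

text \<open>Products need an injective coding of pairs in \<open>'v\<close>; one exists because \<open>'v\<close> is
  infinite.\<close>

definition pair_code :: "'v \<times> 'v \<Rightarrow> 'v" where
  "pair_code = (SOME e. inj e)"

definition prod_psh :: "('v, 'v) cat \<Rightarrow> 'v psh \<Rightarrow> 'v psh \<Rightarrow> 'v psh" where
  "prod_psh C F G = \<lparr>psh_ob = (\<lambda>x\<in>Obj C. pair_code ` (psh_ob F x \<times> psh_ob G x)),
     psh_map = (\<lambda>f\<in>Arr C. \<lambda>p\<in>pair_code ` (psh_ob F (Cod C f) \<times> psh_ob G (Cod C f)).
        pair_code (map_prod (psh_map F f) (psh_map G f) (inv pair_code p)))\<rparr>"

definition snd_psh :: "('v, 'v) cat \<Rightarrow> 'v psh \<Rightarrow> 'v psh \<Rightarrow> 'v psh_arr" where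
  "snd_psh C F G = \<lparr>pa_dom = prod_psh C F G, pa_cod = G,
     pa_comp = (\<lambda>x\<in>Obj C. \<lambda>p\<in>psh_ob (prod_psh C F G) x. snd (inv pair_code p))\<rparr>"

definition tuple_psh :: "('v, 'v) cat \<Rightarrow> 'v psh_arr \<Rightarrow> 'v psh_arr \<Rightarrow> 'v psh_arr" where
  "tuple_psh C \<alpha> \<beta> = \<lparr>pa_dom = pa_dom \<alpha>, pa_cod = prod_psh C (pa_cod \<alpha>) (pa_cod \<beta>),
     pa_comp = (\<lambda>x\<in>Obj C. \<lambda>a\<in>psh_ob (pa_dom \<alpha>) x.
        pair_code (pa_comp \<alpha> x a, pa_comp \<beta> x a))\<rparr>"


subsection \<open>The subobject classifier and its subobject \<open>K\<close>\<close>

text \<open>Subobjects of \<open>y(x)\<close> are represented by sieves on \<open>x\<close>.\<close>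

definition sieves :: "('v, 'v) cat \<Rightarrow> 'v \<Rightarrow> 'v set set" where
  "sieves C x = {S. S \<subseteq> {g \<in> Arr C. Cod C g = x} \<and>
     (\<forall>g\<in>S. \<forall>f\<in>Arr C. Cod C f = Dom C g \<longrightarrow> g \<cdot>\<^bsub>C\<^esub> f \<in> S)}"

definition sieve_incl :: "('v, 'v) cat \<Rightarrow> 'v \<Rightarrow> 'v set \<Rightarrow> 'v psh_arr" where
  "sieve_incl C x S = sub_incl C (yoneda C x) (\<lambda>z. {g \<in> S. Dom C g = z})"

definition sieve_pullback :: "('v, 'v) cat \<Rightarrow> 'v \<Rightarrow> 'v set \<Rightarrow> 'v set" where
  "sieve_pullback C f S = {g \<in> Arr C. Cod C g = Dom C f \<and> f \<cdot>\<^bsub>C\<^esub> g \<in> S}"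

text \<open>Sieves are sets of arrows; to be elements of a presheaf they are coded in \<open>'v\<close>, which
  is possible because a small set has only a small set of subsets.\<close>

definition sieve_code :: "('v, 'v) cat \<Rightarrow> 'v set \<Rightarrow> 'v" where
  "sieve_code C = (SOME e. inj_on e (Pow (Arr C)))"

definition Omega :: "('v, 'v) cat \<Rightarrow> 'v psh" where
  "Omega C = \<lparr>psh_ob = (\<lambda>x\<in>Obj C. sieve_code C ` sieves C x),
     psh_map = (\<lambda>f\<in>Arr C. \<lambda>a\<in>sieve_code C ` sieves C (Cod C f).
        sieve_code C (sieve_pullback C f (inv_into (Pow (Arr C)) (sieve_code C) a)))\<rparr>"

definition K_sub :: "('v, 'v) cat \<Rightarrow> 'v psh_arr set \<Rightarrow> 'v \<Rightarrow> 'v set" where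
  "K_sub C M x = sieve_code C ` {S \<in> sieves C x. sieve_incl C x S \<in> M}"

definition K_psh :: "('v, 'v) cat \<Rightarrow> 'v psh_arr set \<Rightarrow> 'v psh" where
  "K_psh C M = sub_psh C (Omega C) (K_sub C M)"

definition K_top :: "('v, 'v) cat \<Rightarrow> 'v psh_arr set \<Rightarrow> 'v psh_arr" where
  "K_top C M = \<lparr>pa_dom = terminal_psh C, pa_cod = K_psh C M,
     pa_comp = (\<lambda>x\<in>Obj C. \<lambda>a\<in>{undefined}. sieve_code C {g \<in> Arr C. Cod C g = x})\<rparr>"

definition t_map :: "('v, 'v) cat \<Rightarrow> 'v psh_arr set \<Rightarrow> 'v psh \<Rightarrow> 'v psh_arr" where
  "t_map C M Y = tuple_psh C (K_top C M \<cdot>\<^bsub>Psh C\<^esub> bang C Y) (Ident (Psh C) Y)"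

definition pi_map :: "('v, 'v) cat \<Rightarrow> 'v psh_arr set \<Rightarrow> 'v psh \<Rightarrow> 'v psh_arr" where
  "pi_map C M Y = snd_psh C (K_psh C M) Y"


section \<open>Functorial cylinders\<close>

text \<open>\<open>\<delta> k x\<close>, \<open>\<epsilon> x\<close> and \<open>c k x\<close> are the components at \<open>x\<close>, for \<open>k \<in> {0, 1}\<close>.\<close>

definition functorial_cylinder ::
  "('o, 'a) cat \<Rightarrow> ('o, 'a, 'o, 'a) funct \<Rightarrow> (nat \<Rightarrow> 'o \<Rightarrow> 'a) \<Rightarrow> bool" where
  "functorial_cylinder E I \<delta> \<longleftrightarrow> is_functor E E I \<and> (\<forall>k\<in>{0, 1}. nat_transf E E id_funct I (\<delta> k))"

definition contractions ::
  "('o, 'a) cat \<Rightarrow> ('o, 'a, 'o, 'a) funct \<Rightarrow> (nat \<Rightarrow> 'o \<Rightarrow> 'a) \<Rightarrow> ('o \<Rightarrow> 'a) \<Rightarrow> bool" where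
  "contractions E I \<delta> \<epsilon> \<longleftrightarrow> nat_transf E E I id_funct \<epsilon> \<and>
     (\<forall>k\<in>{0, 1}. \<forall>x\<in>Obj E. \<epsilon> x \<cdot>\<^bsub>E\<^esub> \<delta> k x = Ident E x)"

definition connections ::
  "('o, 'a) cat \<Rightarrow> ('o, 'a, 'o, 'a) funct \<Rightarrow> (nat \<Rightarrow> 'o \<Rightarrow> 'a) \<Rightarrow> ('o \<Rightarrow> 'a)
     \<Rightarrow> (nat \<Rightarrow> 'o \<Rightarrow> 'a) \<Rightarrow> bool" where
  "connections E I \<delta> \<epsilon> c \<longleftrightarrow> (\<forall>k\<in>{0, 1}. nat_transf E E (comp_funct I I) I (c k) \<and>
     (\<forall>x\<in>Obj E.
        c k x \<cdot>\<^bsub>E\<^esub> \<delta> k (FO I x) = \<delta> k x \<cdot>\<^bsub>E\<^esub> \<epsilon> x \<and>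
        c k x \<cdot>\<^bsub>E\<^esub> FA I (\<delta> k x) = \<delta> k x \<cdot>\<^bsub>E\<^esub> \<epsilon> x \<and>
        c k x \<cdot>\<^bsub>E\<^esub> \<delta> (1 - k) (FO I x) = Ident E (FO I x) \<and>
        c k x \<cdot>\<^bsub>E\<^esub> FA I (\<delta> (1 - k) x) = Ident E (FO I x)))"

text \<open>\<open>l\<close> is the Leibniz product of \<open>\<delta>\<^sup>k\<close> and \<open>i : A \<rightarrow> B\<close>, for some choice \<open>(u, v)\<close> of the
  pushout of \<open>\<delta>\<^sup>k \<otimes> A\<close> and \<open>i\<close>.\<close>

definition leibniz_product ::
  "('o, 'a) cat \<Rightarrow> ('o, 'a, 'o, 'a) funct \<Rightarrow> ('o \<Rightarrow> 'a) \<Rightarrow> 'a \<Rightarrow> 'a \<Rightarrow> bool" where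
  "leibniz_product E I d i l \<longleftrightarrow> (\<exists>u v. pushout_sq E i u (d (Dom E i)) v \<and>
     l \<in> hom E (Cod E u) (FO I (Cod E i)) \<and>
     l \<cdot>\<^bsub>E\<^esub> u = FA I i \<and> l \<cdot>\<^bsub>E\<^esub> v = d (Cod E i))"


section \<open>The category of arrows and pullback squares\<close>

definition cart_arrows :: "('o, 'a) cat \<Rightarrow> ('a, 'a \<times> 'a \<times> 'a \<times> 'a) cat" where
  "cart_arrows E = \<lparr>Obj = Arr E, Arr = {(m, n, a, b). pullback_sq E m n a b},
     Dom = (\<lambda>(m, n, a, b). m), Cod = (\<lambda>(m, n, a, b). n),
     Ident = (\<lambda>m. (m, m, Ident E (Dom E m), Ident E (Cod E m))),
     Comp = (\<lambda>(m', n', a', b') (m, n, a, b). (m, n', a' \<cdot>\<^bsub>E\<^esub> a, b' \<cdot>\<^bsub>E\<^esub> b))\<rparr>"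

text \<open>A full subcategory of \<open>cart_arrows E\<close> is given by its set \<open>M\<close> of objects. Colimits are
  those of diagrams that are small with respect to the universe \<open>'v\<close>.\<close>

definition admissible ::
  "'v itself \<Rightarrow> ('o, 'a) cat \<Rightarrow> ('o, 'a, 'o, 'a) funct \<Rightarrow> (nat \<Rightarrow> 'o \<Rightarrow> 'a) \<Rightarrow> 'a set \<Rightarrow> bool" where
  "admissible U E I \<delta> M \<longleftrightarrow> M \<subseteq> Arr E \<and>
     (\<forall>m\<in>M. monic E m) \<and>
     (\<forall>z x h. is_initial E z \<longrightarrow> h \<in> hom E z x \<longrightarrow> h \<in> M) \<and>
     (\<forall>m n s t. n \<in> M \<longrightarrow> pullback_sq E m n s t \<longrightarrow> m \<in> M) \<and>
     (\<forall>k\<in>{0, 1}. \<forall>i\<in>M. \<forall>l. leibniz_product E I (\<delta> k) i l \<longrightarrow> l \<in> M) \<and>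
     has_small_colimits U (full_subcat (cart_arrows E) M) \<and>
     preserves_small_colimits U (full_subcat (cart_arrows E) M) (cart_arrows E) id_funct"


section \<open>Slices\<close>

text \<open>An arrow of \<open>E/Y\<close> is a triple \<open>(f, g, h)\<close> with \<open>g \<circ> h = f\<close>.\<close>

definition slice :: "('o, 'a) cat \<Rightarrow> 'o \<Rightarrow> ('a, 'a \<times> 'a \<times> 'a) cat" where
  "slice E Y = \<lparr>Obj = {f \<in> Arr E. Cod E f = Y},
     Arr = {(f, g, h). f \<in> Arr E \<and> Cod E f = Y \<and> g \<in> Arr E \<and> Cod E g = Y \<and>
              h \<in> hom E (Dom E f) (Dom E g) \<and> g \<cdot>\<^bsub>E\<^esub> h = f},
     Dom = (\<lambda>(f, g, h). f), Cod = (\<lambda>(f, g, h). g),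
     Ident = (\<lambda>f. (f, f, Ident E (Dom E f))),
     Comp = (\<lambda>(f', g', h') (f, g, h). (f, g', h' \<cdot>\<^bsub>E\<^esub> h))\<rparr>"

definition under :: "'a \<times> 'a \<times> 'a \<Rightarrow> 'a" where
  "under = (\<lambda>(f, g, h). h)"

definition postcomp :: "('o, 'a) cat \<Rightarrow> 'a \<Rightarrow> ('a, 'a \<times> 'a \<times> 'a, 'a, 'a \<times> 'a \<times> 'a) funct" where
  "postcomp E p = \<lparr>FO = (\<lambda>f. p \<cdot>\<^bsub>E\<^esub> f), FA = (\<lambda>(f, g, h). (p \<cdot>\<^bsub>E\<^esub> f, p \<cdot>\<^bsub>E\<^esub> g, h))\<rparr>"

text \<open>\<open>T\<close> is the functor of pullback along \<open>t\<close>, for the choice of pullbacks with upper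
  projections \<open>pr g\<close>.\<close>

definition pullback_functor ::
  "('o, 'a) cat \<Rightarrow> 'a \<Rightarrow> ('a, 'a \<times> 'a \<times> 'a, 'a, 'a \<times> 'a \<times> 'a) funct \<Rightarrow> ('a \<Rightarrow> 'a) \<Rightarrow> bool" where
  "pullback_functor E t T pr \<longleftrightarrow>
     is_functor (slice E (Cod E t)) (slice E (Dom E t)) T \<and>
     (\<forall>g\<in>Obj (slice E (Cod E t)). pullback_sq E (FO T g) g (pr g) t) \<and>
     (\<forall>(g, g', h)\<in>Arr (slice E (Cod E t)).
        pr g' \<cdot>\<^bsub>E\<^esub> under (FA T (g, g', h)) = h \<cdot>\<^bsub>E\<^esub> pr g)"

text \<open>The partial map classifier is the composite of the right adjoint \<open>R\<close> of pullback along
  \<open>t\<close> with postcomposition with the projection. Its unit at \<open>f\<close> is the top of the pullback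
  square from \<open>f\<close> to \<open>R f\<close> obtained from the chosen pullback of \<open>R f\<close> along \<open>t\<close> by means of
  the inverse of the (invertible) counit \<open>\<epsilon> : t\<^sup>* R \<Rightarrow> Id\<close>.\<close>

definition pmc ::
  "('v, 'v) cat \<Rightarrow> 'v psh_arr set \<Rightarrow> 'v psh \<Rightarrow>
     ('v psh_arr, 'v psh_arr \<times> 'v psh_arr \<times> 'v psh_arr,
      'v psh_arr, 'v psh_arr \<times> 'v psh_arr \<times> 'v psh_arr) funct \<Rightarrow>
     ('v psh_arr, 'v psh_arr \<times> 'v psh_arr \<times> 'v psh_arr,
      'v psh_arr, 'v psh_arr \<times> 'v psh_arr \<times> 'v psh_arr) funct" where
  "pmc C M Y R = comp_funct (postcomp (Psh C) (pi_map C M Y)) R"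

definition pmc_unit ::
  "('o, 'a) cat \<Rightarrow> ('a \<Rightarrow> 'a) \<Rightarrow> ('a, 'a \<times> 'a \<times> 'a, 'a, 'a \<times> 'a \<times> 'a) funct
     \<Rightarrow> ('a \<Rightarrow> 'a \<times> 'a \<times> 'a) \<Rightarrow> 'a \<Rightarrow> 'a" where
  "pmc_unit E pr R \<epsilon> f =
     pr (FO R f) \<cdot>\<^bsub>E\<^esub> under (inv_arr (slice E (Cod E f)) (\<epsilon> f))"


section \<open>Uniform trivial fibrations\<close>

definition fillers :: "('o, 'a) cat \<Rightarrow> 'a \<Rightarrow> 'a \<Rightarrow> 'a \<Rightarrow> 'a \<Rightarrow> 'a set" where
  "fillers E m f s t =
     {d \<in> hom E (Cod E m) (Dom E f). d \<cdot>\<^bsub>E\<^esub> m = s \<and> f \<cdot>\<^bsub>E\<^esub> d = t}"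

text \<open>The right \<open>M\<close>-map structures on \<open>f\<close>; they are \<open>undefined\<close> outside squares from elements
  of \<open>M\<close> to \<open>f\<close>.\<close>

definition right_map_structures ::
  "('o, 'a) cat \<Rightarrow> 'a set \<Rightarrow> 'a \<Rightarrow> ('a \<Rightarrow> 'a \<Rightarrow> 'a \<Rightarrow> 'a) set" where
  "right_map_structures E M f = {\<phi>.
     (\<forall>m s t. if m \<in> M \<and> comm_sq E m f s t then \<phi> m s t \<in> fillers E m f s t
              else \<phi> m s t = undefined) \<and>
     (\<forall>m\<in>M. \<forall>m'\<in>M. \<forall>a b s t. pullback_sq E m m' a b \<longrightarrow> comm_sq E m' f s t \<longrightarrow>
        \<phi> m' s t \<cdot>\<^bsub>E\<^esub> b = \<phi> m (s \<cdot>\<^bsub>E\<^esub> a) (t \<cdot>\<^bsub>E\<^esub> b))}"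

definition retractions :: "('o, 'a, 'z) cat_scheme \<Rightarrow> 'a \<Rightarrow> 'a set" where
  "retractions C s = {r \<in> hom C (Cod C s) (Dom C s). r \<cdot>\<^bsub>C\<^esub> s = Ident C (Dom C s)}"

end

theory Submission
  imports Defs
begin

text \<open>
  The arrow \<open>\<eta> : X \<rightarrow> P\<close> is the generic element of \<open>M\<close> lying over \<open>f\<close>: for every \<open>m : A \<rightarrow> B\<close> in \<open>M\<close>
  and every square \<open>(s, b)\<close> from \<open>m\<close> to \<open>f\<close> there is exactly one \<open>c : B \<rightarrow> P\<close> over \<open>b\<close> such that
  \<open>(s, c)\<close> is a pullback square from \<open>m\<close> to \<open>\<eta>\<close>. Given this, the correspondence is an instance of
  the Yoneda argument (\<open>generic_filler_bij\<close>): uniformity with respect to the square \<open>(s, c)\<close> forces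
  the filler for \<open>(s, b)\<close> to be \<open>d \<cdot> c\<close>, where \<open>d\<close> is the filler at \<open>\<eta>\<close>; conversely, for any filler
  \<open>d\<close> at \<open>\<eta>\<close>, the composites \<open>d \<cdot> c\<close> are fillers, and they are uniform because pullback squares paste
  and the arrows \<open>c\<close> are unique. A filler at \<open>\<eta>\<close> is by definition a retraction of \<open>\<eta>\<close> over \<open>Y\<close>.

  The universal property of \<open>\<eta>\<close> combines two others. The lemma \<open>M_classified\<close> says that \<open>m\<close> is a
  pullback of \<open>t : Y \<rightarrow> K \<times> Y\<close> along exactly one \<open>g\<close> over \<open>b\<close>. The lemma \<open>classify\<close> says that lifts
  of \<open>g\<close> through \<open>t\<^sub>* f\<close> are the same as arrows \<open>s : A \<rightarrow> X\<close> over \<open>Y\<close>. The latter is the adjunction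
  between pullback along \<open>t\<close> and its right adjoint, rewritten with \<open>X\<close> in place of the pullback of
  \<open>t\<^sub>* f\<close> along \<open>t\<close>; the two agree because \<open>t\<close> is monic, which makes the counit invertible
  (\<open>counit_inverse\<close>).

  Classification needs that \<open>M\<close> is determined by the sieves in it. One direction is stability under
  pullback. The other is the locality principle \<open>M_local\<close>: if all pullbacks of a monomorphism \<open>n\<close>
  along elements of its codomain are in \<open>M\<close>, then the colimit in \<open>M\<close> of the diagram of these
  pullbacks receives a pullback square from \<open>n\<close>, so that \<open>n\<close> is in \<open>M\<close>. In particular \<open>t\<close>, whose
  pullback along an element \<open>(S, y)\<close> is the sieve \<open>S\<close>, is in \<open>M\<close>, and hence so is its pullback
  \<open>\<eta>\<close>.

  For \<open>t\<close> to exist, maximal sieves have to be elements of \<open>K\<close>, that is, identities of representables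
  have to be in \<open>M\<close>. This is where the cylinder enters: the endpoint inclusion at \<open>X\<close> is the
  Leibniz product with \<open>0 \<rightarrow> X\<close>, and the identity of \<open>X\<close> is the pullback of this monomorphism along
  itself (\<open>admissible_monic_class\<close>).
\<close>

section \<open>Categories, pullbacks and adjunctions\<close>

locale cat =
  fixes E :: "('o, 'a) cat" (structure)
  assumes cat: "category E"
begin

lemma comp_hom: "f \<in> hom E x y \<Longrightarrow> g \<in> hom E y z \<Longrightarrow> g \<cdot> f \<in> hom E x z"
  using cat unfolding category_def hom_def by fastforce

lemma comp_assoc:
  "f \<in> hom E x y \<Longrightarrow> g \<in> hom E y z \<Longrightarrow> h \<in> hom E z w \<Longrightarrow> (h \<cdot> g) \<cdot> f = h \<cdot> (g \<cdot> f)"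
  using cat unfolding category_def hom_def by fastforce

lemma comp_ident: "f \<in> hom E x y \<Longrightarrow> f \<cdot> Ident E x = f"
  and ident_comp: "f \<in> hom E x y \<Longrightarrow> Ident E y \<cdot> f = f"
  using cat unfolding category_def hom_def by fastforce+

lemma ident_hom: "x \<in> Obj E \<Longrightarrow> Ident E x \<in> hom E x x"
  using cat unfolding category_def by blast

lemma hom_Obj: "f \<in> hom E x y \<Longrightarrow> x \<in> Obj E \<and> y \<in> Obj E"
  using cat unfolding category_def hom_def by auto

lemma arr_hom: "f \<in> Arr E \<Longrightarrow> f \<in> hom E (Dom E f) (Cod E f)"
  by (simp add: hom_def)

lemma comm_sq_iff:
  assumes "m \<in> hom E a b" "n \<in> hom E c d"
  shows "comm_sq E m n s t \<longleftrightarrow> s \<in> hom E a c \<and> t \<in> hom E b d \<and> n \<cdot> s = t \<cdot> m"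
  using assms by (auto simp: comm_sq_def hom_def)

lemma pullback_sq_iff:
  assumes "m \<in> hom E a b" "n \<in> hom E c d"
  shows "pullback_sq E m n s t \<longleftrightarrow> s \<in> hom E a c \<and> t \<in> hom E b d \<and> n \<cdot> s = t \<cdot> m \<and>
    (\<forall>z. \<forall>u\<in>hom E z c. \<forall>v\<in>hom E z b. n \<cdot> u = t \<cdot> v \<longrightarrow>
        (\<exists>!w. w \<in> hom E z a \<and> s \<cdot> w = u \<and> m \<cdot> w = v))"
proof -
  have "Dom E m = a" "Cod E m = b" "Dom E n = c" using assms by (auto simp: hom_def)
  then show ?thesis
    unfolding pullback_sq_def comm_sq_iff[OF assms] by auto
qed

text \<open>A pullback square may be read in both directions; which side is called the left one matters
  when \<open>f\<close> is regarded as a pullback of \<open>rho\<close> and \<open>\<eta>\<close> as a pullback of \<open>t\<close>.\<close>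

lemma pullback_sq_transpose:
  assumes "pullback_sq E m n s t"
  shows "pullback_sq E s t m n"
proof -
  have c: "m \<in> Arr E" "n \<in> Arr E" "s \<in> hom E (Dom E m) (Dom E n)" "t \<in> hom E (Cod E m) (Cod E n)"
    "n \<cdot> s = t \<cdot> m"
    using assms unfolding pullback_sq_def comm_sq_def by auto
  have m: "m \<in> hom E (Dom E m) (Cod E m)" and n: "n \<in> hom E (Dom E n) (Cod E n)"
    using c arr_hom by auto
  show ?thesis
    unfolding pullback_sq_iff[OF c(3,4)]
  proof (intro conjI allI ballI impI)
    fix z u v assume "u \<in> hom E z (Cod E m)" "v \<in> hom E z (Dom E n)" "t \<cdot> u = n \<cdot> v"
    then have "\<exists>!w. w \<in> hom E z (Dom E m) \<and> s \<cdot> w = v \<and> m \<cdot> w = u"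
      using assms unfolding pullback_sq_iff[OF m n] by auto
    then show "\<exists>!w. w \<in> hom E z (Dom E m) \<and> m \<cdot> w = u \<and> s \<cdot> w = v"
      by (simp add: conj_commute)
  qed (use c m n in auto)
qed

lemma monicD:
  "monic E m \<Longrightarrow> m \<in> hom E a b \<Longrightarrow> u \<in> hom E x a \<Longrightarrow> v \<in> hom E x a \<Longrightarrow> m \<cdot> u = m \<cdot> v \<Longrightarrow> u = v"
  unfolding monic_def by (auto simp: hom_def)

lemma pullback_monic:
  assumes "pullback_sq E m n s t" "monic E t"
  shows "monic E s"
  unfolding monic_def
proof (intro conjI allI ballI impI)
  have c: "m \<in> Arr E" "n \<in> Arr E" "s \<in> hom E (Dom E m) (Dom E n)" "t \<in> hom E (Cod E m) (Cod E n)"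
    "n \<cdot> s = t \<cdot> m"
    using assms unfolding pullback_sq_def comm_sq_def by auto
  have m: "m \<in> hom E (Dom E m) (Cod E m)" and n: "n \<in> hom E (Dom E n) (Cod E n)"
    using c arr_hom by auto
  show "s \<in> Arr E" using c by (simp add: hom_def)
  have ds: "Dom E s = Dom E m" using c by (simp add: hom_def)
  fix x u v assume uv: "u \<in> hom E x (Dom E s)" "v \<in> hom E x (Dom E s)" "s \<cdot> u = s \<cdot> v"
  have u: "u \<in> hom E x (Dom E m)" and v: "v \<in> hom E x (Dom E m)" using uv ds by auto
  have "t \<cdot> (m \<cdot> u) = n \<cdot> (s \<cdot> u)"
    using comp_assoc[OF u m c(4)] comp_assoc[OF u c(3) n] c(5) by simp
  also have "\<dots> = t \<cdot> (m \<cdot> v)"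
    using comp_assoc[OF v m c(4)] comp_assoc[OF v c(3) n] c(5) uv by simp
  finally have mm: "m \<cdot> u = m \<cdot> v"
    using monicD[OF assms(2) c(4) comp_hom[OF u m] comp_hom[OF v m]] by simp
  have "\<exists>!w. w \<in> hom E x (Dom E m) \<and> s \<cdot> w = s \<cdot> u \<and> m \<cdot> w = m \<cdot> u"
    using assms(1) comp_hom[OF u c(3)] comp_hom[OF u m]
      comp_assoc[OF u m c(4)] comp_assoc[OF u c(3) n] c(5)
    unfolding pullback_sq_iff[OF m n] by auto
  then show "u = v" using u v uv mm by metis
qed

text \<open>The two halves of the pasting law for horizontally adjacent squares with common side \<open>n\<close>.\<close>

lemma pullback_paste:
  assumes pb1: "pullback_sq E m n s t" and pb2: "pullback_sq E n k u v"
  shows "pullback_sq E m k (u \<cdot> s) (v \<cdot> t)"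
proof -
  have c1: "m \<in> Arr E" "n \<in> Arr E" "s \<in> hom E (Dom E m) (Dom E n)" "t \<in> hom E (Cod E m) (Cod E n)"
    "n \<cdot> s = t \<cdot> m"
    using pb1 unfolding pullback_sq_def comm_sq_def by auto
  have c2: "k \<in> Arr E" "u \<in> hom E (Dom E n) (Dom E k)" "v \<in> hom E (Cod E n) (Cod E k)"
    "k \<cdot> u = v \<cdot> n"
    using pb2 unfolding pullback_sq_def comm_sq_def by auto
  note m = arr_hom[OF c1(1)] and n = arr_hom[OF c1(2)] and k = arr_hom[OF c2(1)]
  show ?thesis
    unfolding pullback_sq_iff[OF m k]
  proof (intro conjI allI ballI impI)
    show "u \<cdot> s \<in> hom E (Dom E m) (Dom E k)" "v \<cdot> t \<in> hom E (Cod E m) (Cod E k)"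
      using comp_hom c1 c2 by blast+
    show "k \<cdot> (u \<cdot> s) = (v \<cdot> t) \<cdot> m"
      using comp_assoc[OF c1(3) c2(2) k] comp_assoc[OF c1(3) n c2(3)] comp_assoc[OF m c1(4) c2(3)]
        c1(5) c2(4) by simp
    fix z p q assume p: "p \<in> hom E z (Dom E k)" and q: "q \<in> hom E z (Cod E m)"
      and e: "k \<cdot> p = (v \<cdot> t) \<cdot> q"
    note tq = comp_hom[OF q c1(4)]
    have "k \<cdot> p = v \<cdot> (t \<cdot> q)" using e comp_assoc[OF q c1(4) c2(3)] by simp
    then obtain w where w: "w \<in> hom E z (Dom E n)" "u \<cdot> w = p" "n \<cdot> w = t \<cdot> q"
      and wu: "\<And>w'. w' \<in> hom E z (Dom E n) \<Longrightarrow> u \<cdot> w' = p \<Longrightarrow> n \<cdot> w' = t \<cdot> q \<Longrightarrow> w' = w"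
      using pb2 p tq unfolding pullback_sq_iff[OF n k] by blast
    obtain x where x: "x \<in> hom E z (Dom E m)" "s \<cdot> x = w" "m \<cdot> x = q"
      and xu: "\<And>x'. x' \<in> hom E z (Dom E m) \<Longrightarrow> s \<cdot> x' = w \<Longrightarrow> m \<cdot> x' = q \<Longrightarrow> x' = x"
      using pb1 w q unfolding pullback_sq_iff[OF m n] by blast
    show "\<exists>!w. w \<in> hom E z (Dom E m) \<and> (u \<cdot> s) \<cdot> w = p \<and> m \<cdot> w = q"
    proof (intro ex1I[of _ x] conjI)
      show "(u \<cdot> s) \<cdot> x = p" using comp_assoc[OF x(1) c1(3) c2(2)] x w by simp
    next
      fix x' assume a: "x' \<in> hom E z (Dom E m) \<and> (u \<cdot> s) \<cdot> x' = p \<and> m \<cdot> x' = q"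
      then have x': "x' \<in> hom E z (Dom E m)" by simp
      have "s \<cdot> x' = w"
        using a wu[OF comp_hom[OF x' c1(3)]] comp_assoc[OF x' c1(3) c2(2)]
          comp_assoc[OF x' c1(3) n] comp_assoc[OF x' m c1(4)] c1(5) by simp
      then show "x' = x" using xu a by simp
    qed (use x in auto)
  qed
qed

lemma pullback_cancel:
  assumes pb: "pullback_sq E m k (u \<cdot> s) (v \<cdot> t)" and pb2: "pullback_sq E n k u v"
    and sq: "comm_sq E m n s t"
  shows "pullback_sq E m n s t"
proof -
  have c1: "m \<in> Arr E" "n \<in> Arr E" "s \<in> hom E (Dom E m) (Dom E n)" "t \<in> hom E (Cod E m) (Cod E n)"
    "n \<cdot> s = t \<cdot> m"
    using sq unfolding comm_sq_def by auto
  have c2: "k \<in> Arr E" "u \<in> hom E (Dom E n) (Dom E k)" "v \<in> hom E (Cod E n) (Cod E k)"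
    "k \<cdot> u = v \<cdot> n"
    using pb2 unfolding pullback_sq_def comm_sq_def by auto
  note m = arr_hom[OF c1(1)] and n = arr_hom[OF c1(2)] and k = arr_hom[OF c2(1)]
  show ?thesis
    unfolding pullback_sq_iff[OF m n]
  proof (intro conjI allI ballI impI)
    fix z p q assume p: "p \<in> hom E z (Dom E n)" and q: "q \<in> hom E z (Cod E m)"
      and e: "n \<cdot> p = t \<cdot> q"
    note tq = comp_hom[OF q c1(4)] and up = comp_hom[OF p c2(2)]
    have kup: "k \<cdot> (u \<cdot> p) = (v \<cdot> t) \<cdot> q"
      using comp_assoc[OF p c2(2) k] comp_assoc[OF p n c2(3)] comp_assoc[OF q c1(4) c2(3)] c2(4) e
      by simp
    then obtain x where x: "x \<in> hom E z (Dom E m)" "(u \<cdot> s) \<cdot> x = u \<cdot> p" "m \<cdot> x = q"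
      and xu: "\<And>x'. x' \<in> hom E z (Dom E m) \<Longrightarrow> (u \<cdot> s) \<cdot> x' = u \<cdot> p \<Longrightarrow> m \<cdot> x' = q \<Longrightarrow> x' = x"
      using pb up q unfolding pullback_sq_iff[OF m k] by blast
    have sx: "s \<cdot> x \<in> hom E z (Dom E n)" "u \<cdot> (s \<cdot> x) = u \<cdot> p" "n \<cdot> (s \<cdot> x) = n \<cdot> p"
      using comp_hom[OF x(1) c1(3)] comp_assoc[OF x(1) c1(3) c2(2)] x
        comp_assoc[OF x(1) c1(3) n] comp_assoc[OF x(1) m c1(4)] c1(5) e by simp_all
    have np: "n \<cdot> p \<in> hom E z (Cod E n)" using comp_hom[OF p n] .
    have "k \<cdot> (u \<cdot> p) = v \<cdot> (n \<cdot> p)"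
      using comp_assoc[OF p c2(2) k] comp_assoc[OF p n c2(3)] c2(4) by simp
    then have "\<exists>!w. w \<in> hom E z (Dom E n) \<and> u \<cdot> w = u \<cdot> p \<and> n \<cdot> w = n \<cdot> p"
      using pb2 up np unfolding pullback_sq_iff[OF n k] by blast
    then have "s \<cdot> x = p" using sx p by blast
    moreover have "x' = x" if "x' \<in> hom E z (Dom E m)" "s \<cdot> x' = p" "m \<cdot> x' = q" for x'
      using xu[OF that(1) _ that(3)] comp_assoc[OF that(1) c1(3) c2(2)] that(2) by simp
    ultimately show "\<exists>!w. w \<in> hom E z (Dom E m) \<and> s \<cdot> w = p \<and> m \<cdot> w = q"
      using x(1,3) by (intro ex1I[of _ x]) blast+
  qed (use c1 in auto)
qed

end

text \<open>Transposition along an adjunction is bijective: by the triangle identities, \<open>s\<close> has the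
  transpose \<open>G s \<cdot> \<eta>\<close> and no other.\<close>

lemma adjunction_transpose:
  assumes C: "category C" and D: "category D" and adj: "adjunction C D F G \<eta> \<epsilon>"
    and x: "x \<in> Obj C" and y: "y \<in> Obj D" and s: "s \<in> hom D (FO F x) y"
  shows "\<exists>!b. b \<in> hom C x (FO G y) \<and> \<epsilon> y \<cdot>\<^bsub>D\<^esub> FA F b = s"
proof -
  interpret C: cat C by (rule cat.intro) (rule C)
  interpret D: cat D by (rule cat.intro) (rule D)
  have F: "is_functor C D F" and G: "is_functor D C G"
    and u: "nat_transf C C id_funct (comp_funct G F) \<eta>"
    and e: "nat_transf D D (comp_funct F G) id_funct \<epsilon>"
    and tri1: "\<And>x. x \<in> Obj C \<Longrightarrow> \<epsilon> (FO F x) \<cdot>\<^bsub>D\<^esub> FA F (\<eta> x) = Ident D (FO F x)"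
    and tri2: "\<And>y. y \<in> Obj D \<Longrightarrow> FA G (\<epsilon> y) \<cdot>\<^bsub>C\<^esub> \<eta> (FO G y) = Ident C (FO G y)"
    using adj unfolding adjunction_def by auto
  have FOo: "FO F x \<in> Obj D" if "x \<in> Obj C" for x using F that unfolding is_functor_def by blast
  have GOo: "FO G x \<in> Obj C" if "x \<in> Obj D" for x using G that unfolding is_functor_def by blast
  have Fh: "FA F f \<in> hom D (FO F a) (FO F b)" if "f \<in> hom C a b" for f a b
    using F that unfolding is_functor_def hom_def by auto
  have Gh: "FA G f \<in> hom C (FO G a) (FO G b)" if "f \<in> hom D a b" for f a b
    using G that unfolding is_functor_def hom_def by auto
  have Fc: "FA F (g \<cdot>\<^bsub>C\<^esub> f) = FA F g \<cdot>\<^bsub>D\<^esub> FA F f" if "f \<in> hom C a b" "g \<in> hom C b c" for f g a b c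
    using F that unfolding is_functor_def hom_def by auto
  have Gc: "FA G (g \<cdot>\<^bsub>D\<^esub> f) = FA G g \<cdot>\<^bsub>C\<^esub> FA G f" if "f \<in> hom D a b" "g \<in> hom D b c" for f g a b c
    using G that unfolding is_functor_def hom_def by auto
  have uh: "\<eta> x \<in> hom C x (FO G (FO F x))" if "x \<in> Obj C" for x
    using u that unfolding nat_transf_def id_funct_def comp_funct_def by auto
  have eh: "\<epsilon> y \<in> hom D (FO F (FO G y)) y" if "y \<in> Obj D" for y
    using e that unfolding nat_transf_def id_funct_def comp_funct_def by auto
  have un: "FA G (FA F f) \<cdot>\<^bsub>C\<^esub> \<eta> a = \<eta> b \<cdot>\<^bsub>C\<^esub> f" if "f \<in> hom C a b" for f a b
    using u that unfolding nat_transf_def id_funct_def comp_funct_def hom_def by auto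
  have en: "f \<cdot>\<^bsub>D\<^esub> \<epsilon> a = \<epsilon> b \<cdot>\<^bsub>D\<^esub> FA F (FA G f)" if "f \<in> hom D a b" for f a b
    using e that unfolding nat_transf_def id_funct_def comp_funct_def hom_def by auto
  note Gs = Gh[OF s] and Fu = Fh[OF uh[OF x]]
  show ?thesis
  proof (rule ex1I[of _ "FA G s \<cdot>\<^bsub>C\<^esub> \<eta> x"], rule conjI)
    show "FA G s \<cdot>\<^bsub>C\<^esub> \<eta> x \<in> hom C x (FO G y)"
      using C.comp_hom[OF uh[OF x] Gs] .
    have "\<epsilon> y \<cdot>\<^bsub>D\<^esub> FA F (FA G s \<cdot>\<^bsub>C\<^esub> \<eta> x) = \<epsilon> y \<cdot>\<^bsub>D\<^esub> (FA F (FA G s) \<cdot>\<^bsub>D\<^esub> FA F (\<eta> x))"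
      using Fc[OF uh[OF x] Gs] by simp
    also have "\<dots> = (\<epsilon> y \<cdot>\<^bsub>D\<^esub> FA F (FA G s)) \<cdot>\<^bsub>D\<^esub> FA F (\<eta> x)"
      using D.comp_assoc[OF Fu Fh[OF Gs] eh[OF y]] by simp
    also have "\<dots> = (s \<cdot>\<^bsub>D\<^esub> \<epsilon> (FO F x)) \<cdot>\<^bsub>D\<^esub> FA F (\<eta> x)" using en[OF s] by simp
    also have "\<dots> = s" 
      using D.comp_assoc[OF Fu eh[OF FOo[OF x]] s] tri1[OF x] D.comp_ident[OF s] by simp
    finally show "\<epsilon> y \<cdot>\<^bsub>D\<^esub> FA F (FA G s \<cdot>\<^bsub>C\<^esub> \<eta> x) = s" .
  next
    fix b assume a: "b \<in> hom C x (FO G y) \<and> \<epsilon> y \<cdot>\<^bsub>D\<^esub> FA F b = s"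
    then have b: "b \<in> hom C x (FO G y)" by simp
    have "FA G s \<cdot>\<^bsub>C\<^esub> \<eta> x = (FA G (\<epsilon> y) \<cdot>\<^bsub>C\<^esub> FA G (FA F b)) \<cdot>\<^bsub>C\<^esub> \<eta> x"
      using a Gc[OF Fh[OF b] eh[OF y]] by simp
    also have "\<dots> = FA G (\<epsilon> y) \<cdot>\<^bsub>C\<^esub> (\<eta> (FO G y) \<cdot>\<^bsub>C\<^esub> b)"
      using C.comp_assoc[OF uh[OF x] Gh[OF Fh[OF b]] Gh[OF eh[OF y]]] un[OF b] by simp
    also have "\<dots> = b"
      using C.comp_assoc[OF b uh[OF GOo[OF y]] Gh[OF eh[OF y]]] tri2[OF y] C.ident_comp[OF b] by simp
    finally show "b = FA G s \<cdot>\<^bsub>C\<^esub> \<eta> x" by simp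
  qed
qed

lemma inv_arr_eq:
  fixes D :: "('o, 'a) cat"
  assumes D: "category D" and h: "h \<in> hom D x y" and g: "g \<in> hom D y x"
    and gh: "g \<cdot>\<^bsub>D\<^esub> h = Ident D x" and hg: "h \<cdot>\<^bsub>D\<^esub> g = Ident D y"
  shows "inv_arr D h = g"
proof -
  interpret D: cat D by (rule cat.intro) (rule D)
  have dc: "Dom D h = x" "Cod D h = y" using h by (auto simp: hom_def)
  show ?thesis unfolding inv_arr_def dc
  proof (rule the_equality)
    fix k assume k: "k \<in> hom D y x \<and> k \<cdot>\<^bsub>D\<^esub> h = Ident D x \<and> h \<cdot>\<^bsub>D\<^esub> k = Ident D y"
    have "k = (g \<cdot>\<^bsub>D\<^esub> h) \<cdot>\<^bsub>D\<^esub> k" using gh k D.ident_comp by auto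
    also have "\<dots> = g" using D.comp_assoc[of k y x h y g x] k h g D.comp_ident by auto
    finally show "k = g" .
  qed (use assms in auto)
qed

lemma slice_simps:
  "Arr (slice E Y) = {(f, g, h). f \<in> Arr E \<and> Cod E f = Y \<and> g \<in> Arr E \<and> Cod E g = Y \<and>
     h \<in> hom E (Dom E f) (Dom E g) \<and> g \<cdot>\<^bsub>E\<^esub> h = f}"
  "Obj (slice E Y) = {f \<in> Arr E. Cod E f = Y}"
  "Dom (slice E Y) (f, g, h) = f" "Cod (slice E Y) (f, g, h) = g"
  "Ident (slice E Y) f = (f, f, Ident E (Dom E f))"
  "(f', g', h') \<cdot>\<^bsub>slice E Y\<^esub> (f, g, h) = (f, g', h' \<cdot>\<^bsub>E\<^esub> h)"
  by (simp_all add: slice_def)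

lemma slice_hom_iff:
  "f \<in> hom E a Y \<Longrightarrow> g \<in> hom E b Y \<Longrightarrow>
     x \<in> hom (slice E Y) f g \<longleftrightarrow> (\<exists>h\<in>hom E a b. g \<cdot>\<^bsub>E\<^esub> h = f \<and> x = (f, g, h))"
  by (cases x) (auto simp: slice_simps hom_def)

lemma (in cat) slice_category: "category (slice E Y)"
proof -
  let ?S = "slice E Y"
  note S = slice_simps
  have comp: "g' \<cdot> (h' \<cdot> h) = f" 
    if "h \<in> hom E (Dom E f) (Dom E g)" "h' \<in> hom E (Dom E g) (Dom E g')" "g \<cdot> h = f" "g' \<cdot> h' = g" "g' \<in> Arr E"
    for f g g' h h'
    using comp_assoc[OF that(1,2) arr_hom[OF that(5)]] that by simp
  have comp2: "h' \<cdot> h \<in> hom E x z" if "h \<in> hom E x y" "h' \<in> hom E y z" for h h' x y z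
    using comp_hom that by blast
  have i: "Ident E (Dom E f) \<in> hom E (Dom E f) (Dom E f)" "f \<cdot> Ident E (Dom E f) = f" if "f \<in> Arr E" for f
    using arr_hom[OF that] hom_Obj ident_hom comp_ident by blast+
  have o: "Dom E f \<in> Obj E" if "f \<in> Arr E" for f using hom_Obj arr_hom[OF that] by blast
  show ?thesis
    unfolding category_def hom_def[of ?S]
  proof (intro conjI ballI impI)
    fix f g assume "f \<in> Arr ?S" "g \<in> Arr ?S" "Dom ?S g = Cod ?S f"
    then show "g \<cdot>\<^bsub>?S\<^esub> f \<in> {h \<in> Arr ?S. Dom ?S h = Dom ?S f \<and> Cod ?S h = Cod ?S g}"
      by (cases f; cases g) (auto simp: S intro: comp2 comp)
  next
    fix f g h assume "f \<in> Arr ?S" "g \<in> Arr ?S" "h \<in> Arr ?S" "Dom ?S g = Cod ?S f" "Dom ?S h = Cod ?S g"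
    then show "h \<cdot>\<^bsub>?S\<^esub> (g \<cdot>\<^bsub>?S\<^esub> f) = (h \<cdot>\<^bsub>?S\<^esub> g) \<cdot>\<^bsub>?S\<^esub> f"
      by (cases f; cases g; cases h) (clarsimp simp: S, metis comp_assoc)
  next
    fix f assume "f \<in> Arr ?S"
    then show "f \<cdot>\<^bsub>?S\<^esub> Ident ?S (Dom ?S f) = f" "Ident ?S (Cod ?S f) \<cdot>\<^bsub>?S\<^esub> f = f"
      by (cases f; force simp: S intro: comp_ident ident_comp)+
  qed (auto simp: S i)
qed

section \<open>Relative partial map classifiers from the right adjoint of pullback\<close>

text \<open>The right adjoint of pullback along a monomorphism \<open>t\<close>, in any category. For an object \<open>f\<close>
  over \<open>Y\<close>, the object \<open>rho\<close> below is \<open>t\<^sub>* f\<close> with total object \<open>Z\<close>; the chosen pullback of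
  \<open>rho\<close> along \<open>t\<close> is \<open>q : Q \<rightarrow> Y\<close> with upper projection \<open>p : Q \<rightarrow> Z\<close>; and \<open>e : Q \<rightarrow> X\<close> is the
  underlying arrow of the counit at \<open>f\<close>.\<close>

locale pullback_adjoint = cat E for E :: "('o, 'a) cat" (structure) +
  fixes t :: 'a and Y KY :: 'o
    and T R :: "('a, 'a \<times> 'a \<times> 'a, 'a, 'a \<times> 'a \<times> 'a) funct"
    and pr :: "'a \<Rightarrow> 'a" and unit counit :: "'a \<Rightarrow> 'a \<times> 'a \<times> 'a"
  assumes t_hom: "t \<in> hom E Y KY"
    and t_monic: "monic E t"
    and T_pullback: "pullback_functor E t T pr"
    and T_adjoint: "adjunction (slice E KY) (slice E Y) T R unit counit"
begin

lemma T_object: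
  assumes "g \<in> hom E B KY"
  shows "\<exists>A. FO T g \<in> hom E A Y \<and> pr g \<in> hom E A B \<and> pullback_sq E (FO T g) g (pr g) t"
proof -
  have "pullback_sq E (FO T g) g (pr g) t"
    using assms T_pullback t_hom unfolding pullback_functor_def by (auto simp: slice_simps hom_def)
  moreover from this have "FO T g \<in> hom E (Dom E (FO T g)) Y" "pr g \<in> hom E (Dom E (FO T g)) B"
    using assms t_hom unfolding pullback_sq_def comm_sq_def hom_def by fastforce+
  ultimately show ?thesis by blast
qed

lemma T_arrow:
  assumes g: "g \<in> hom E B KY" and g': "g' \<in> hom E B' KY" and b: "b \<in> hom E B B'" "g' \<cdot> b = g"
    and A: "FO T g \<in> hom E A Y" and A': "FO T g' \<in> hom E A' Y"
  shows "\<exists>k\<in>hom E A A'. FA T (g, g', b) = (FO T g, FO T g', k) \<and> pr g' \<cdot> k = b \<cdot> pr g"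
proof -
  have ct: "Cod E t = KY" "Dom E t = Y" using t_hom by (auto simp: hom_def)
  have 1: "(g, g', b) \<in> Arr (slice E KY)" using g g' b by (auto simp: slice_simps hom_def)
  have "FA T (g, g', b) \<in> hom (slice E Y) (FO T g) (FO T g')"
    using T_pullback 1 unfolding pullback_functor_def is_functor_def ct
    using slice_simps(3,4)[of E KY g g' b] by auto
  then obtain k where k: "k \<in> hom E A A'" "FA T (g, g', b) = (FO T g, FO T g', k)"
    unfolding slice_hom_iff[OF A A'] by blast
  moreover have "pr g' \<cdot> under (FA T (g, g', b)) = b \<cdot> pr g"
    using T_pullback 1 unfolding pullback_functor_def ct by auto
  ultimately show ?thesis by (auto simp: under_def)
qed

end

locale relative_classifier = pullback_adjoint E t Y KY T R pr unit counit
  for E :: "('o, 'a) cat" (structure) and t Y KY T R pr unit counit +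
  fixes f :: 'a and X :: 'o
  assumes f_hom: "f \<in> hom E X Y"
begin

definition "rho = FO R f"
definition "Z = Dom E rho"
definition "q = FO T rho"
definition "Q = Dom E q"
definition "p = pr rho"
definition "e = under (counit f)"

lemma f_Obj: "f \<in> Obj (slice E Y)"
  using f_hom by (simp add: slice_simps hom_def)

lemma rho_hom: "rho \<in> hom E Z KY"
proof -
  have "rho \<in> Obj (slice E KY)"
    using T_adjoint f_Obj unfolding adjunction_def is_functor_def rho_def by blast
  then show ?thesis by (simp add: Z_def hom_def slice_simps)
qed

lemma q_hom: "q \<in> hom E Q Y" and p_hom: "p \<in> hom E Q Z" and Q_pullback: "pullback_sq E q rho p t"
  using T_object[OF rho_hom] by (auto simp: q_def Q_def p_def hom_def)

lemma p_monic: "monic E p"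
  using pullback_monic[OF Q_pullback t_monic] .

lemma e_hom: "e \<in> hom E Q X" and e_over: "f \<cdot> e = q" and counit_eq: "counit f = (q, f, e)"
proof -
  have "counit f \<in> hom (slice E Y) q f"
    using T_adjoint f_Obj unfolding adjunction_def nat_transf_def
    by (auto simp: comp_funct_def id_funct_def q_def rho_def)
  then show "e \<in> hom E Q X" "f \<cdot> e = q" "counit f = (q, f, e)"
    unfolding slice_hom_iff[OF q_hom f_hom] by (auto simp: e_def under_def)
qed

text \<open>The adjunction, freed from the choice of pullbacks: the chosen pullback of \<open>g\<close> is
  isomorphic to the given one \<open>w\<close>, and an arrow into \<open>rho\<close> restricts along the inclusion \<open>m\<close>
  of either to the same partial map.\<close>

lemma transpose:
  assumes pb: "pullback_sq E w g m t" and m: "m \<in> hom E A B" and s: "s \<in> hom E A X" "f \<cdot> s = w"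
  shows "\<exists>!b. b \<in> hom E B Z \<and> rho \<cdot> b = g \<and> (\<exists>k\<in>hom E A Q. p \<cdot> k = b \<cdot> m \<and> e \<cdot> k = s)"
proof -
  have w: "w \<in> hom E A Y" using s f_hom comp_hom by blast
  have g: "g \<in> hom E B KY"
    using pb m t_hom unfolding pullback_sq_def comm_sq_def by (auto simp: hom_def)
  obtain A' where tau: "FO T g \<in> hom E A' Y" and pg: "pr g \<in> hom E A' B"
    and pb': "pullback_sq E (FO T g) g (pr g) t" using T_object[OF g] by blast
  have gm: "g \<cdot> m = t \<cdot> w" and gpg: "g \<cdot> pr g = t \<cdot> FO T g"
    using pb pb' unfolding pullback_sq_def comm_sq_def by auto
  have ump': "\<exists>!j. j \<in> hom E z A' \<and> pr g \<cdot> j = u \<and> FO T g \<cdot> j = v"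
    if "u \<in> hom E z B" "v \<in> hom E z Y" "g \<cdot> u = t \<cdot> v" for z u v
    using pb' that unfolding pullback_sq_iff[OF tau g] by blast
  have ump: "\<exists>!j. j \<in> hom E z A \<and> m \<cdot> j = u \<and> w \<cdot> j = v"
    if "u \<in> hom E z B" "v \<in> hom E z Y" "g \<cdot> u = t \<cdot> v" for z u v
    using pb that unfolding pullback_sq_iff[OF w g] by blast
  obtain j where j: "j \<in> hom E A A'" "pr g \<cdot> j = m" "FO T g \<cdot> j = w"
    using ump'[OF m w gm] by blast
  obtain j' where j': "j' \<in> hom E A' A" "m \<cdot> j' = pr g" "w \<cdot> j' = FO T g"
    using ump[OF pg tau gpg] by blast
  have idA: "Ident E A \<in> hom E A A" using w hom_Obj ident_hom by blast
  have "m \<cdot> (j' \<cdot> j) = m" "w \<cdot> (j' \<cdot> j) = w"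
    using comp_assoc[OF j(1) j'(1) m] comp_assoc[OF j(1) j'(1) w] j j' by simp_all
  then have jj: "j' \<cdot> j = Ident E A"
    using ump[OF m w gm] comp_hom[OF j(1) j'(1)] idA comp_ident[OF m] comp_ident[OF w] by metis
  let ?s = "s \<cdot> j'"
  have s0: "?s \<in> hom E A' X" using comp_hom[OF j'(1) s(1)] .
  have fs0: "f \<cdot> ?s = FO T g" using comp_assoc[OF j'(1) s(1) f_hom] s j' by simp
  have gO: "g \<in> Obj (slice E KY)" using g by (simp add: slice_simps hom_def)
  have "(FO T g, f, ?s) \<in> hom (slice E Y) (FO T g) f"
    using s0 fs0 unfolding slice_hom_iff[OF tau f_hom] by blast
  from adjunction_transpose[OF slice_category slice_category T_adjoint gO f_Obj this]
  obtain b0 where b0: "b0 \<in> hom (slice E KY) g rho"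
      "counit f \<cdot>\<^bsub>slice E Y\<^esub> FA T b0 = (FO T g, f, ?s)"
    and b0u: "\<And>b'. b' \<in> hom (slice E KY) g rho \<Longrightarrow>
       counit f \<cdot>\<^bsub>slice E Y\<^esub> FA T b' = (FO T g, f, ?s) \<Longrightarrow> b' = b0"
    unfolding rho_def by blast
  obtain b where b: "b \<in> hom E B Z" "rho \<cdot> b = g" "b0 = (g, rho, b)"
    using b0(1) unfolding slice_hom_iff[OF g rho_hom] by auto
  obtain k0 where k0: "k0 \<in> hom E A' Q" "FA T b0 = (FO T g, q, k0)" "p \<cdot> k0 = b \<cdot> pr g"
    using T_arrow[OF g rho_hom b(1,2) tau] q_hom b(3) by (auto simp: q_def p_def)
  have ek0: "e \<cdot> k0 = ?s" using b0(2) k0(2) by (simp add: counit_eq slice_simps)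
  show ?thesis
  proof (intro ex1I[of _ b] conjI bexI[of _ "k0 \<cdot> j"])
    show "p \<cdot> (k0 \<cdot> j) = b \<cdot> m"
      using comp_assoc[OF j(1) k0(1) p_hom] comp_assoc[OF j(1) pg b(1)] k0 j by simp
    show "e \<cdot> (k0 \<cdot> j) = s"
      using comp_assoc[OF j(1) k0(1) e_hom] ek0 comp_assoc[OF j(1) j'(1) s(1)] jj comp_ident[OF s(1)]
      by simp
    show "k0 \<cdot> j \<in> hom E A Q" using comp_hom[OF j(1) k0(1)] .
  next
    fix b' assume a: "b' \<in> hom E B Z \<and> rho \<cdot> b' = g \<and> (\<exists>k\<in>hom E A Q. p \<cdot> k = b' \<cdot> m \<and> e \<cdot> k = s)"
    then obtain k where k: "k \<in> hom E A Q" "p \<cdot> k = b' \<cdot> m" "e \<cdot> k = s" by blast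
    have b': "b' \<in> hom E B Z" "rho \<cdot> b' = g" using a by auto
    obtain k' where k': "k' \<in> hom E A' Q" "FA T (g, rho, b') = (FO T g, q, k')" "p \<cdot> k' = b' \<cdot> pr g"
      using T_arrow[OF g rho_hom b' tau] q_hom by (auto simp: q_def p_def)
    have "p \<cdot> (k \<cdot> j') = p \<cdot> k'"
      using comp_assoc[OF j'(1) k(1) p_hom] comp_assoc[OF j'(1) m b'(1)] k k' j' by simp
    then have "k \<cdot> j' = k'"
      using monicD[OF p_monic p_hom comp_hom[OF j'(1) k(1)] k'(1)] by simp
    then have "e \<cdot> k' = ?s" using comp_assoc[OF j'(1) k(1) e_hom] k by auto
    then have "(g, rho, b') = b0"
      using b0u[of "(g, rho, b')"] b' k'(2) unfolding slice_hom_iff[OF g rho_hom]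
      by (auto simp: counit_eq slice_simps)
    then show "b' = b" using b(3) by simp
  qed (use b in auto)
qed

text \<open>Since \<open>t\<close> is monic, \<open>f\<close> is itself a pullback of \<open>t \<cdot> f\<close> along \<open>t\<close>, and likewise \<open>q\<close> of
  \<open>t \<cdot> q\<close>. Transposing \<open>Ident E X\<close> over the first gives a section of the counit; uniqueness of
  transposes over the second shows that it is a two-sided inverse.\<close>

lemma pullback_along_t:
  assumes h: "h \<in> hom E W Y"
  shows "pullback_sq E h (t \<cdot> h) (Ident E W) t"
proof -
  have i: "Ident E W \<in> hom E W W" using h hom_Obj ident_hom by blast
  have th: "t \<cdot> h \<in> hom E W KY" using comp_hom[OF h t_hom] .
  show ?thesis unfolding pullback_sq_iff[OF h th]
  proof (intro conjI allI ballI impI)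
    fix z u v assume u: "u \<in> hom E z W" and v: "v \<in> hom E z Y" and a: "(t \<cdot> h) \<cdot> u = t \<cdot> v"
    then have "h \<cdot> u = v"
      using monicD[OF t_monic t_hom comp_hom[OF u h] v] comp_assoc[OF u h t_hom] by simp
    then show "\<exists>!w. w \<in> hom E z W \<and> Ident E W \<cdot> w = u \<and> h \<cdot> w = v"
      using u by (metis ident_comp)
  qed (use i th h t_hom comp_ident[OF th] in auto)
qed

lemma counit_inverse:
  obtains i where "i \<in> hom E X Q" "e \<cdot> i = Ident E X" "i \<cdot> e = Ident E Q"
proof -
  have iX: "Ident E X \<in> hom E X X" and iQ: "Ident E Q \<in> hom E Q Q"
    using f_hom q_hom hom_Obj ident_hom by blast+
  obtain b i where b: "b \<in> hom E X Z" "rho \<cdot> b = t \<cdot> f"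
    and i: "i \<in> hom E X Q" "p \<cdot> i = b \<cdot> Ident E X" "e \<cdot> i = Ident E X"
    using transpose[OF pullback_along_t[OF f_hom] iX iX comp_ident[OF f_hom]] by blast
  have pi: "p \<cdot> i = b" using i comp_ident[OF b(1)] by simp
  note be = comp_hom[OF e_hom b(1)] and ie = comp_hom[OF e_hom i(1)]
  have sq: "rho \<cdot> p = t \<cdot> q" using Q_pullback unfolding pullback_sq_def comm_sq_def by auto
  have "rho \<cdot> (b \<cdot> e) = t \<cdot> q"
    using comp_assoc[OF e_hom b(1) rho_hom] b(2) comp_assoc[OF e_hom f_hom t_hom] e_over by simp
  moreover have "p \<cdot> (i \<cdot> e) = (b \<cdot> e) \<cdot> Ident E Q"
    using comp_assoc[OF e_hom i(1) p_hom] pi comp_ident[OF be] by simp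
  moreover have "e \<cdot> (i \<cdot> e) = e"
    using comp_assoc[OF e_hom i(1) e_hom] i(3) ident_comp[OF e_hom] by simp
  moreover have "e \<cdot> Ident E Q = e" using comp_ident[OF e_hom] .
  \<comment> \<open>Both \<open>b \<cdot> e\<close> and \<open>p\<close> are transposes of \<open>e\<close>, regarded as an arrow from \<open>q\<close> to \<open>f\<close>.\<close>
  ultimately have "b \<cdot> e = p"
    using transpose[OF pullback_along_t[OF q_hom] iQ e_hom e_over] be ie p_hom iQ sq by metis
  then have "p \<cdot> (i \<cdot> e) = p \<cdot> Ident E Q"
    using comp_assoc[OF e_hom i(1) p_hom] pi comp_ident[OF p_hom] by simp
  then have "i \<cdot> e = Ident E Q" using monicD[OF p_monic p_hom ie iQ] by simp
  then show ?thesis using that i by blast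
qed

definition "eta = pmc_unit E pr R counit f"

lemma eta_eq:
  assumes i: "i \<in> hom E X Q" "e \<cdot> i = Ident E X" "i \<cdot> e = Ident E Q"
  shows "eta = p \<cdot> i"
proof -
  have fi: "q \<cdot> i = f"
    using comp_assoc[OF i(1) e_hom f_hom] i e_over comp_ident[OF f_hom] by simp
  have d: "Dom E q = Q" "Dom E f = X" "Cod E f = Y" using q_hom f_hom by (auto simp: hom_def)
  have "inv_arr (slice E Y) (counit f) = (f, q, i)"
    by (rule inv_arr_eq[OF slice_category, of _ _ q f])
      (use i fi e_hom e_over in \<open>auto simp: counit_eq slice_simps d slice_hom_iff[OF q_hom f_hom]
        slice_hom_iff[OF f_hom q_hom]\<close>)
  then show ?thesis by (simp add: eta_def pmc_unit_def d under_def p_def rho_def)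
qed

lemma eta_hom: "eta \<in> hom E X Z"
  using counit_inverse eta_eq comp_hom p_hom by metis

text \<open>The chosen pullback square of \<open>rho\<close> along \<open>t\<close>, transported along the isomorphism \<open>e\<close>.\<close>

lemma eta_pullback: "pullback_sq E eta t f rho"
proof -
  obtain i where i: "i \<in> hom E X Q" "e \<cdot> i = Ident E X" "i \<cdot> e = Ident E Q"
    using counit_inverse by blast
  have ie: "eta = p \<cdot> i" using eta_eq[OF i] .
  have qi: "q \<cdot> i = f"
    using comp_assoc[OF i(1) e_hom f_hom] i e_over comp_ident[OF f_hom] by simp
  have sq: "rho \<cdot> p = t \<cdot> q" using Q_pullback unfolding pullback_sq_def comm_sq_def by auto
  have "pullback_sq E f rho eta t"
    unfolding pullback_sq_iff[OF f_hom rho_hom]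
  proof (intro conjI allI ballI impI)
    show "rho \<cdot> eta = t \<cdot> f"
      using comp_assoc[OF i(1) p_hom rho_hom] comp_assoc[OF i(1) q_hom t_hom] ie qi sq by simp
    fix z u v assume u: "u \<in> hom E z Z" and v: "v \<in> hom E z Y" and a: "rho \<cdot> u = t \<cdot> v"
    obtain x where x: "x \<in> hom E z Q" "p \<cdot> x = u" "q \<cdot> x = v"
      and xu: "\<And>x'. x' \<in> hom E z Q \<Longrightarrow> p \<cdot> x' = u \<Longrightarrow> q \<cdot> x' = v \<Longrightarrow> x' = x"
      using Q_pullback u v a unfolding pullback_sq_iff[OF q_hom rho_hom] by blast
    have ex: "e \<cdot> x \<in> hom E z X" using comp_hom[OF x(1) e_hom] .
    have iex: "i \<cdot> (e \<cdot> x) = x"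
      using comp_assoc[OF x(1) e_hom i(1)] i ident_comp[OF x(1)] by simp
    show "\<exists>!w. w \<in> hom E z X \<and> eta \<cdot> w = u \<and> f \<cdot> w = v"
    proof (rule ex1I[of _ "e \<cdot> x"], intro conjI)
      show "eta \<cdot> (e \<cdot> x) = u" using comp_assoc[OF ex i(1) p_hom] ie iex x by simp
      show "f \<cdot> (e \<cdot> x) = v" using comp_assoc[OF x(1) e_hom f_hom] e_over x by simp
      fix w assume a: "w \<in> hom E z X \<and> eta \<cdot> w = u \<and> f \<cdot> w = v"
      then have w: "w \<in> hom E z X" by simp
      have "i \<cdot> w = x"
        using a xu[OF comp_hom[OF w i(1)]] comp_assoc[OF w i(1) p_hom] comp_assoc[OF w i(1) q_hom] ie qi
        by simp
      then show "w = e \<cdot> x" using comp_assoc[OF w i(1) e_hom] i ident_comp[OF w] by auto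
    qed (use ex in auto)
  qed (use eta_hom t_hom in auto)
  then show ?thesis using pullback_sq_transpose pullback_sq_transpose by blast
qed

text \<open>The lift \<open>b\<close> of \<open>g\<close> is the partial map \<open>s\<close> with domain of definition \<open>m\<close>: the transposition
  property with \<open>Q\<close> replaced by \<open>X\<close>.\<close>

lemma classify:
  assumes pb: "pullback_sq E w g m t" and m: "m \<in> hom E A B" and s: "s \<in> hom E A X" "f \<cdot> s = w"
  shows "\<exists>!b. b \<in> hom E B Z \<and> rho \<cdot> b = g \<and> b \<cdot> m = eta \<cdot> s"
proof -
  obtain i where i: "i \<in> hom E X Q" "e \<cdot> i = Ident E X" "i \<cdot> e = Ident E Q"
    using counit_inverse by blast
  have lift: "i \<cdot> s \<in> hom E A Q" "p \<cdot> (i \<cdot> s) = eta \<cdot> s" "e \<cdot> (i \<cdot> s) = s"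
    using comp_hom[OF s(1) i(1)] comp_assoc[OF s(1) i(1) p_hom] comp_assoc[OF s(1) i(1) e_hom]
      eta_eq[OF i] i ident_comp[OF s(1)] by simp_all
  have eq: "k = i \<cdot> s" if "k \<in> hom E A Q" "e \<cdot> k = s" for k
    using comp_assoc[OF that(1) e_hom i(1)] i that ident_comp[OF that(1)] by simp
  have "(\<exists>k\<in>hom E A Q. p \<cdot> k = b \<cdot> m \<and> e \<cdot> k = s) \<longleftrightarrow> b \<cdot> m = eta \<cdot> s" for b
    using lift eq by metis
  then show ?thesis using transpose[OF assms] by simp
qed

end

section \<open>Presheaves\<close>

text \<open>The natural transformation with components \<open>\<phi> x\<close>, cut down to the extensional form that the
  equality of morphisms requires.\<close>

definition nt :: "('v, 'v) cat \<Rightarrow> 'v psh \<Rightarrow> 'v psh \<Rightarrow> ('v \<Rightarrow> 'v \<Rightarrow> 'v) \<Rightarrow> 'v psh_arr" where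
  "nt C F G \<phi> = \<lparr>pa_dom = F, pa_cod = G, pa_comp = (\<lambda>x\<in>Obj C. \<lambda>a\<in>psh_ob F x. \<phi> x a)\<rparr>"

lemma nt_comp [simp]: "x \<in> Obj C \<Longrightarrow> a \<in> psh_ob F x \<Longrightarrow> pa_comp (nt C F G \<phi>) x a = \<phi> x a"
  by (simp add: nt_def)

locale presheaves =
  fixes C :: "('v, 'v) cat"
  assumes U: "universe TYPE('v)" and small_C: "small_category C"
begin

lemma C_cat: "category C" using small_C by (simp add: small_category_def)

sublocale C: cat C by (rule cat.intro) (rule C_cat)

lemma infinite_v: "infinite (UNIV :: 'v set)" using U by (simp add: universe_def)

lemma small_subset: "small (B :: 'v set) \<Longrightarrow> A \<subseteq> B \<Longrightarrow> small A"
  unfolding small_def using card_of_mono1 ordLeq_ordLess_trans by blast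

lemma small_image: "small (A :: 'v set) \<Longrightarrow> small ((g :: 'v \<Rightarrow> 'v) ` A)"
  unfolding small_def using card_of_image ordLeq_ordLess_trans by blast

lemma small_UNION: "small (A :: 'v set) \<Longrightarrow> (\<And>a. a \<in> A \<Longrightarrow> small (B a :: 'v set)) \<Longrightarrow> small (\<Union>a\<in>A. B a)"
  unfolding small_def
  by (rule card_of_UNION_ordLess_infinite_Field_regularCard)
    (use U infinite_v in \<open>auto simp: universe_def cinfinite_def card_of_card_order_on Field_card_of\<close>)

lemma inj_pair_code: "inj (pair_code :: 'v \<times> 'v \<Rightarrow> 'v)"
proof -
  have "|UNIV \<times> UNIV :: ('v \<times> 'v) set| \<le>o |UNIV :: 'v set|"
    using card_of_Times_same_infinite[OF infinite_v] ordIso_imp_ordLeq by blast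
  then have "\<exists>e :: 'v \<times> 'v \<Rightarrow> 'v. inj e"
    unfolding card_of_ordLeq[symmetric] by auto
  then show ?thesis unfolding pair_code_def by (rule someI_ex)
qed

lemma pair_code_eq [simp]: "pair_code (a, b) = pair_code (a', b' :: 'v) \<longleftrightarrow> a = a' \<and> b = b'"
  using inj_pair_code by (auto dest: injD)

lemma inv_pair_code [simp]: "inv pair_code (pair_code p) = (p :: 'v \<times> 'v)"
  using inj_pair_code by simp

lemma small_pair_Sigma:
  assumes "small (A :: 'v set)" "\<And>a. a \<in> A \<Longrightarrow> small (B a :: 'v set)"
  shows "small (pair_code ` (Sigma A B))"
proof -
  have "pair_code ` (Sigma A B) = (\<Union>a\<in>A. (\<lambda>b. pair_code (a, b)) ` B a)" by auto
  then show ?thesis using small_UNION[OF assms(1) small_image[OF assms(2)]] by simp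
qed

lemma small_hom: "small (hom C x y)"
  using small_C small_subset[of "Arr C"] by (auto simp: small_category_def hom_def)

lemma inj_sieve_code: "inj_on (sieve_code C) (Pow (Arr C))"
proof -
  have "|Pow (Arr C)| <o |UNIV :: 'v set|"
    using U small_C by (auto simp: universe_def small_category_def)
  then have "|Pow (Arr C)| \<le>o |UNIV :: 'v set|" by (rule ordLess_imp_ordLeq)
  then have "\<exists>e :: 'v set \<Rightarrow> 'v. inj_on e (Pow (Arr C))"
    unfolding card_of_ordLeq[symmetric] by blast
  then show ?thesis unfolding sieve_code_def by (rule someI_ex)
qed

text \<open>The strong limit property of the universe makes \<open>\<Omega>\<close> a presheaf of small sets.\<close>

lemma small_sieve_code: "small (sieve_code C ` sieves C x)"
proof -
  have "|Pow (Arr C)| <o |UNIV :: 'v set|"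
    using U small_C by (auto simp: universe_def small_category_def)
  moreover have "|sieve_code C ` sieves C x| \<le>o |Pow (Arr C)|"
    by (rule ordLeq_transitive[OF card_of_image]) (auto simp: sieves_def intro!: card_of_mono1)
  ultimately show ?thesis unfolding small_def using ordLeq_ordLess_trans by blast
qed

subsection \<open>The category of presheaves\<close>

lemma presheafD:
  assumes "presheaf C F"
  shows "h \<in> hom C y x \<Longrightarrow> a \<in> psh_ob F x \<Longrightarrow> psh_map F h a \<in> psh_ob F y"
    and "x \<in> Obj C \<Longrightarrow> a \<in> psh_ob F x \<Longrightarrow> psh_map F (Ident C x) a = a"
    and "h \<in> hom C y x \<Longrightarrow> g \<in> hom C z y \<Longrightarrow> a \<in> psh_ob F x \<Longrightarrow>
      psh_map F (h \<cdot>\<^bsub>C\<^esub> g) a = psh_map F g (psh_map F h a)"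
    and "x \<in> Obj C \<Longrightarrow> small (psh_ob F x)"
  using assms unfolding presheaf_def hom_def by fastforce+

lemma presheafI:
  assumes "psh_ob F \<in> extensional (Obj C)" "psh_map F \<in> extensional (Arr C)"
    and "\<And>h. h \<in> Arr C \<Longrightarrow> psh_map F h \<in> extensional (psh_ob F (Cod C h))"
    and "\<And>x. x \<in> Obj C \<Longrightarrow> small (psh_ob F x)"
    and "\<And>h y x a. h \<in> hom C y x \<Longrightarrow> a \<in> psh_ob F x \<Longrightarrow> psh_map F h a \<in> psh_ob F y"
    and "\<And>x a. x \<in> Obj C \<Longrightarrow> a \<in> psh_ob F x \<Longrightarrow> psh_map F (Ident C x) a = a"
    and "\<And>h g x y z a. h \<in> hom C y x \<Longrightarrow> g \<in> hom C z y \<Longrightarrow> a \<in> psh_ob F x \<Longrightarrow>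
      psh_map F (h \<cdot>\<^bsub>C\<^esub> g) a = psh_map F g (psh_map F h a)"
  shows "presheaf C F"
  using assms unfolding presheaf_def hom_def PiE_def by blast

lemma Psh_hom_iff:
  "\<alpha> \<in> hom (Psh C) F G \<longleftrightarrow> psh_morphism C \<alpha> \<and> pa_dom \<alpha> = F \<and> pa_cod \<alpha> = G"
  by (simp add: hom_def Psh_def)

lemma Psh_Obj [simp]: "F \<in> Obj (Psh C) \<longleftrightarrow> presheaf C F"
  by (simp add: Psh_def)

lemma Psh_homD:
  assumes "\<alpha> \<in> hom (Psh C) F G"
  shows "presheaf C F" "presheaf C G"
    and "x \<in> Obj C \<Longrightarrow> a \<in> psh_ob F x \<Longrightarrow> pa_comp \<alpha> x a \<in> psh_ob G x"
    and "h \<in> hom C y x \<Longrightarrow> a \<in> psh_ob F x \<Longrightarrow>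
      pa_comp \<alpha> y (psh_map F h a) = psh_map G h (pa_comp \<alpha> x a)"
proof -
  have a: "psh_morphism C \<alpha>" "pa_dom \<alpha> = F" "pa_cod \<alpha> = G" using assms by (auto simp: Psh_hom_iff)
  show "presheaf C F" "presheaf C G" using a by (auto simp: psh_morphism_def)
  show "x \<in> Obj C \<Longrightarrow> a \<in> psh_ob F x \<Longrightarrow> pa_comp \<alpha> x a \<in> psh_ob G x"
    using a by (auto simp: psh_morphism_def)
  show "h \<in> hom C y x \<Longrightarrow> a \<in> psh_ob F x \<Longrightarrow>
      pa_comp \<alpha> y (psh_map F h a) = psh_map G h (pa_comp \<alpha> x a)"
    using a by (auto simp: psh_morphism_def hom_def)
qed

lemma Psh_ext:
  assumes "\<alpha> \<in> hom (Psh C) F G" "\<beta> \<in> hom (Psh C) F G"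
    and "\<And>x a. x \<in> Obj C \<Longrightarrow> a \<in> psh_ob F x \<Longrightarrow> pa_comp \<alpha> x a = pa_comp \<beta> x a"
  shows "\<alpha> = \<beta>"
proof -
  have a: "psh_morphism C \<alpha>" "psh_morphism C \<beta>" "pa_dom \<alpha> = F" "pa_dom \<beta> = F"
    "pa_cod \<alpha> = G" "pa_cod \<beta> = G"
    using assms by (auto simp: Psh_hom_iff)
  have "pa_comp \<alpha> = pa_comp \<beta>"
  proof (rule extensionalityI)
    fix x assume x: "x \<in> Obj C"
    show "pa_comp \<alpha> x = pa_comp \<beta> x"
      by (rule PiE_ext[of _ "psh_ob F x" "\<lambda>_. psh_ob G x"])
        (use a x assms in \<open>auto simp: psh_morphism_def\<close>)
  qed (use a in \<open>auto simp: psh_morphism_def\<close>)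
  then show ?thesis using a by (cases \<alpha>; cases \<beta>) simp
qed

lemma nt_hom:
  assumes "presheaf C F" "presheaf C G"
    and "\<And>x a. x \<in> Obj C \<Longrightarrow> a \<in> psh_ob F x \<Longrightarrow> \<phi> x a \<in> psh_ob G x"
    and "\<And>h y x a. h \<in> hom C y x \<Longrightarrow> a \<in> psh_ob F x \<Longrightarrow> \<phi> y (psh_map F h a) = psh_map G h (\<phi> x a)"
  shows "nt C F G \<phi> \<in> hom (Psh C) F G"
proof -
  have "Dom C h \<in> Obj C \<and> Cod C h \<in> Obj C" if "h \<in> Arr C" for h
    using C.hom_Obj[OF C.arr_hom[OF that]] by blast
  moreover have "psh_map F h a \<in> psh_ob F (Dom C h)" if "h \<in> Arr C" "a \<in> psh_ob F (Cod C h)" for h a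
    using presheafD(1)[OF assms(1) C.arr_hom[OF that(1)] that(2)] .
  ultimately show ?thesis
    using assms C.arr_hom unfolding Psh_hom_iff psh_morphism_def by (auto simp: nt_def)
qed

lemma Psh_comp_eq: "\<beta> \<cdot>\<^bsub>Psh C\<^esub> \<alpha> = nt C (pa_dom \<alpha>) (pa_cod \<beta>) (\<lambda>x a. pa_comp \<beta> x (pa_comp \<alpha> x a))"
  by (simp add: Psh_def nt_def)

lemma Psh_ident_eq: "Ident (Psh C) F = nt C F F (\<lambda>x a. a)"
  by (simp add: Psh_def nt_def)

lemma Psh_comp [simp]:
  "\<alpha> \<in> hom (Psh C) F G \<Longrightarrow> x \<in> Obj C \<Longrightarrow> a \<in> psh_ob F x \<Longrightarrow>
     pa_comp (\<beta> \<cdot>\<^bsub>Psh C\<^esub> \<alpha>) x a = pa_comp \<beta> x (pa_comp \<alpha> x a)"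
  unfolding Psh_comp_eq by (simp add: Psh_hom_iff)

lemma Psh_ident [simp]:
  "x \<in> Obj C \<Longrightarrow> a \<in> psh_ob F x \<Longrightarrow> pa_comp (Ident (Psh C) F) x a = a"
  unfolding Psh_ident_eq by simp

lemma Psh_comp_hom:
  assumes "\<alpha> \<in> hom (Psh C) F G" "\<beta> \<in> hom (Psh C) G H"
  shows "\<beta> \<cdot>\<^bsub>Psh C\<^esub> \<alpha> \<in> hom (Psh C) F H"
proof -
  have "pa_dom \<alpha> = F" "pa_cod \<beta> = H" using assms by (auto simp: Psh_hom_iff)
  then show ?thesis unfolding Psh_comp_eq
    using Psh_homD[OF assms(1)] Psh_homD[OF assms(2)] C.hom_Obj by (auto intro!: nt_hom)
qed

lemma Psh_ident_hom: "presheaf C F \<Longrightarrow> Ident (Psh C) F \<in> hom (Psh C) F F"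
  unfolding Psh_ident_eq by (rule nt_hom) auto

lemma Psh_arr: "\<alpha> \<in> Arr (Psh C) \<Longrightarrow> \<alpha> \<in> hom (Psh C) (pa_dom \<alpha>) (pa_cod \<alpha>)"
  by (simp add: hom_def Psh_def)

lemma Psh_Dom_Cod: "Dom (Psh C) = pa_dom" "Cod (Psh C) = pa_cod"
  by (simp_all add: Psh_def)

lemma Psh_category: "category (Psh C)"
  unfolding category_def Psh_Dom_Cod
proof (intro conjI ballI impI)
  fix f assume "f \<in> Arr (Psh C)"
  then have f: "f \<in> hom (Psh C) (pa_dom f) (pa_cod f)" by (rule Psh_arr)
  show "pa_dom f \<in> Obj (Psh C)" "pa_cod f \<in> Obj (Psh C)" using Psh_homD[OF f] by auto
  have i: "Ident (Psh C) (pa_dom f) \<in> hom (Psh C) (pa_dom f) (pa_dom f)"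
    "Ident (Psh C) (pa_cod f) \<in> hom (Psh C) (pa_cod f) (pa_cod f)"
    using Psh_homD[OF f] Psh_ident_hom by auto
  show "f \<cdot>\<^bsub>Psh C\<^esub> Ident (Psh C) (pa_dom f) = f"
    by (rule Psh_ext[OF Psh_comp_hom[OF i(1) f] f]) (simp add: Psh_comp[OF i(1)])
  show "Ident (Psh C) (pa_cod f) \<cdot>\<^bsub>Psh C\<^esub> f = f"
    by (rule Psh_ext[OF Psh_comp_hom[OF f i(2)] f]) (simp add: Psh_comp[OF f] Psh_homD[OF f])
  fix g assume "g \<in> Arr (Psh C)" and d: "pa_dom g = pa_cod f"
  then have g: "g \<in> hom (Psh C) (pa_cod f) (pa_cod g)" using Psh_arr by force
  show "g \<cdot>\<^bsub>Psh C\<^esub> f \<in> hom (Psh C) (pa_dom f) (pa_cod g)" using Psh_comp_hom[OF f g] .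
  fix h assume "h \<in> Arr (Psh C)" and "pa_dom h = pa_cod g"
  then have h: "h \<in> hom (Psh C) (pa_cod g) (pa_cod h)" using Psh_arr by force
  show "h \<cdot>\<^bsub>Psh C\<^esub> (g \<cdot>\<^bsub>Psh C\<^esub> f) = (h \<cdot>\<^bsub>Psh C\<^esub> g) \<cdot>\<^bsub>Psh C\<^esub> f"
    by (rule Psh_ext[OF Psh_comp_hom[OF Psh_comp_hom[OF f g] h] Psh_comp_hom[OF f Psh_comp_hom[OF g h]]])
      (simp add: Psh_comp[OF f] Psh_comp[OF g] Psh_comp[OF Psh_comp_hom[OF f g]] Psh_homD[OF f])
qed (use Psh_ident_hom in auto)

sublocale E: cat "Psh C" by (rule cat.intro) (rule Psh_category)

subsection \<open>Representables\<close>

lemma yoneda_ob [simp]: "z \<in> Obj C \<Longrightarrow> psh_ob (yoneda C x) z = hom C z x"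
  by (simp add: yoneda_def)

lemma yoneda_map: "f \<in> hom C z y \<Longrightarrow> g \<in> hom C y x \<Longrightarrow> psh_map (yoneda C x) f g = g \<cdot>\<^bsub>C\<^esub> f"
  by (simp add: yoneda_def hom_def)

lemma yoneda_presheaf: "presheaf C (yoneda C x)"
proof (rule presheafI)
  fix h y z a assume h: "h \<in> hom C y z" and a: "a \<in> psh_ob (yoneda C x) z"
  have o: "y \<in> Obj C" "z \<in> Obj C" using C.hom_Obj[OF h] by auto
  then show "psh_map (yoneda C x) h a \<in> psh_ob (yoneda C x) y"
    using h a C.comp_hom by (simp add: yoneda_map)
  fix g w assume g: "g \<in> hom C w y"
  have "w \<in> Obj C" using C.hom_Obj[OF g] by auto
  then show "psh_map (yoneda C x) (h \<cdot>\<^bsub>C\<^esub> g) a = psh_map (yoneda C x) g (psh_map (yoneda C x) h a)"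
    using C.comp_hom[OF g h] C.comp_hom[OF h] C.comp_assoc[OF g h, of a x] h g a o
    by (simp add: yoneda_map)
next
  fix z a assume z: "z \<in> Obj C" and "a \<in> psh_ob (yoneda C x) z"
  then have a: "a \<in> hom C z x" by simp
  show "psh_map (yoneda C x) (Ident C z) a = a"
    using C.comp_ident[OF a] by (simp add: yoneda_map[OF C.ident_hom[OF z] a])
next
  fix h assume "h \<in> Arr C"
  then have "Cod C h \<in> Obj C" using C.hom_Obj[OF C.arr_hom] by blast
  then show "psh_map (yoneda C x) h \<in> extensional (psh_ob (yoneda C x) (Cod C h))"
    using \<open>h \<in> Arr C\<close> by (simp add: yoneda_def)
qed (simp_all add: yoneda_def small_hom)

text \<open>The morphism that corresponds to an element under the Yoneda lemma.\<close>

definition element :: "'v psh \<Rightarrow> 'v \<Rightarrow> 'v \<Rightarrow> 'v psh_arr" where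
  "element F x b = nt C (yoneda C x) F (\<lambda>z g. psh_map F g b)"

lemma element_hom:
  assumes F: "presheaf C F" and x: "x \<in> Obj C" and b: "b \<in> psh_ob F x"
  shows "element F x b \<in> hom (Psh C) (yoneda C x) F"
  unfolding element_def
proof (rule nt_hom[OF yoneda_presheaf F])
  fix z a assume z: "z \<in> Obj C" and "a \<in> psh_ob (yoneda C x) z"
  then show "psh_map F a b \<in> psh_ob F z" using presheafD(1)[OF F _ b] by simp
next
  fix h y z a assume h: "h \<in> hom C y z" and "a \<in> psh_ob (yoneda C x) z"
  then have "a \<in> hom C z x" using C.hom_Obj[OF h] by simp
  then show "psh_map F (psh_map (yoneda C x) h a) b = psh_map F h (psh_map F a b)"
    using h b presheafD(3)[OF F] by (simp add: yoneda_map)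
qed

lemma element_comp [simp]:
  assumes "g \<in> hom C z x"
  shows "pa_comp (element F x b) z g = psh_map F g b"
  using assms C.hom_Obj[OF assms] by (simp add: element_def)

lemma comp_element:
  assumes \<alpha>: "\<alpha> \<in> hom (Psh C) F G" and x: "x \<in> Obj C" and b: "b \<in> psh_ob F x"
  shows "\<alpha> \<cdot>\<^bsub>Psh C\<^esub> element F x b = element G x (pa_comp \<alpha> x b)"
proof (rule Psh_ext)
  have F: "presheaf C F" and G: "presheaf C G" using Psh_homD[OF \<alpha>] by auto
  show "\<alpha> \<cdot>\<^bsub>Psh C\<^esub> element F x b \<in> hom (Psh C) (yoneda C x) G"
    using Psh_comp_hom[OF element_hom[OF F x b] \<alpha>] .
  show "element G x (pa_comp \<alpha> x b) \<in> hom (Psh C) (yoneda C x) G"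
    using element_hom[OF G x] Psh_homD(3)[OF \<alpha> x b] by blast
  fix z g assume z: "z \<in> Obj C" and "g \<in> psh_ob (yoneda C x) z"
  then have g: "g \<in> hom C z x" by simp
  then show "pa_comp (\<alpha> \<cdot>\<^bsub>Psh C\<^esub> element F x b) z g = pa_comp (element G x (pa_comp \<alpha> x b)) z g"
    using z Psh_homD(4)[OF \<alpha> g b] by (simp add: Psh_comp[OF element_hom[OF F x b]])
qed

lemma element_of_ident:
  assumes \<alpha>: "\<alpha> \<in> hom (Psh C) (yoneda C x) F" and g: "g \<in> hom C z x"
  shows "pa_comp \<alpha> z g = psh_map F g (pa_comp \<alpha> x (Ident C x))"
proof -
  have x: "x \<in> Obj C" using C.hom_Obj[OF g] by simp
  have i: "Ident C x \<in> psh_ob (yoneda C x) x" using C.ident_hom[OF x] x by simp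
  show ?thesis
    using Psh_homD(4)[OF \<alpha> g i] yoneda_map[OF g C.ident_hom[OF x]] C.ident_comp[OF g] by simp
qed

lemma element_ident:
  assumes "presheaf C F" "x \<in> Obj C" "b \<in> psh_ob F x"
  shows "pa_comp (element F x b) x (Ident C x) = b"
  using assms presheafD(2) C.ident_hom by simp

subsection \<open>Monomorphisms and pullbacks are computed pointwise\<close>

text \<open>Representables detect the injectivity of the components: an element is a map out of a
  representable.\<close>

lemma monic_iff_inj:
  assumes \<alpha>: "\<alpha> \<in> hom (Psh C) F G"
  shows "monic (Psh C) \<alpha> \<longleftrightarrow> (\<forall>x\<in>Obj C. inj_on (pa_comp \<alpha> x) (psh_ob F x))"
proof
  assume m: "monic (Psh C) \<alpha>"
  show "\<forall>x\<in>Obj C. inj_on (pa_comp \<alpha> x) (psh_ob F x)"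
  proof (intro ballI inj_onI)
    fix x a b assume x: "x \<in> Obj C" and ab: "a \<in> psh_ob F x" "b \<in> psh_ob F x"
      "pa_comp \<alpha> x a = pa_comp \<alpha> x b"
    have F: "presheaf C F" using Psh_homD[OF \<alpha>] by simp
    have "element F x a = element F x b"
      using E.monicD[OF m \<alpha> element_hom[OF F x ab(1)] element_hom[OF F x ab(2)]]
        comp_element[OF \<alpha> x] ab by simp
    then show "a = b" using element_ident[OF F x] ab by metis
  qed
next
  assume inj: "\<forall>x\<in>Obj C. inj_on (pa_comp \<alpha> x) (psh_ob F x)"
  have d: "Dom (Psh C) \<alpha> = F" "\<alpha> \<in> Arr (Psh C)" using \<alpha> by (auto simp: hom_def)
  show "monic (Psh C) \<alpha>"
    unfolding monic_def d
  proof (intro conjI allI ballI impI)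
    fix H u v assume u: "u \<in> hom (Psh C) H F" and v: "v \<in> hom (Psh C) H F"
      and e: "\<alpha> \<cdot>\<^bsub>Psh C\<^esub> u = \<alpha> \<cdot>\<^bsub>Psh C\<^esub> v"
    show "u = v"
    proof (rule Psh_ext[OF u v])
      fix x a assume x: "x \<in> Obj C" and a: "a \<in> psh_ob H x"
      have "pa_comp \<alpha> x (pa_comp u x a) = pa_comp \<alpha> x (pa_comp v x a)"
        using e Psh_comp[OF u x a, of \<alpha>] Psh_comp[OF v x a, of \<alpha>] by simp
      then show "pa_comp u x a = pa_comp v x a"
        using inj x Psh_homD(3)[OF u x a] Psh_homD(3)[OF v x a] by (auto dest: inj_onD)
    qed
  qed (rule d)
qed

definition im :: "'v psh_arr \<Rightarrow> 'v \<Rightarrow> 'v set" where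
  "im m x = pa_comp m x ` psh_ob (pa_dom m) x"

lemma im_iff: "m \<in> hom (Psh C) A B \<Longrightarrow> b \<in> im m x \<longleftrightarrow> (\<exists>a\<in>psh_ob A x. b = pa_comp m x a)"
  by (auto simp: im_def Psh_hom_iff)

lemma im_restrict:
  assumes m: "m \<in> hom (Psh C) A B" and h: "h \<in> hom C y x" and b: "b \<in> im m x"
  shows "psh_map B h b \<in> im m y"
proof -
  obtain a where a: "a \<in> psh_ob A x" "b = pa_comp m x a" using b im_iff[OF m] by blast
  then have "psh_map B h b = pa_comp m y (psh_map A h a)" using Psh_homD(4)[OF m h] by simp
  then show ?thesis using presheafD(1)[OF Psh_homD(1)[OF m] h a(1)] im_iff[OF m] by blast
qed

text \<open>A square between monomorphisms is a pullback exactly when its bottom side preserves and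
  reflects membership in the two subobjects; its top side is then determined. The next lemmas
  prove the two directions of this criterion, which produces every pullback square of presheaves
  that is needed.\<close>

lemma pullback_im:
  assumes m: "m \<in> hom (Psh C) A B" and n: "n \<in> hom (Psh C) A' B'"
    and pb: "pullback_sq (Psh C) m n s g"
    and x: "x \<in> Obj C" and b: "b \<in> psh_ob B x"
  shows "b \<in> im m x \<longleftrightarrow> pa_comp g x b \<in> im n x"
proof -
  have s: "s \<in> hom (Psh C) A A'" and g: "g \<in> hom (Psh C) B B'"
    and c: "n \<cdot>\<^bsub>Psh C\<^esub> s = g \<cdot>\<^bsub>Psh C\<^esub> m"
    and ump: "\<And>z u v. u \<in> hom (Psh C) z A' \<Longrightarrow> v \<in> hom (Psh C) z B \<Longrightarrow>
       n \<cdot>\<^bsub>Psh C\<^esub> u = g \<cdot>\<^bsub>Psh C\<^esub> v \<Longrightarrow>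
       \<exists>w. w \<in> hom (Psh C) z A \<and> m \<cdot>\<^bsub>Psh C\<^esub> w = v"
    using pb unfolding E.pullback_sq_iff[OF m n] by blast+
  show ?thesis
  proof
    assume "b \<in> im m x"
    then obtain a where a: "a \<in> psh_ob A x" "b = pa_comp m x a" using im_iff[OF m] by blast
    have "pa_comp g x b = pa_comp n x (pa_comp s x a)"
      using Psh_comp[OF s x a(1), of n] Psh_comp[OF m x a(1), of g] c a(2) by simp
    then show "pa_comp g x b \<in> im n x" using Psh_homD(3)[OF s x a(1)] im_iff[OF n] by blast
  next
    assume "pa_comp g x b \<in> im n x"
    then obtain a' where a': "a' \<in> psh_ob A' x" "pa_comp g x b = pa_comp n x a'"
      using im_iff[OF n] by blast
    have P: "presheaf C A'" "presheaf C B" using Psh_homD[OF n] Psh_homD[OF m] by auto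
    have "n \<cdot>\<^bsub>Psh C\<^esub> element A' x a' = g \<cdot>\<^bsub>Psh C\<^esub> element B x b"
      using comp_element[OF n x a'(1)] comp_element[OF g x b] a'(2) by simp
    from ump[OF element_hom[OF P(1) x a'(1)] element_hom[OF P(2) x b] this]
    obtain w where w: "w \<in> hom (Psh C) (yoneda C x) A" "m \<cdot>\<^bsub>Psh C\<^esub> w = element B x b" by blast
    have i: "Ident C x \<in> psh_ob (yoneda C x) x" using x C.ident_hom by simp
    have "b = pa_comp m x (pa_comp w x (Ident C x))"
      using Psh_comp[OF w(1) x i, of m] w(2) element_ident[OF P(2) x b] by simp
    then show "b \<in> im m x" using Psh_homD(3)[OF w(1) x i] im_iff[OF m] by blast
  qed
qed

lemma lift_along_monic:
  assumes n: "n \<in> hom (Psh C) A' B'" "monic (Psh C) n"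
    and g: "g \<in> hom (Psh C) D B'"
    and im: "\<And>x b. x \<in> Obj C \<Longrightarrow> b \<in> psh_ob D x \<Longrightarrow> pa_comp g x b \<in> im n x"
  shows "\<exists>s\<in>hom (Psh C) D A'. n \<cdot>\<^bsub>Psh C\<^esub> s = g"
proof -
  define \<phi> where "\<phi> x b = (SOME a. a \<in> psh_ob A' x \<and> pa_comp g x b = pa_comp n x a)" for x b
  have \<phi>: "\<phi> x b \<in> psh_ob A' x \<and> pa_comp g x b = pa_comp n x (\<phi> x b)"
    if "x \<in> Obj C" "b \<in> psh_ob D x" for x b
    unfolding \<phi>_def by (rule someI_ex) (use im[OF that] im_iff[OF n(1)] in blast)
  have P: "presheaf C D" "presheaf C A'" using Psh_homD[OF n(1)] Psh_homD[OF g] by auto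
  have s: "nt C D A' \<phi> \<in> hom (Psh C) D A'"
  proof (rule nt_hom[OF P])
    fix h y x a assume h: "h \<in> hom C y x" and a: "a \<in> psh_ob D x"
    have o: "y \<in> Obj C" "x \<in> Obj C" using C.hom_Obj[OF h] by auto
    have ha: "psh_map D h a \<in> psh_ob D y" using presheafD(1)[OF P(1) h a] .
    have "pa_comp n y (\<phi> y (psh_map D h a)) = pa_comp n y (psh_map A' h (\<phi> x a))"
      using \<phi>[OF o(1) ha] \<phi>[OF o(2) a] Psh_homD(4)[OF g h a] Psh_homD(4)[OF n(1) h, of "\<phi> x a"]
      by simp
    then show "\<phi> y (psh_map D h a) = psh_map A' h (\<phi> x a)"
      using n(2) \<phi>[OF o(1) ha] \<phi>[OF o(2) a] presheafD(1)[OF P(2) h, of "\<phi> x a"] o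
      unfolding monic_iff_inj[OF n(1)] by (auto dest: inj_onD)
  qed (use \<phi> in blast)
  moreover have "n \<cdot>\<^bsub>Psh C\<^esub> nt C D A' \<phi> = g"
    by (rule Psh_ext[OF Psh_comp_hom[OF s n(1)] g]) (use \<phi> in \<open>simp add: Psh_comp[OF s]\<close>)
  ultimately show ?thesis by blast
qed

lemma pullback_of_monic:
  assumes m: "m \<in> hom (Psh C) A B" "monic (Psh C) m" and n: "n \<in> hom (Psh C) A' B'" "monic (Psh C) n"
    and g: "g \<in> hom (Psh C) B B'"
    and im: "\<And>x b. x \<in> Obj C \<Longrightarrow> b \<in> psh_ob B x \<Longrightarrow> b \<in> im m x \<longleftrightarrow> pa_comp g x b \<in> im n x"
  shows "\<exists>!s. pullback_sq (Psh C) m n s g"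
proof -
  have gm: "g \<cdot>\<^bsub>Psh C\<^esub> m \<in> hom (Psh C) A B'" using Psh_comp_hom[OF m(1) g] .
  have "pa_comp (g \<cdot>\<^bsub>Psh C\<^esub> m) x a \<in> im n x" if "x \<in> Obj C" "a \<in> psh_ob A x" for x a
    using im[OF that(1) Psh_homD(3)[OF m(1) that]] im_iff[OF m(1)] that Psh_comp[OF m(1) that] by auto
  from lift_along_monic[OF n gm this]
  obtain s where s: "s \<in> hom (Psh C) A A'" "n \<cdot>\<^bsub>Psh C\<^esub> s = g \<cdot>\<^bsub>Psh C\<^esub> m" by blast
  have "pullback_sq (Psh C) m n s g"
    unfolding E.pullback_sq_iff[OF m(1) n(1)]
  proof (intro conjI allI ballI impI)
    fix D u v assume u: "u \<in> hom (Psh C) D A'" and v: "v \<in> hom (Psh C) D B"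
      and e: "n \<cdot>\<^bsub>Psh C\<^esub> u = g \<cdot>\<^bsub>Psh C\<^esub> v"
    have "pa_comp v x b \<in> im m x" if "x \<in> Obj C" "b \<in> psh_ob D x" for x b
      using im[OF that(1) Psh_homD(3)[OF v that]] e Psh_comp[OF u that, of n] Psh_comp[OF v that, of g]
        im_iff[OF n(1)] Psh_homD(3)[OF u that] by auto
    from lift_along_monic[OF m v this]
    obtain w where w: "w \<in> hom (Psh C) D A" "m \<cdot>\<^bsub>Psh C\<^esub> w = v" by blast
    have "n \<cdot>\<^bsub>Psh C\<^esub> (s \<cdot>\<^bsub>Psh C\<^esub> w) = n \<cdot>\<^bsub>Psh C\<^esub> u"
      using E.comp_assoc[OF w(1) s(1) n(1)] E.comp_assoc[OF w(1) m(1) g] s w e by simp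
    then have "s \<cdot>\<^bsub>Psh C\<^esub> w = u" using E.monicD[OF n(2,1) Psh_comp_hom[OF w(1) s(1)] u] by simp
    moreover have "w' = w" if "w' \<in> hom (Psh C) D A" "m \<cdot>\<^bsub>Psh C\<^esub> w' = v" for w'
      using E.monicD[OF m(2,1) that(1) w(1)] that w by simp
    ultimately show "\<exists>!w. w \<in> hom (Psh C) D A \<and> s \<cdot>\<^bsub>Psh C\<^esub> w = u \<and> m \<cdot>\<^bsub>Psh C\<^esub> w = v"
      using w by blast
  qed (use s g in auto)
  moreover have "s' = s" if "pullback_sq (Psh C) m n s' g" for s'
    using that s E.monicD[OF n(2,1)] unfolding E.pullback_sq_iff[OF m(1) n(1)] by metis
  ultimately show ?thesis by blast
qed

section \<open>Sieves and the maps that they classify\<close>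

lemma sub_psh_presheaf:
  assumes F: "presheaf C F" and sub: "\<And>x. x \<in> Obj C \<Longrightarrow> V x \<subseteq> psh_ob F x"
    and stable: "\<And>h y x a. h \<in> hom C y x \<Longrightarrow> a \<in> V x \<Longrightarrow> psh_map F h a \<in> V y"
  shows "presheaf C (sub_psh C F V)"
proof (rule presheafI)
  fix x assume "x \<in> Obj C" then show "small (psh_ob (sub_psh C F V) x)"
    using small_subset[OF presheafD(4)[OF F] sub] by (simp add: sub_psh_def)
next
  fix h y x a assume h: "h \<in> hom C y x" and a: "a \<in> psh_ob (sub_psh C F V) x"
  have o: "x \<in> Obj C" "y \<in> Obj C" "h \<in> Arr C" "Cod C h = x" using C.hom_Obj[OF h] h by (auto simp: hom_def)
  have aV: "a \<in> V x" using a o by (simp add: sub_psh_def)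
  show "psh_map (sub_psh C F V) h a \<in> psh_ob (sub_psh C F V) y"
    using stable[OF h aV] aV o by (simp add: sub_psh_def)
  fix g z assume g: "g \<in> hom C z y"
  have o': "g \<in> Arr C" "Cod C g = y" using g by (auto simp: hom_def)
  have o2: "h \<cdot>\<^bsub>C\<^esub> g \<in> Arr C" "Cod C (h \<cdot>\<^bsub>C\<^esub> g) = x" using C.comp_hom[OF g h] by (auto simp: hom_def)
  show "psh_map (sub_psh C F V) (h \<cdot>\<^bsub>C\<^esub> g) a = psh_map (sub_psh C F V) g (psh_map (sub_psh C F V) h a)"
    using o o' o2 aV stable[OF h aV] presheafD(3)[OF F h g] sub[OF o(1)] by (auto simp: sub_psh_def)
next
  fix x a assume x: "x \<in> Obj C" and "a \<in> psh_ob (sub_psh C F V) x"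
  then have aV: "a \<in> V x" by (simp add: sub_psh_def)
  have "Ident C x \<in> Arr C" "Cod C (Ident C x) = x" using C.ident_hom[OF x] by (auto simp: hom_def)
  then show "psh_map (sub_psh C F V) (Ident C x) a = a"
    using aV x sub[OF x] presheafD(2)[OF F x] by (auto simp: sub_psh_def)
next
  fix h assume h: "h \<in> Arr C"
  then have "Cod C h \<in> Obj C" using C.hom_Obj[OF C.arr_hom] by blast
  then show "psh_map (sub_psh C F V) h \<in> extensional (psh_ob (sub_psh C F V) (Cod C h))"
    using h by (simp add: sub_psh_def)
qed (simp_all add: sub_psh_def)

lemma sub_psh_ob [simp]: "x \<in> Obj C \<Longrightarrow> psh_ob (sub_psh C F V) x = V x"
  by (simp add: sub_psh_def)

lemma sub_psh_map: "h \<in> hom C y x \<Longrightarrow> a \<in> V x \<Longrightarrow> psh_map (sub_psh C F V) h a = psh_map F h a"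
  by (auto simp: sub_psh_def hom_def)

lemma sub_incl:
  assumes F: "presheaf C F" and sub: "\<And>x. x \<in> Obj C \<Longrightarrow> V x \<subseteq> psh_ob F x"
    and stable: "\<And>h y x a. h \<in> hom C y x \<Longrightarrow> a \<in> V x \<Longrightarrow> psh_map F h a \<in> V y"
  shows "sub_incl C F V \<in> hom (Psh C) (sub_psh C F V) F" "monic (Psh C) (sub_incl C F V)"
    "x \<in> Obj C \<Longrightarrow> im (sub_incl C F V) x = V x"
proof -
  have e: "sub_incl C F V = nt C (sub_psh C F V) F (\<lambda>x a. a)"
    unfolding sub_incl_def nt_def by (auto simp: fun_eq_iff restrict_def)
  show h: "sub_incl C F V \<in> hom (Psh C) (sub_psh C F V) F"
    unfolding e
  proof (rule nt_hom[OF sub_psh_presheaf[OF F sub stable] F])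
    fix x a assume "x \<in> Obj C" "a \<in> psh_ob (sub_psh C F V) x"
    then show "a \<in> psh_ob F x" using sub by auto
  next
    fix h y x a assume h: "h \<in> hom C y x" and "a \<in> psh_ob (sub_psh C F V) x"
    then show "psh_map (sub_psh C F V) h a = psh_map F h a"
      using C.hom_Obj[OF h] sub_psh_map[OF h] by simp
  qed
  show "monic (Psh C) (sub_incl C F V)"
    unfolding monic_iff_inj[OF h] by (auto simp: e intro!: inj_onI)
  show "x \<in> Obj C \<Longrightarrow> im (sub_incl C F V) x = V x"
    by (auto simp: im_def sub_incl_def image_iff)
qed

lemma sievesD:
  assumes "S \<in> sieves C x"
  shows "g \<in> S \<Longrightarrow> g \<in> hom C (Dom C g) x" and "g \<in> S \<Longrightarrow> f \<in> hom C z (Dom C g) \<Longrightarrow> g \<cdot>\<^bsub>C\<^esub> f \<in> S"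
  using assms by (auto simp: sieves_def hom_def)

lemma sieve_incl:
  assumes S: "S \<in> sieves C x"
  shows "\<exists>A. sieve_incl C x S \<in> hom (Psh C) A (yoneda C x)" "monic (Psh C) (sieve_incl C x S)"
    "g \<in> hom C z x \<Longrightarrow> g \<in> im (sieve_incl C x S) z \<longleftrightarrow> g \<in> S"
proof -
  let ?V = "\<lambda>z. {g \<in> S. Dom C g = z}"
  have sub: "?V z \<subseteq> psh_ob (yoneda C x) z" if "z \<in> Obj C" for z
    using that sievesD(1)[OF S] by auto
  have stable: "psh_map (yoneda C x) h a \<in> ?V y" if h: "h \<in> hom C y z" and a: "a \<in> ?V z" for h y z a
  proof -
    have ax: "a \<in> hom C z x" using sievesD(1)[OF S, of a] a by simp
    have "a \<cdot>\<^bsub>C\<^esub> h \<in> S" using sievesD(2)[OF S, of a h y] a h by simp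
    then show ?thesis using C.comp_hom[OF h ax] yoneda_map[OF h ax] by (simp add: hom_def)
  qed
  have s: "sub_incl C (yoneda C x) ?V \<in> hom (Psh C) (sub_psh C (yoneda C x) ?V) (yoneda C x)"
    "monic (Psh C) (sub_incl C (yoneda C x) ?V)"
    "\<And>z. z \<in> Obj C \<Longrightarrow> im (sub_incl C (yoneda C x) ?V) z = ?V z"
    by (rule sub_incl[OF yoneda_presheaf]; use sub stable in blast)+
  show "\<exists>A. sieve_incl C x S \<in> hom (Psh C) A (yoneda C x)" "monic (Psh C) (sieve_incl C x S)"
    using s(1,2) unfolding sieve_incl_def by blast+
  show "g \<in> im (sieve_incl C x S) z \<longleftrightarrow> g \<in> S" if g: "g \<in> hom C z x"
    unfolding sieve_incl_def using s(3)[of z] C.hom_Obj[OF g] g by (auto simp: hom_def)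
qed

text \<open>The sieve of all restrictions of \<open>b\<close> that lie in the subobject \<open>n\<close>: the pullback of \<open>n\<close>
  along the element \<open>b\<close>, and the value at \<open>b\<close> of the classifying map of \<open>n\<close>.\<close>

definition image_sieve :: "'v psh_arr \<Rightarrow> 'v \<Rightarrow> 'v \<Rightarrow> 'v set" where
  "image_sieve n x b = {h \<in> Arr C. Cod C h = x \<and> psh_map (pa_cod n) h b \<in> im n (Dom C h)}"

lemma image_sieve_iff:
  "n \<in> hom (Psh C) A B \<Longrightarrow> h \<in> hom C y x \<Longrightarrow> h \<in> image_sieve n x b \<longleftrightarrow> psh_map B h b \<in> im n y"
  unfolding image_sieve_def Psh_hom_iff by (auto simp: hom_def)

lemma image_sieve_hom: "h \<in> image_sieve n x b \<Longrightarrow> h \<in> hom C (Dom C h) x"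
  by (auto simp: image_sieve_def hom_def)

lemma image_sieve:
  assumes n: "n \<in> hom (Psh C) A B" and b: "b \<in> psh_ob B x"
  shows "image_sieve n x b \<in> sieves C x"
  unfolding sieves_def
proof (intro CollectI conjI ballI impI)
  show "image_sieve n x b \<subseteq> {g \<in> Arr C. Cod C g = x}" by (auto simp: image_sieve_def)
  fix g f assume gi: "g \<in> image_sieve n x b" and "f \<in> Arr C" "Cod C f = Dom C g"
  then have g: "g \<in> hom C (Dom C g) x" and f: "f \<in> hom C (Dom C f) (Dom C g)"
    using image_sieve_hom by (auto simp: hom_def)
  have "psh_map B g b \<in> im n (Dom C g)" using gi image_sieve_iff[OF n g] by simp
  then have "psh_map B f (psh_map B g b) \<in> im n (Dom C f)" using im_restrict[OF n f] by blast
  then show "g \<cdot>\<^bsub>C\<^esub> f \<in> image_sieve n x b"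
    using image_sieve_iff[OF n C.comp_hom[OF f g]] presheafD(3)[OF Psh_homD(2)[OF n] g f b] by simp
qed

lemma image_sieve_pullback:
  assumes n: "n \<in> hom (Psh C) A B" "monic (Psh C) n" and x: "x \<in> Obj C" and b: "b \<in> psh_ob B x"
  shows "\<exists>!s. pullback_sq (Psh C) (sieve_incl C x (image_sieve n x b)) n s (element B x b)"
proof -
  note S = image_sieve[OF n(1) b]
  obtain A' where A': "sieve_incl C x (image_sieve n x b) \<in> hom (Psh C) A' (yoneda C x)"
    using sieve_incl(1)[OF S] by blast
  show ?thesis
  proof (rule pullback_of_monic[OF A' sieve_incl(2)[OF S] n element_hom[OF Psh_homD(2)[OF n(1)] x b]])
    fix z g assume "z \<in> Obj C" "g \<in> psh_ob (yoneda C x) z"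
    then have g: "g \<in> hom C z x" by simp
    show "g \<in> im (sieve_incl C x (image_sieve n x b)) z \<longleftrightarrow> pa_comp (element B x b) z g \<in> im n z"
      using sieve_incl(3)[OF S g] image_sieve_iff[OF n(1) g] g by simp
  qed
qed

text \<open>Restriction in \<open>\<Omega>\<close> is a pullback of subobjects of representables, so that it inherits the
  stability of a class of monomorphisms.\<close>

lemma sieve_pullback_eq:
  assumes S: "S \<in> sieves C x" and f: "f \<in> hom C y x"
  shows "sieve_pullback C f S = image_sieve (sieve_incl C x S) y f"
proof -
  obtain A where A: "sieve_incl C x S \<in> hom (Psh C) A (yoneda C x)" using sieve_incl(1)[OF S] by blast
  have "h \<in> sieve_pullback C f S \<longleftrightarrow> h \<in> image_sieve (sieve_incl C x S) y f" for h
  proof (cases "h \<in> hom C (Dom C h) y")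
    case True
    then show ?thesis
      using image_sieve_iff[OF A True] sieve_incl(3)[OF S C.comp_hom[OF True f]] yoneda_map[OF True f] f
      by (auto simp: sieve_pullback_def hom_def)
  next
    case False
    then show ?thesis using image_sieve_hom f by (auto simp: sieve_pullback_def hom_def)
  qed
  then show ?thesis by blast
qed

lemma sieve_pullback_sieve:
  assumes S: "S \<in> sieves C x" and f: "f \<in> hom C y x"
  shows "sieve_pullback C f S \<in> sieves C y"
proof -
  obtain A where A: "sieve_incl C x S \<in> hom (Psh C) A (yoneda C x)" using sieve_incl(1)[OF S] by blast
  show ?thesis unfolding sieve_pullback_eq[OF assms]
    by (rule image_sieve[OF A]) (use f C.hom_Obj[OF f] in simp)
qed

lemma sieve_code_eq:
  assumes "S \<in> sieves C x" "S' \<in> sieves C x'"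
  shows "sieve_code C S = sieve_code C S' \<longleftrightarrow> S = S'"
  using assms inj_onD[OF inj_sieve_code, of S S'] by (auto simp: sieves_def)

lemma Omega_map:
  assumes S: "S \<in> sieves C x" and f: "f \<in> hom C y x"
  shows "psh_map (Omega C) f (sieve_code C S) = sieve_code C (sieve_pullback C f S)"
proof -
  have "inv_into (Pow (Arr C)) (sieve_code C) (sieve_code C S) = S"
    by (rule inv_into_f_f[OF inj_sieve_code]) (use S in \<open>auto simp: sieves_def\<close>)
  then show ?thesis using S f by (simp add: Omega_def hom_def)
qed

lemma sieve_pullback_comp:
  assumes S: "S \<in> sieves C x" and f: "f \<in> hom C y x" and g: "g \<in> hom C z y"
  shows "sieve_pullback C (f \<cdot>\<^bsub>C\<^esub> g) S = sieve_pullback C g (sieve_pullback C f S)"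
proof -
  have "h \<in> sieve_pullback C (f \<cdot>\<^bsub>C\<^esub> g) S \<longleftrightarrow> h \<in> sieve_pullback C g (sieve_pullback C f S)" for h
  proof (cases "h \<in> hom C (Dom C h) z")
    case True
    then show ?thesis
      using C.comp_assoc[OF True g f] C.comp_hom[OF True g] C.comp_hom[OF g f] f g
      by (auto simp: sieve_pullback_def hom_def)
  next
    case False
    then show ?thesis using C.comp_hom[OF g f] g by (auto simp: sieve_pullback_def hom_def)
  qed
  then show ?thesis by blast
qed

lemma sieve_pullback_ident:
  assumes S: "S \<in> sieves C x" and x: "x \<in> Obj C"
  shows "sieve_pullback C (Ident C x) S = S"
proof -
  have "g \<in> sieve_pullback C (Ident C x) S \<longleftrightarrow> g \<in> S" for g
    using C.ident_hom[OF x] C.ident_comp[of g "Dom C g" x] sievesD(1)[OF S, of g]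
    by (auto simp: sieve_pullback_def hom_def)
  then show ?thesis by blast
qed

lemma Omega_presheaf: "presheaf C (Omega C)"
proof (rule presheafI)
  fix x assume "x \<in> Obj C" then show "small (psh_ob (Omega C) x)"
    using small_sieve_code by (simp add: Omega_def)
next
  fix h y x a assume h: "h \<in> hom C y x" and a: "a \<in> psh_ob (Omega C) x"
  have o: "x \<in> Obj C" "y \<in> Obj C" using C.hom_Obj[OF h] by auto
  obtain S where S: "S \<in> sieves C x" "a = sieve_code C S" using a o by (auto simp: Omega_def)
  note hS = sieve_pullback_sieve[OF S(1) h]
  show "psh_map (Omega C) h a \<in> psh_ob (Omega C) y"
    using hS Omega_map[OF S(1) h] S o by (simp add: Omega_def)
  fix g z assume g: "g \<in> hom C z y"
  show "psh_map (Omega C) (h \<cdot>\<^bsub>C\<^esub> g) a = psh_map (Omega C) g (psh_map (Omega C) h a)"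
    using Omega_map[OF S(1) C.comp_hom[OF g h]] Omega_map[OF S(1) h] Omega_map[OF hS g]
      sieve_pullback_comp[OF S(1) h g] S by simp
next
  fix x a assume x: "x \<in> Obj C" and "a \<in> psh_ob (Omega C) x"
  then obtain S where S: "S \<in> sieves C x" "a = sieve_code C S" by (auto simp: Omega_def)
  then show "psh_map (Omega C) (Ident C x) a = a"
    using Omega_map[OF S(1) C.ident_hom[OF x]] sieve_pullback_ident[OF S(1) x] by simp
next
  fix h assume h: "h \<in> Arr C"
  then have "Cod C h \<in> Obj C" using C.hom_Obj[OF C.arr_hom] by blast
  then show "psh_map (Omega C) h \<in> extensional (psh_ob (Omega C) (Cod C h))"
    using h by (simp add: Omega_def)
qed (simp_all add: Omega_def)

text \<open>The value of \<open>\<top> : 1 \<rightarrow> \<Omega>\<close> at \<open>x\<close>.\<close>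

definition top_sieve :: "'v \<Rightarrow> 'v set" where
  "top_sieve x = {g \<in> Arr C. Cod C g = x}"

lemma top_sieve: "top_sieve x \<in> sieves C x"
  using C.comp_hom by (auto simp: top_sieve_def sieves_def hom_def)

text \<open>An element of \<open>\<Omega>\<close> is recovered as the pullback of \<open>\<top>\<close> along itself; this is what makes
  classifying maps unique.\<close>

lemma sieve_pullback_top_iff:
  assumes S: "S \<in> sieves C x" and f: "f \<in> hom C y x"
  shows "sieve_pullback C f S = top_sieve y \<longleftrightarrow> f \<in> S"
proof
  have y: "y \<in> Obj C" using C.hom_Obj[OF f] by simp
  assume "sieve_pullback C f S = top_sieve y"
  moreover have "Ident C y \<in> top_sieve y" using C.ident_hom[OF y] by (auto simp: top_sieve_def hom_def)
  ultimately have "f \<cdot>\<^bsub>C\<^esub> Ident C y \<in> S" by (auto simp: sieve_pullback_def)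
  then show "f \<in> S" using C.comp_ident[OF f] by simp
next
  assume a: "f \<in> S"
  have "f \<cdot>\<^bsub>C\<^esub> h \<in> S" if "h \<in> top_sieve y" for h
    using sievesD(2)[OF S a, of h "Dom C h"] that f by (auto simp: top_sieve_def hom_def)
  then show "sieve_pullback C f S = top_sieve y"
    using f by (auto simp: sieve_pullback_def top_sieve_def hom_def)
qed

subsection \<open>Products of presheaves\<close>

lemma prod_psh_ob: "x \<in> Obj C \<Longrightarrow> psh_ob (prod_psh C F G) x = pair_code ` (psh_ob F x \<times> psh_ob G x)"
  by (simp add: prod_psh_def)

lemma prod_psh_map:
  "h \<in> hom C y x \<Longrightarrow> a \<in> psh_ob F x \<Longrightarrow> b \<in> psh_ob G x \<Longrightarrow>
     psh_map (prod_psh C F G) h (pair_code (a, b)) = pair_code (psh_map F h a, psh_map G h b)"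
  by (auto simp: prod_psh_def hom_def)

lemma prod_psh_presheaf:
  assumes F: "presheaf C F" and G: "presheaf C G"
  shows "presheaf C (prod_psh C F G)"
proof (rule presheafI)
  fix x assume "x \<in> Obj C" then show "small (psh_ob (prod_psh C F G) x)"
    using small_pair_Sigma[OF presheafD(4)[OF F] presheafD(4)[OF G]] by (simp add: prod_psh_ob)
next
  fix h y x p assume h: "h \<in> hom C y x" and p: "p \<in> psh_ob (prod_psh C F G) x"
  have o: "x \<in> Obj C" "y \<in> Obj C" using C.hom_Obj[OF h] by auto
  obtain a b where ab: "a \<in> psh_ob F x" "b \<in> psh_ob G x" "p = pair_code (a, b)"
    using p prod_psh_ob[OF o(1)] by auto
  note ha = presheafD(1)[OF F h ab(1)] and hb = presheafD(1)[OF G h ab(2)]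
  show "psh_map (prod_psh C F G) h p \<in> psh_ob (prod_psh C F G) y"
    using ab ha hb o prod_psh_map[OF h ab(1,2)] prod_psh_ob by simp
  fix g z assume g: "g \<in> hom C z y"
  show "psh_map (prod_psh C F G) (h \<cdot>\<^bsub>C\<^esub> g) p
      = psh_map (prod_psh C F G) g (psh_map (prod_psh C F G) h p)"
    using prod_psh_map[OF C.comp_hom[OF g h] ab(1,2)] prod_psh_map[OF h ab(1,2)] prod_psh_map[OF g ha hb]
      presheafD(3)[OF F h g ab(1)] presheafD(3)[OF G h g ab(2)] ab(3) by simp
next
  fix x p assume x: "x \<in> Obj C" and "p \<in> psh_ob (prod_psh C F G) x"
  then obtain a b where ab: "a \<in> psh_ob F x" "b \<in> psh_ob G x" "p = pair_code (a, b)"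
    using prod_psh_ob by auto
  then show "psh_map (prod_psh C F G) (Ident C x) p = p"
    using prod_psh_map[OF C.ident_hom[OF x] ab(1,2)] presheafD(2)[OF F x] presheafD(2)[OF G x] by simp
next
  fix h assume h: "h \<in> Arr C"
  then have "Cod C h \<in> Obj C" using C.hom_Obj[OF C.arr_hom] by blast
  then show "psh_map (prod_psh C F G) h \<in> extensional (psh_ob (prod_psh C F G) (Cod C h))"
    using h by (simp add: prod_psh_def)
qed (simp_all add: prod_psh_def)

lemma snd_psh:
  assumes F: "presheaf C F" and G: "presheaf C G"
  shows "snd_psh C F G \<in> hom (Psh C) (prod_psh C F G) G"
    and "x \<in> Obj C \<Longrightarrow> a \<in> psh_ob F x \<Longrightarrow> b \<in> psh_ob G x \<Longrightarrow>
      pa_comp (snd_psh C F G) x (pair_code (a, b)) = b"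
proof -
  have e: "snd_psh C F G = nt C (prod_psh C F G) G (\<lambda>x p. snd (inv pair_code p))"
    by (simp add: snd_psh_def nt_def)
  show "snd_psh C F G \<in> hom (Psh C) (prod_psh C F G) G"
    unfolding e
  proof (rule nt_hom[OF prod_psh_presheaf[OF F G] G])
    fix h y x p assume h: "h \<in> hom C y x" and "p \<in> psh_ob (prod_psh C F G) x"
    then obtain a b where ab: "a \<in> psh_ob F x" "b \<in> psh_ob G x" "p = pair_code (a, b)"
      using prod_psh_ob C.hom_Obj[OF h] by auto
    then show "snd (inv pair_code (psh_map (prod_psh C F G) h p)) = psh_map G h (snd (inv pair_code p))"
      using prod_psh_map[OF h ab(1,2)] by simp
  qed (auto simp: prod_psh_ob)
  show "x \<in> Obj C \<Longrightarrow> a \<in> psh_ob F x \<Longrightarrow> b \<in> psh_ob G x \<Longrightarrow>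
      pa_comp (snd_psh C F G) x (pair_code (a, b)) = b"
    by (simp add: e prod_psh_ob)
qed

section \<open>The category of elements\<close>

text \<open>An object is an element \<open>b\<close> of \<open>B\<close> over \<open>x\<close>; an arrow is a pair of an arrow \<open>h\<close> of the base
  and an element \<open>b\<close> over its codomain, regarded as an arrow from the restriction of \<open>b\<close> along \<open>h\<close>
  to \<open>b\<close>.\<close>

definition elements :: "'v psh \<Rightarrow> ('v, 'v) cat" where
  "elements B = \<lparr>Obj = pair_code ` (SIGMA x:Obj C. psh_ob B x),
     Arr = pair_code ` (SIGMA h:Arr C. psh_ob B (Cod C h)),
     Dom = (\<lambda>u. case inv pair_code u of (h, b) \<Rightarrow> pair_code (Dom C h, psh_map B h b)),
     Cod = (\<lambda>u. case inv pair_code u of (h, b) \<Rightarrow> pair_code (Cod C h, b)),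
     Ident = (\<lambda>j. case inv pair_code j of (x, b) \<Rightarrow> pair_code (Ident C x, b)),
     Comp = (\<lambda>v u. case inv pair_code v of (k, c) \<Rightarrow> case inv pair_code u of (h, b) \<Rightarrow>
        pair_code (k \<cdot>\<^bsub>C\<^esub> h, c))\<rparr>"

lemma elements_simps [simp]:
  "Dom (elements B) (pair_code (h, b)) = pair_code (Dom C h, psh_map B h b)"
  "Cod (elements B) (pair_code (h, b)) = pair_code (Cod C h, b)"
  "Ident (elements B) (pair_code (h, b)) = pair_code (Ident C h, b)"
  "pair_code (k, c) \<cdot>\<^bsub>elements B\<^esub> pair_code (h, b) = pair_code (k \<cdot>\<^bsub>C\<^esub> h, c)"
  by (simp_all add: elements_def)

lemma elements_ObjE:
  assumes "j \<in> Obj (elements B)"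
  obtains x b where "j = pair_code (x, b)" "x \<in> Obj C" "b \<in> psh_ob B x"
  using assms by (auto simp: elements_def)

lemma elements_ArrE:
  assumes "u \<in> Arr (elements B)"
  obtains y x h b where "u = pair_code (h, b)" "h \<in> hom C y x" "b \<in> psh_ob B x"
  using assms by (auto simp: elements_def hom_def)

lemma elements_ObjI: "x \<in> Obj C \<Longrightarrow> b \<in> psh_ob B x \<Longrightarrow> pair_code (x, b) \<in> Obj (elements B)"
  by (auto simp: elements_def)

lemma elements_homI:
  "h \<in> hom C y x \<Longrightarrow> b \<in> psh_ob B x \<Longrightarrow>
     pair_code (h, b) \<in> hom (elements B) (pair_code (y, psh_map B h b)) (pair_code (x, b))"
  unfolding hom_def[of "elements B"] by (auto simp: elements_def hom_def)

lemma elements_small_category: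
  assumes B: "presheaf C B"
  shows "small_category (elements B)"
  unfolding small_category_def
proof (intro conjI)
  have o: "Cod C h \<in> Obj C" if "h \<in> Arr C" for h using C.hom_Obj[OF C.arr_hom[OF that]] by blast
  show "small (Obj (elements B))" "small (Arr (elements B))"
    using small_C presheafD(4)[OF B] o
    by (auto simp: elements_def small_category_def intro!: small_pair_Sigma)
  show "category (elements B)"
    unfolding category_def
  proof (intro conjI ballI impI)
    fix u assume "u \<in> Arr (elements B)"
    then obtain y x h b where u: "u = pair_code (h, b)" "h \<in> hom C y x" "b \<in> psh_ob B x"
      by (rule elements_ArrE)
    have xy: "x \<in> Obj C" "y \<in> Obj C" "Dom C h = y" "Cod C h = x"
      using C.hom_Obj[OF u(2)] u(2) by (auto simp: hom_def)
    show "Dom (elements B) u \<in> Obj (elements B)" "Cod (elements B) u \<in> Obj (elements B)"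
      using elements_ObjI presheafD(1)[OF B u(2,3)] u xy by auto
    show "u \<cdot>\<^bsub>elements B\<^esub> Ident (elements B) (Dom (elements B) u) = u"
      "Ident (elements B) (Cod (elements B) u) \<cdot>\<^bsub>elements B\<^esub> u = u"
      using u xy C.comp_ident[OF u(2)] C.ident_comp[OF u(2)] by auto
    fix v assume "v \<in> Arr (elements B)" and vu: "Dom (elements B) v = Cod (elements B) u"
    then obtain y' x' k c where v': "v = pair_code (k, c)" "k \<in> hom C y' x'" "c \<in> psh_ob B x'"
      by (elim elements_ArrE)
    then have v: "k \<in> hom C x x'" "psh_map B k c = b" using vu u xy by (auto simp: hom_def)
    show "v \<cdot>\<^bsub>elements B\<^esub> u \<in> hom (elements B) (Dom (elements B) u) (Cod (elements B) v)"
      using elements_homI[OF C.comp_hom[OF u(2) v(1)] v'(3)] presheafD(3)[OF B v(1) u(2) v'(3)] v v' u xy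
      by (auto simp: hom_def[of C])
    fix w assume "w \<in> Arr (elements B)" and wv: "Dom (elements B) w = Cod (elements B) v"
    then obtain y'' x'' l d where w': "w = pair_code (l, d)" "l \<in> hom C y'' x''" "d \<in> psh_ob B x''"
      by (elim elements_ArrE)
    then have w: "l \<in> hom C x' x''" using wv v' by (auto simp: hom_def)
    show "w \<cdot>\<^bsub>elements B\<^esub> (v \<cdot>\<^bsub>elements B\<^esub> u) = (w \<cdot>\<^bsub>elements B\<^esub> v) \<cdot>\<^bsub>elements B\<^esub> u"
      using C.comp_assoc[OF u(2) v(1) w] u v' w' by simp
  next
    fix j assume "j \<in> Obj (elements B)"
    then obtain x b where j: "j = pair_code (x, b)" "x \<in> Obj C" "b \<in> psh_ob B x" by (rule elements_ObjE)
    then show "Ident (elements B) j \<in> hom (elements B) j j"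
      using elements_homI[OF C.ident_hom[OF j(2)] j(3)] presheafD(2)[OF B] by simp
  qed
qed

end

section \<open>Membership in the class is local on representables\<close>

text \<open>The closure properties of the class that the classification uses. Identities are derived
  from the cylinder further below; they put the maximal sieves into \<open>K\<close>.\<close>

locale monic_class = presheaves C for C :: "('v, 'v) cat" +
  fixes M :: "'v psh_arr set"
  assumes M_monic: "m \<in> M \<Longrightarrow> monic (Psh C) m"
    and M_pullback: "n \<in> M \<Longrightarrow> pullback_sq (Psh C) m n s g \<Longrightarrow> m \<in> M"
    and M_identities: "presheaf C X \<Longrightarrow> Ident (Psh C) X \<in> M"
    and M_colimits: "has_small_colimits TYPE('v) (full_subcat (cart_arrows (Psh C)) M)"
begin

lemma M_hom: "m \<in> M \<Longrightarrow> m \<in> hom (Psh C) (pa_dom m) (pa_cod m)"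
  using M_monic Psh_arr by (auto simp: monic_def)

lemma image_sieve_in_M:
  assumes "n \<in> hom (Psh C) A B" "n \<in> M" "x \<in> Obj C" "b \<in> psh_ob B x"
  shows "sieve_incl C x (image_sieve n x b) \<in> M"
  using image_sieve_pullback[OF assms(1) M_monic[OF assms(2)] assms(3,4)] M_pullback[OF assms(2)] by blast

text \<open>The diagram, indexed by the elements of the codomain, of the pullbacks of \<open>n\<close> along these
  elements. The top sides of its squares are determined by the bottom sides, so that a definite
  description picks them.\<close>

definition restrictions ::
  "'v psh_arr \<Rightarrow> ('v, 'v, 'v psh_arr, 'v psh_arr \<times> 'v psh_arr \<times> 'v psh_arr \<times> 'v psh_arr) funct" where
  "restrictions n = \<lparr>FO = (\<lambda>j. case inv pair_code j of (x, b) \<Rightarrow> sieve_incl C x (image_sieve n x b)),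
     FA = (\<lambda>u. case inv pair_code u of (h, b) \<Rightarrow>
       let m = sieve_incl C (Dom C h) (image_sieve n (Dom C h) (psh_map (pa_cod n) h b));
           m' = sieve_incl C (Cod C h) (image_sieve n (Cod C h) b);
           g = element (yoneda C (Cod C h)) (Dom C h) h
       in (m, m', (THE s. pullback_sq (Psh C) m m' s g), g))\<rparr>"

lemma restrictions_pullback:
  assumes n: "n \<in> hom (Psh C) A B" and h: "h \<in> hom C y x" and b: "b \<in> psh_ob B x"
  shows "\<exists>!s. pullback_sq (Psh C) (sieve_incl C y (image_sieve n y (psh_map B h b)))
    (sieve_incl C x (image_sieve n x b)) s (element (yoneda C x) y h)"
proof -
  note B = Psh_homD(2)[OF n]
  note S = image_sieve[OF n b] and hb = presheafD(1)[OF B h b]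
  note S' = image_sieve[OF n hb]
  have y: "y \<in> Obj C" using C.hom_Obj[OF h] by simp
  obtain D D' where D: "sieve_incl C x (image_sieve n x b) \<in> hom (Psh C) D (yoneda C x)"
    and D': "sieve_incl C y (image_sieve n y (psh_map B h b)) \<in> hom (Psh C) D' (yoneda C y)"
    using sieve_incl(1)[OF S] sieve_incl(1)[OF S'] by blast
  have e: "element (yoneda C x) y h \<in> hom (Psh C) (yoneda C y) (yoneda C x)"
    using element_hom[OF yoneda_presheaf y] h y by simp
  show ?thesis
  proof (rule pullback_of_monic[OF D' sieve_incl(2)[OF S'] D sieve_incl(2)[OF S] e])
    fix z g assume "z \<in> Obj C" "g \<in> psh_ob (yoneda C y) z"
    then have g: "g \<in> hom C z y" by simp
    note hg = C.comp_hom[OF g h]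
    show "g \<in> im (sieve_incl C y (image_sieve n y (psh_map B h b))) z \<longleftrightarrow>
        pa_comp (element (yoneda C x) y h) z g \<in> im (sieve_incl C x (image_sieve n x b)) z"
      using sieve_incl(3)[OF S' g] sieve_incl(3)[OF S hg] image_sieve_iff[OF n g] image_sieve_iff[OF n hg]
        presheafD(3)[OF B h g b] yoneda_map[OF g h] g by simp
  qed
qed

lemma restrictions_simps:
  assumes n: "n \<in> hom (Psh C) A B"
  shows "FO (restrictions n) (pair_code (x, b)) = sieve_incl C x (image_sieve n x b)"
    and "h \<in> hom C y x \<Longrightarrow> b \<in> psh_ob B x \<Longrightarrow> \<exists>s. FA (restrictions n) (pair_code (h, b)) =
       (sieve_incl C y (image_sieve n y (psh_map B h b)), sieve_incl C x (image_sieve n x b), s,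
         element (yoneda C x) y h) \<and>
       pullback_sq (Psh C) (sieve_incl C y (image_sieve n y (psh_map B h b)))
         (sieve_incl C x (image_sieve n x b)) s (element (yoneda C x) y h)"
proof -
  show "FO (restrictions n) (pair_code (x, b)) = sieve_incl C x (image_sieve n x b)"
    by (simp add: restrictions_def)
  assume h: "h \<in> hom C y x" and b: "b \<in> psh_ob B x"
  have d: "Dom C h = y" "Cod C h = x" "pa_cod n = B" using h n by (auto simp: hom_def Psh_Dom_Cod)
  show "\<exists>s. FA (restrictions n) (pair_code (h, b)) =
       (sieve_incl C y (image_sieve n y (psh_map B h b)), sieve_incl C x (image_sieve n x b), s,
         element (yoneda C x) y h) \<and>
       pullback_sq (Psh C) (sieve_incl C y (image_sieve n y (psh_map B h b)))
         (sieve_incl C x (image_sieve n x b)) s (element (yoneda C x) y h)"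
    using theI'[OF restrictions_pullback[OF n h b]] by (simp add: restrictions_def d Let_def)
qed

lemma cart_arrows_simps:
  "Obj (full_subcat (cart_arrows E) M) = Arr E \<inter> M"
  "Arr (full_subcat (cart_arrows E) M) =
     {(m, n, a, b). pullback_sq E m n a b \<and> m \<in> M \<and> n \<in> M}"
  "Dom (full_subcat (cart_arrows E) M) (m, n, a, b) = m"
  "Cod (full_subcat (cart_arrows E) M) (m, n, a, b) = n"
  "Ident (full_subcat (cart_arrows E) M) m = (m, m, Ident E (Dom E m), Ident E (Cod E m))"
  "(m', n', a', b') \<cdot>\<^bsub>full_subcat (cart_arrows E) M\<^esub> (m, n, a, b) = (m, n', a' \<cdot>\<^bsub>E\<^esub> a, b' \<cdot>\<^bsub>E\<^esub> b)"
  by (auto simp: full_subcat_def cart_arrows_def)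

lemma element_Ident:
  assumes x: "x \<in> Obj C"
  shows "element (yoneda C x) x (Ident C x) = Ident (Psh C) (yoneda C x)"
proof (rule Psh_ext)
  show "element (yoneda C x) x (Ident C x) \<in> hom (Psh C) (yoneda C x) (yoneda C x)"
    using element_hom[OF yoneda_presheaf x, of "Ident C x" x] C.ident_hom[OF x] x by simp
  show "Ident (Psh C) (yoneda C x) \<in> hom (Psh C) (yoneda C x) (yoneda C x)"
    using Psh_ident_hom[OF yoneda_presheaf] .
  fix z g assume z: "z \<in> Obj C" and g: "g \<in> psh_ob (yoneda C x) z"
  then have "g \<in> hom C z x" by simp
  then show "pa_comp (element (yoneda C x) x (Ident C x)) z g = pa_comp (Ident (Psh C) (yoneda C x)) z g"
    using z g yoneda_map[OF _ C.ident_hom[OF x]] C.ident_comp by simp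
qed

lemma restrictions_functor:
  assumes n: "n \<in> hom (Psh C) A B"
    and local: "\<And>x b. x \<in> Obj C \<Longrightarrow> b \<in> psh_ob B x \<Longrightarrow> sieve_incl C x (image_sieve n x b) \<in> M"
  shows "is_functor (elements B) (full_subcat (cart_arrows (Psh C)) M) (restrictions n)"
  unfolding is_functor_def
proof (intro conjI ballI impI)
  note B = Psh_homD(2)[OF n]
  fix j assume "j \<in> Obj (elements B)"
  then obtain x b where j: "j = pair_code (x, b)" and x: "x \<in> Obj C" and b: "b \<in> psh_ob B x"
    by (rule elements_ObjE)
  let ?m = "sieve_incl C x (image_sieve n x b)"
  have mM: "?m \<in> M" using local x b .
  then show "FO (restrictions n) j \<in> Obj (full_subcat (cart_arrows (Psh C)) M)"
    using M_hom[OF mM] by (simp add: j restrictions_simps(1)[OF n] cart_arrows_simps hom_def)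
  obtain D where D: "?m \<in> hom (Psh C) D (yoneda C x)"
    using sieve_incl(1)[OF image_sieve[OF n b]] by blast
  obtain s where s: "FA (restrictions n) (pair_code (Ident C x, b)) =
       (?m, ?m, s, Ident (Psh C) (yoneda C x))"
     "pullback_sq (Psh C) ?m ?m s (Ident (Psh C) (yoneda C x))"
    using restrictions_simps(2)[OF n C.ident_hom[OF x] b] presheafD(2)[OF B x b] element_Ident[OF x]
    by auto
  have D0: "D \<in> Obj (Psh C)" using E.hom_Obj[OF D] by simp
  have "s \<in> hom (Psh C) D D" "?m \<cdot>\<^bsub>Psh C\<^esub> s = ?m"
    using s(2) E.ident_comp[OF D] unfolding E.pullback_sq_iff[OF D D] by simp_all
  then have "s = Ident (Psh C) D"
    using E.monicD[OF M_monic[OF mM] D _ E.ident_hom[OF D0], of s] E.comp_ident[OF D] by simp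
  moreover have "Dom (Psh C) ?m = D" "Cod (Psh C) ?m = yoneda C x" using D by (auto simp: hom_def)
  ultimately show "FA (restrictions n) (Ident (elements B) j) =
      Ident (full_subcat (cart_arrows (Psh C)) M) (FO (restrictions n) j)"
    using s(1) by (simp add: j restrictions_simps(1)[OF n] cart_arrows_simps)
next
  note B = Psh_homD(2)[OF n]
  fix u assume "u \<in> Arr (elements B)"
  then obtain y x h b where u: "u = pair_code (h, b)" and h: "h \<in> hom C y x" and b: "b \<in> psh_ob B x"
    by (rule elements_ArrE)
  have o: "x \<in> Obj C" "y \<in> Obj C" and d: "Dom C h = y" "Cod C h = x"
    using C.hom_Obj[OF h] h by (auto simp: hom_def)
  note hb = presheafD(1)[OF B h b]
  let ?m = "sieve_incl C x (image_sieve n x b)"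
  let ?m' = "sieve_incl C y (image_sieve n y (psh_map B h b))"
  obtain s where s: "FA (restrictions n) u = (?m', ?m, s, element (yoneda C x) y h)"
     "pullback_sq (Psh C) ?m' ?m s (element (yoneda C x) y h)"
    using restrictions_simps(2)[OF n h b] u by blast
  show "FA (restrictions n) u \<in> hom (full_subcat (cart_arrows (Psh C)) M)
      (FO (restrictions n) (Dom (elements B) u)) (FO (restrictions n) (Cod (elements B) u))"
    using s local[OF o(1) b] local[OF o(2) hb]
    by (simp add: hom_def[of "full_subcat _ _"] cart_arrows_simps u restrictions_simps(1)[OF n] d)
  fix v assume "v \<in> Arr (elements B)" and vu: "Dom (elements B) v = Cod (elements B) u"
  then obtain y' x' k c where v: "v = pair_code (k, c)" and k': "k \<in> hom C y' x'" and c: "c \<in> psh_ob B x'"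
    by (elim elements_ArrE)
  have k: "k \<in> hom C x x'" and kc: "psh_map B k c = b" using vu u v k' d by (auto simp: hom_def)
  have x': "x' \<in> Obj C" using C.hom_Obj[OF k] by simp
  let ?m'' = "sieve_incl C x' (image_sieve n x' c)"
  obtain r where r: "FA (restrictions n) v = (?m, ?m'', r, element (yoneda C x') x k)"
     "pullback_sq (Psh C) ?m ?m'' r (element (yoneda C x') x k)"
    using restrictions_simps(2)[OF n k c] v kc by blast
  have khc: "psh_map B (k \<cdot>\<^bsub>C\<^esub> h) c = psh_map B h b" using presheafD(3)[OF B k h c] kc by simp
  obtain q where q: "FA (restrictions n) (pair_code (k \<cdot>\<^bsub>C\<^esub> h, c)) =
       (?m', ?m'', q, element (yoneda C x') y (k \<cdot>\<^bsub>C\<^esub> h))"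
     "pullback_sq (Psh C) ?m' ?m'' q (element (yoneda C x') y (k \<cdot>\<^bsub>C\<^esub> h))"
    using restrictions_simps(2)[OF n C.comp_hom[OF h k] c] khc by auto
  have kh: "element (yoneda C x') x k \<in> hom (Psh C) (yoneda C x) (yoneda C x')"
    using element_hom[OF yoneda_presheaf o(1)] k o by simp
  have hk: "h \<in> psh_ob (yoneda C x) y" using h o by simp
  have comp: "element (yoneda C x') x k \<cdot>\<^bsub>Psh C\<^esub> element (yoneda C x) y h = element (yoneda C x') y (k \<cdot>\<^bsub>C\<^esub> h)"
    using comp_element[OF kh o(2) hk] h yoneda_map[OF h k] by simp
  have "pullback_sq (Psh C) ?m' ?m'' (r \<cdot>\<^bsub>Psh C\<^esub> s) (element (yoneda C x') y (k \<cdot>\<^bsub>C\<^esub> h))"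
    using E.pullback_paste[OF s(2) r(2)] comp by simp
  \<comment> \<open>Functoriality holds because the top side of a pullback square between monomorphisms is unique.\<close>
  then have "q = r \<cdot>\<^bsub>Psh C\<^esub> s"
    using q(2) restrictions_pullback[OF n C.comp_hom[OF h k] c] khc by auto
  then show "FA (restrictions n) (v \<cdot>\<^bsub>elements B\<^esub> u) =
      FA (restrictions n) v \<cdot>\<^bsub>full_subcat (cart_arrows (Psh C)) M\<^esub> FA (restrictions n) u"
    using q(1) r(1) s(1) comp by (simp add: u v cart_arrows_simps)
qed

text \<open>The pullbacks of \<open>n\<close> along the elements \<open>b\<close> of \<open>B\<close> form a diagram in \<open>M\<close>, whose colimit \<open>c\<close> comes
  with a compatible family of pullback squares from them to \<open>c\<close>. The bottom sides
  \<open>\<beta> x b : y(x) \<rightarrow> B'\<close> glue to one morphism \<open>g : B \<rightarrow> B'\<close>, because \<open>B\<close> is the colimit of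
  its elements, and \<open>g\<close> exhibits \<open>n\<close> as a pullback of \<open>c\<close>: membership of \<open>b\<close> in \<open>n\<close> is tested by
  the identity in the sieve at \<open>b\<close>.\<close>

lemma M_local:
  assumes n: "n \<in> hom (Psh C) A B" "monic (Psh C) n"
    and local: "\<And>x b. x \<in> Obj C \<Longrightarrow> b \<in> psh_ob B x \<Longrightarrow> sieve_incl C x (image_sieve n x b) \<in> M"
  shows "n \<in> M"
proof -
  note B = Psh_homD(2)[OF n(1)]
  let ?S = "full_subcat (cart_arrows (Psh C)) M"
  obtain c \<kappa> where "is_colimit (elements B) ?S (restrictions n) c \<kappa>"
    using M_colimits elements_small_category[OF B] restrictions_functor[OF n(1) local]
    unfolding has_small_colimits_def by blast
  then have cM: "c \<in> M" and \<kappa>: "\<And>j. j \<in> Obj (elements B) \<Longrightarrow> \<kappa> j \<in> hom ?S (FO (restrictions n) j) c"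
    and nat: "\<And>u. u \<in> Arr (elements B) \<Longrightarrow>
      \<kappa> (Cod (elements B) u) \<cdot>\<^bsub>?S\<^esub> FA (restrictions n) u = \<kappa> (Dom (elements B) u)"
    unfolding is_colimit_def cocone_def by (auto simp: cart_arrows_simps)
  define A' where "A' = pa_dom c"
  define B' where "B' = pa_cod c"
  have c: "c \<in> hom (Psh C) A' B'" using M_hom[OF cM] by (simp add: A'_def B'_def)
  note B' = Psh_homD(2)[OF c]
  define \<beta> where "\<beta> x b = (case \<kappa> (pair_code (x, b)) of (_, _, _, g) \<Rightarrow> g)" for x b
  have \<beta>: "\<exists>s. \<kappa> (pair_code (x, b)) = (sieve_incl C x (image_sieve n x b), c, s, \<beta> x b) \<and>
      pullback_sq (Psh C) (sieve_incl C x (image_sieve n x b)) c s (\<beta> x b)"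
    if "x \<in> Obj C" "b \<in> psh_ob B x" for x b
    using \<kappa>[OF elements_ObjI[of x b B]] that
    by (auto simp: hom_def[of ?S] cart_arrows_simps \<beta>_def restrictions_simps(1)[OF n(1)])
  have inc: "\<exists>D. sieve_incl C x (image_sieve n x b) \<in> hom (Psh C) D (yoneda C x)"
    if "b \<in> psh_ob B x" for x b
    using sieve_incl(1)[OF image_sieve[OF n(1) that]] .
  have \<beta>_hom: "\<beta> x b \<in> hom (Psh C) (yoneda C x) B'" if xb: "x \<in> Obj C" "b \<in> psh_ob B x" for x b
  proof -
    obtain D where D: "sieve_incl C x (image_sieve n x b) \<in> hom (Psh C) D (yoneda C x)"
      using inc[OF xb(2)] by blast
    show ?thesis using \<beta>[OF xb] unfolding E.pullback_sq_iff[OF D c] by blast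
  qed
  define g where "g = nt C B B' (\<lambda>x b. pa_comp (\<beta> x b) x (Ident C x))"
  have idy: "Ident C x \<in> psh_ob (yoneda C x) x" if "x \<in> Obj C" for x
    using that C.ident_hom by simp
  have g: "g \<in> hom (Psh C) B B'"
    unfolding g_def
  proof (rule nt_hom[OF B B'])
    fix x b assume x: "x \<in> Obj C" "b \<in> psh_ob B x"
    show "pa_comp (\<beta> x b) x (Ident C x) \<in> psh_ob B' x"
      using Psh_homD(3)[OF \<beta>_hom[OF x] x(1) idy[OF x(1)]] .
  next
    fix h y x b assume h: "h \<in> hom C y x" and b: "b \<in> psh_ob B x"
    have o: "x \<in> Obj C" "y \<in> Obj C" "Dom C h = y" "Cod C h = x"
      using C.hom_Obj[OF h] h by (auto simp: hom_def)
    note hb = presheafD(1)[OF B h b]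
    have u: "pair_code (h, b) \<in> Arr (elements B)" using elements_homI[where B = B, OF h b] by (simp add: hom_def)
    have hy: "h \<in> psh_ob (yoneda C x) y" using h o by simp
    have "\<beta> x b \<cdot>\<^bsub>Psh C\<^esub> element (yoneda C x) y h = \<beta> y (psh_map B h b)"
      using nat[OF u] \<beta>[OF o(1) b] \<beta>[OF o(2) hb] restrictions_simps(2)[OF n(1) h b] o
      by (auto simp: cart_arrows_simps)
    then have "pa_comp (\<beta> y (psh_map B h b)) y (Ident C y) = pa_comp (\<beta> x b) y h"
      using Psh_comp[OF element_hom[OF yoneda_presheaf o(2) hy] o(2) idy[OF o(2)], of "\<beta> x b"]
        element_ident[OF yoneda_presheaf o(2) hy] by simp
    then show "pa_comp (\<beta> y (psh_map B h b)) y (Ident C y) = psh_map B' h (pa_comp (\<beta> x b) x (Ident C x))"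
      using element_of_ident[OF \<beta>_hom[OF o(1) b] h] by simp
  qed
  have "\<exists>!s. pullback_sq (Psh C) n c s g"
  proof (rule pullback_of_monic[OF n c M_monic[OF cM] g])
    fix x b assume x: "x \<in> Obj C" and b: "b \<in> psh_ob B x"
    obtain D where D: "sieve_incl C x (image_sieve n x b) \<in> hom (Psh C) D (yoneda C x)"
      using inc[OF b] by blast
    obtain s where s: "pullback_sq (Psh C) (sieve_incl C x (image_sieve n x b)) c s (\<beta> x b)"
      using \<beta>[OF x b] by blast
    have "pa_comp g x b = pa_comp (\<beta> x b) x (Ident C x)" using x b by (simp add: g_def)
    then show "b \<in> im n x \<longleftrightarrow> pa_comp g x b \<in> im c x"
      using pullback_im[OF D c s x idy[OF x]] sieve_incl(3)[OF image_sieve[OF n(1) b] C.ident_hom[OF x]]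
        image_sieve_iff[OF n(1) C.ident_hom[OF x]] presheafD(2)[OF B x b] by simp
  qed
  then show ?thesis using M_pullback[OF cM] by blast
qed

section \<open>The classifier of the class\<close>

lemma K_sub: "k \<in> K_sub C M x \<longleftrightarrow> (\<exists>S\<in>sieves C x. sieve_incl C x S \<in> M \<and> k = sieve_code C S)"
  by (auto simp: K_sub_def)

lemma sieve_pullback_in_M:
  assumes S: "S \<in> sieves C x" "sieve_incl C x S \<in> M" and f: "f \<in> hom C y x"
  shows "sieve_incl C y (sieve_pullback C f S) \<in> M"
proof -
  obtain A where A: "sieve_incl C x S \<in> hom (Psh C) A (yoneda C x)" using sieve_incl(1)[OF S(1)] by blast
  have y: "y \<in> Obj C" using C.hom_Obj[OF f] by simp
  show ?thesis unfolding sieve_pullback_eq[OF S(1) f]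
    by (rule image_sieve_in_M[OF A S(2) y]) (use f y in simp)
qed

lemma K_presheaf: "presheaf C (K_psh C M)"
  unfolding K_psh_def
proof (rule sub_psh_presheaf[OF Omega_presheaf])
  fix x assume "x \<in> Obj C" then show "K_sub C M x \<subseteq> psh_ob (Omega C) x"
    by (auto simp: K_sub_def Omega_def)
next
  fix h y x k assume h: "h \<in> hom C y x" and "k \<in> K_sub C M x"
  then obtain S where S: "S \<in> sieves C x" "sieve_incl C x S \<in> M" "k = sieve_code C S"
    using K_sub by blast
  then show "psh_map (Omega C) h k \<in> K_sub C M y"
    using K_sub sieve_pullback_in_M[OF S(1,2) h] sieve_pullback_sieve[OF S(1) h] Omega_map[OF S(1) h]
    by auto
qed

lemma K_ob: "x \<in> Obj C \<Longrightarrow> psh_ob (K_psh C M) x = K_sub C M x"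
  by (simp add: K_psh_def)

lemma K_map:
  assumes "S \<in> sieves C x" "sieve_incl C x S \<in> M" "h \<in> hom C y x"
  shows "psh_map (K_psh C M) h (sieve_code C S) = sieve_code C (sieve_pullback C h S)"
  using assms Omega_map sub_psh_map[OF assms(3)] K_sub unfolding K_psh_def by metis

lemma top_sieve_in_M:
  assumes x: "x \<in> Obj C"
  shows "sieve_incl C x (top_sieve x) \<in> M"
proof -
  obtain D where D: "sieve_incl C x (top_sieve x) \<in> hom (Psh C) D (yoneda C x)"
    using sieve_incl(1)[OF top_sieve] by blast
  note i = Psh_ident_hom[OF yoneda_presheaf] and iM = M_identities[OF yoneda_presheaf]
  have "\<exists>!s. pullback_sq (Psh C) (sieve_incl C x (top_sieve x)) (Ident (Psh C) (yoneda C x)) s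
      (Ident (Psh C) (yoneda C x))"
  proof (rule pullback_of_monic[OF D sieve_incl(2)[OF top_sieve] i M_monic[OF iM] i])
    fix z g assume z: "z \<in> Obj C" and g: "g \<in> psh_ob (yoneda C x) z"
    then have "g \<in> hom C z x" by simp
    then show "g \<in> im (sieve_incl C x (top_sieve x)) z \<longleftrightarrow>
        pa_comp (Ident (Psh C) (yoneda C x)) z g \<in> im (Ident (Psh C) (yoneda C x)) z"
      using sieve_incl(3)[OF top_sieve, of g z x] im_iff[OF i, of g] z g Psh_ident[OF z g]
      by (auto simp: top_sieve_def hom_def)
  qed
  then show ?thesis using M_pullback[OF iM] by blast
qed

lemma t_map_eq: "t_map C M Y = nt C Y (prod_psh C (K_psh C M) Y) (\<lambda>x y. pair_code (sieve_code C (top_sieve x), y))"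
proof -
  have "psh_ob (terminal_psh C) x = {undefined}" if "x \<in> Obj C" for x
    using that by (simp add: terminal_psh_def)
  then show ?thesis
    unfolding t_map_def tuple_psh_def nt_def Psh_def K_top_def bang_def
    by (auto simp: top_sieve_def intro!: restrict_ext ext)
qed

context
  fixes Y :: "'v psh"
  assumes Y: "presheaf C Y"
begin

abbreviation "KY \<equiv> prod_psh C (K_psh C M) Y"

lemma KY_ob: "x \<in> Obj C \<Longrightarrow> p \<in> psh_ob KY x \<longleftrightarrow>
    (\<exists>S y. S \<in> sieves C x \<and> sieve_incl C x S \<in> M \<and> y \<in> psh_ob Y x \<and> p = pair_code (sieve_code C S, y))"
  by (auto simp: prod_psh_ob K_ob K_sub image_iff)

lemma KY_map:
  assumes "S \<in> sieves C x" "sieve_incl C x S \<in> M" "h \<in> hom C z x" "y \<in> psh_ob Y x"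
  shows "psh_map KY h (pair_code (sieve_code C S, y)) =
    pair_code (sieve_code C (sieve_pullback C h S), psh_map Y h y)"
proof -
  have "sieve_code C S \<in> psh_ob (K_psh C M) x"
    using assms K_ob K_sub C.hom_Obj[OF assms(3)] by auto
  then show ?thesis using prod_psh_map[OF assms(3) _ assms(4)] K_map[OF assms(1,2,3)] by simp
qed

lemma KY_presheaf: "presheaf C KY"
  using prod_psh_presheaf[OF K_presheaf Y] .

lemma t_map_hom: "t_map C M Y \<in> hom (Psh C) Y KY"
  unfolding t_map_eq
proof (rule nt_hom[OF Y KY_presheaf])
  fix x y assume "x \<in> Obj C" "y \<in> psh_ob Y x"
  then show "pair_code (sieve_code C (top_sieve x), y) \<in> psh_ob KY x"
    using KY_ob top_sieve top_sieve_in_M by blast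
next
  fix h z x y assume h: "h \<in> hom C z x" and y: "y \<in> psh_ob Y x"
  have x: "x \<in> Obj C" using C.hom_Obj[OF h] by simp
  have "h \<in> top_sieve x" using h by (auto simp: top_sieve_def hom_def)
  then show "pair_code (sieve_code C (top_sieve z), psh_map Y h y) =
      psh_map KY h (pair_code (sieve_code C (top_sieve x), y))"
    using KY_map[OF top_sieve top_sieve_in_M[OF x] h y] sieve_pullback_top_iff[OF top_sieve h] by simp
qed

lemma t_map_monic: "monic (Psh C) (t_map C M Y)"
  unfolding monic_iff_inj[OF t_map_hom] by (auto simp: t_map_eq intro!: inj_onI)

lemma im_t_map:
  assumes x: "x \<in> Obj C" and y: "y \<in> psh_ob Y x" and S: "S \<in> sieves C x"
  shows "pair_code (sieve_code C S, y) \<in> im (t_map C M Y) x \<longleftrightarrow> S = top_sieve x"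
  unfolding im_iff[OF t_map_hom] using x y sieve_code_eq[OF S top_sieve] by (auto simp: t_map_eq)

text \<open>The pullback of \<open>t\<close> along an element \<open>(S, y)\<close> of \<open>K \<times> Y\<close> is the sieve \<open>S\<close>, which is in \<open>M\<close> by the
  definition of \<open>K\<close>. Locality therefore puts \<open>t\<close> into \<open>M\<close>.\<close>

lemma image_sieve_t_map:
  assumes x: "x \<in> Obj C" and y: "y \<in> psh_ob Y x" and S: "S \<in> sieves C x" "sieve_incl C x S \<in> M"
  shows "image_sieve (t_map C M Y) x (pair_code (sieve_code C S, y)) = S"
proof -
  have "h \<in> image_sieve (t_map C M Y) x (pair_code (sieve_code C S, y)) \<longleftrightarrow> h \<in> S"
    if h: "h \<in> hom C (Dom C h) x" for h
    using image_sieve_iff[OF t_map_hom h] KY_map[OF S h y] C.hom_Obj[OF h]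
      im_t_map[OF _ presheafD(1)[OF Y h y] sieve_pullback_sieve[OF S(1) h]]
      sieve_pullback_top_iff[OF S(1) h] by simp
  then show ?thesis using sievesD(1)[OF S(1)] image_sieve_hom by blast
qed

lemma t_map_in_M: "t_map C M Y \<in> M"
proof (rule M_local[OF t_map_hom t_map_monic])
  fix x p assume x: "x \<in> Obj C" and "p \<in> psh_ob KY x"
  then obtain S y where "S \<in> sieves C x" "sieve_incl C x S \<in> M" "y \<in> psh_ob Y x"
    "p = pair_code (sieve_code C S, y)" using KY_ob by blast
  then show "sieve_incl C x (image_sieve (t_map C M Y) x p) \<in> M" using image_sieve_t_map[OF x] by simp
qed

lemma pi_map:
  "pi_map C M Y \<in> hom (Psh C) KY Y"
  "x \<in> Obj C \<Longrightarrow> S \<in> sieves C x \<Longrightarrow> sieve_incl C x S \<in> M \<Longrightarrow> y \<in> psh_ob Y x \<Longrightarrow>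
     pa_comp (pi_map C M Y) x (pair_code (sieve_code C S, y)) = y"
  unfolding pi_map_def using snd_psh[OF K_presheaf Y] K_ob K_sub by auto

lemma pi_t: "pi_map C M Y \<cdot>\<^bsub>Psh C\<^esub> t_map C M Y = Ident (Psh C) Y"
proof (rule Psh_ext[OF Psh_comp_hom[OF t_map_hom pi_map(1)] Psh_ident_hom[OF Y]])
  fix x y assume xy: "x \<in> Obj C" "y \<in> psh_ob Y x"
  then show "pa_comp (pi_map C M Y \<cdot>\<^bsub>Psh C\<^esub> t_map C M Y) x y = pa_comp (Ident (Psh C) Y) x y"
    using pi_map(2)[OF xy(1) top_sieve top_sieve_in_M[OF xy(1)] xy(2)]
    by (simp add: Psh_comp[OF t_map_hom]) (simp add: t_map_eq)
qed

text \<open>The classifying map \<open>g\<close> has as first component the sieve of restrictions that lie in \<open>m\<close>. The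
  second component is prescribed by \<open>b\<close>, and it forces the top side of the pullback square to be
  \<open>b \<cdot> m\<close>, since \<open>\<pi> \<cdot> t\<close> is the identity.\<close>

lemma M_classified:
  assumes m: "m \<in> hom (Psh C) A B" "m \<in> M" and b: "b \<in> hom (Psh C) B Y"
  shows "\<exists>!g. g \<in> hom (Psh C) B KY \<and> pi_map C M Y \<cdot>\<^bsub>Psh C\<^esub> g = b \<and>
    pullback_sq (Psh C) m (t_map C M Y) (b \<cdot>\<^bsub>Psh C\<^esub> m) g"
proof -
  note B = Psh_homD(2)[OF m(1)]
  define g where "g = nt C B KY (\<lambda>x a. pair_code (sieve_code C (image_sieve m x a), pa_comp b x a))"
  have imM: "image_sieve m x a \<in> sieves C x" "sieve_incl C x (image_sieve m x a) \<in> M"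
    if "x \<in> Obj C" "a \<in> psh_ob B x" for x a
    using image_sieve[OF m(1) that(2)] image_sieve_in_M[OF m that] by auto
  have g: "g \<in> hom (Psh C) B KY"
    unfolding g_def
  proof (rule nt_hom[OF B KY_presheaf])
    fix x a assume x: "x \<in> Obj C" "a \<in> psh_ob B x"
    show "pair_code (sieve_code C (image_sieve m x a), pa_comp b x a) \<in> psh_ob KY x"
      using KY_ob[OF x(1)] imM[OF x] Psh_homD(3)[OF b x] by blast
  next
    fix h y x a assume h: "h \<in> hom C y x" and a: "a \<in> psh_ob B x"
    have o: "x \<in> Obj C" "y \<in> Obj C" using C.hom_Obj[OF h] by auto
    have "k \<in> image_sieve m y (psh_map B h a) \<longleftrightarrow> k \<in> sieve_pullback C h (image_sieve m x a)" for k
    proof (cases "k \<in> hom C (Dom C k) y")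
      case True
      then show ?thesis
        using image_sieve_iff[OF m(1) True] image_sieve_iff[OF m(1) C.comp_hom[OF True h]]
          presheafD(3)[OF B h True a] h by (auto simp: sieve_pullback_def hom_def)
    next
      case False
      then show ?thesis using image_sieve_hom h by (auto simp: sieve_pullback_def hom_def)
    qed
    then have "image_sieve m y (psh_map B h a) = sieve_pullback C h (image_sieve m x a)" by blast
    then show "pair_code (sieve_code C (image_sieve m y (psh_map B h a)), pa_comp b y (psh_map B h a)) =
        psh_map KY h (pair_code (sieve_code C (image_sieve m x a), pa_comp b x a))"
      using KY_map[OF imM[OF o(1) a] h Psh_homD(3)[OF b o(1) a]] Psh_homD(4)[OF b h a] by simp
  qed
  have top_iff: "S = top_sieve x \<longleftrightarrow> Ident C x \<in> S" if "S \<in> sieves C x" "x \<in> Obj C" for S x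
    using sieve_pullback_top_iff[OF that(1) C.ident_hom[OF that(2)]] sieve_pullback_ident[OF that] by simp
  have pig: "pi_map C M Y \<cdot>\<^bsub>Psh C\<^esub> g = b"
  proof (rule Psh_ext[OF Psh_comp_hom[OF g pi_map(1)] b])
    fix x a assume x: "x \<in> Obj C" "a \<in> psh_ob B x"
    then show "pa_comp (pi_map C M Y \<cdot>\<^bsub>Psh C\<^esub> g) x a = pa_comp b x a"
      using pi_map(2)[OF x(1) imM[OF x] Psh_homD(3)[OF b x]] by (simp add: Psh_comp[OF g]) (simp add: g_def)
  qed
  have "\<exists>!s. pullback_sq (Psh C) m (t_map C M Y) s g"
  proof (rule pullback_of_monic[OF m(1) M_monic[OF m(2)] t_map_hom t_map_monic g])
    fix x a assume x: "x \<in> Obj C" "a \<in> psh_ob B x"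
    show "a \<in> im m x \<longleftrightarrow> pa_comp g x a \<in> im (t_map C M Y) x"
      using im_t_map[OF x(1) Psh_homD(3)[OF b x] imM(1)[OF x]] top_iff[OF imM(1)[OF x] x(1)]
        image_sieve_iff[OF m(1) C.ident_hom[OF x(1)]] presheafD(2)[OF B x] x by (simp add: g_def)
  qed
  then obtain s where s: "pullback_sq (Psh C) m (t_map C M Y) s g" by blast
  have sh: "s \<in> hom (Psh C) A Y" and "t_map C M Y \<cdot>\<^bsub>Psh C\<^esub> s = g \<cdot>\<^bsub>Psh C\<^esub> m"
    using s unfolding E.pullback_sq_iff[OF m(1) t_map_hom] by auto
  then have "s = b \<cdot>\<^bsub>Psh C\<^esub> m"
    using E.comp_assoc[OF sh t_map_hom pi_map(1)] E.comp_assoc[OF m(1) g pi_map(1)] pig pi_t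
      E.ident_comp[OF sh] by simp
  \<comment> \<open>For uniqueness, the sieve that any such \<open>g'\<close> assigns to \<open>a\<close> is found by restricting \<open>a\<close> along
    its members and testing membership in \<open>t\<close>.\<close>
  moreover have "g' = g" if g': "g' \<in> hom (Psh C) B KY" and pg': "pi_map C M Y \<cdot>\<^bsub>Psh C\<^esub> g' = b"
    and pb: "pullback_sq (Psh C) m (t_map C M Y) s' g'" for g' s'
  proof (rule Psh_ext[OF g' g])
    fix x a assume x: "x \<in> Obj C" and a: "a \<in> psh_ob B x"
    obtain S y where S: "S \<in> sieves C x" "sieve_incl C x S \<in> M" and y: "y \<in> psh_ob Y x"
      and e: "pa_comp g' x a = pair_code (sieve_code C S, y)"
      using Psh_homD(3)[OF g' x a] KY_ob[OF x] by blast
    have yb: "y = pa_comp b x a"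
      using Psh_comp[OF g' x a, of "pi_map C M Y"] pg' pi_map(2)[OF x S y] e by simp
    have "h \<in> S \<longleftrightarrow> h \<in> image_sieve m x a" if h: "h \<in> hom C (Dom C h) x" for h
    proof -
      have z: "Dom C h \<in> Obj C" using C.hom_Obj[OF h] by simp
      note ha = presheafD(1)[OF B h a]
      have "h \<in> S \<longleftrightarrow> pa_comp g' (Dom C h) (psh_map B h a) \<in> im (t_map C M Y) (Dom C h)"
        using Psh_homD(4)[OF g' h a] e KY_map[OF S h y] sieve_pullback_top_iff[OF S(1) h]
          im_t_map[OF z presheafD(1)[OF Y h y] sieve_pullback_sieve[OF S(1) h]] by simp
      also have "\<dots> \<longleftrightarrow> psh_map B h a \<in> im m (Dom C h)"
        using pullback_im[OF m(1) t_map_hom pb z ha] by simp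
      finally show ?thesis using image_sieve_iff[OF m(1) h] by simp
    qed
    then have "S = image_sieve m x a" using sievesD(1)[OF S(1)] image_sieve_hom by blast
    then show "pa_comp g' x a = pa_comp g x a" using e yb x a by (simp add: g_def)
  qed
  ultimately show ?thesis using g pig s by blast
qed

end

end

section \<open>Identities are in the class\<close>

lemma left_adjoint_initial:
  assumes C: "category C" and D: "category D" and adj: "adjunction C D F G \<eta> \<epsilon>"
    and z: "is_initial C z"
  shows "is_initial D (FO F z)"
  unfolding is_initial_def
proof (intro conjI ballI)
  have F: "is_functor C D F" and G: "is_functor D C G" using adj by (auto simp: adjunction_def)
  have zO: "z \<in> Obj C" using z by (simp add: is_initial_def)
  show FzO: "FO F z \<in> Obj D" using F zO by (simp add: is_functor_def)
  interpret D: cat D by (rule cat.intro) (rule D)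
  fix y assume y: "y \<in> Obj D"
  have Gy: "FO G y \<in> Obj C" using G y by (simp add: is_functor_def)
  have eps: "\<epsilon> y \<in> hom D (FO F (FO G y)) y"
    using adj y by (auto simp: adjunction_def nat_transf_def comp_funct_def id_funct_def)
  obtain h where h: "h \<in> hom C z (FO G y)" and hu: "\<And>h'. h' \<in> hom C z (FO G y) \<Longrightarrow> h' = h"
    using z Gy unfolding is_initial_def by blast
  have Fh: "FA F h \<in> hom D (FO F z) (FO F (FO G y))"
    using F h by (auto simp: is_functor_def hom_def)
  have "s = \<epsilon> y \<cdot>\<^bsub>D\<^esub> FA F h" if "s \<in> hom D (FO F z) y" for s
    using adjunction_transpose[OF C D adj zO y that] hu by metis
  then show "\<exists>!s. s \<in> hom D (FO F z) y" using D.comp_hom[OF Fh eps] by blast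
qed

text \<open>If \<open>I \<otimes> z\<close> is initial, then the pushout of \<open>\<delta> z\<close> along \<open>z \<rightarrow> X\<close> is \<open>X\<close> itself, and the Leibniz
  product reduces to the endpoint inclusion at \<open>X\<close>.\<close>

lemma (in cat) initial_leibniz_product:
  assumes z: "is_initial E z" and Iz: "is_initial E (FO I z)"
    and I: "is_functor E E I" and d: "nat_transf E E id_funct I d" and h: "h \<in> hom E z X"
  shows "leibniz_product E I d h (d X)"
proof -
  have X: "X \<in> Obj E" "z \<in> Obj E" using hom_Obj[OF h] by auto
  have dh: "d x \<in> hom E x (FO I x)" if "x \<in> Obj E" for x
    using d that by (simp add: nat_transf_def id_funct_def)
  have uniq: "u = v" if "u \<in> hom E z x" "v \<in> hom E z x" for u v x
    using z that hom_Obj[OF that(1)] unfolding is_initial_def by blast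
  have uniqI: "u = v" if "u \<in> hom E (FO I z) x" "v \<in> hom E (FO I z) x" for u v x
    using Iz that hom_Obj[OF that(1)] unfolding is_initial_def by blast
  obtain u where u: "u \<in> hom E (FO I z) X" using Iz X unfolding is_initial_def by blast
  note iX = ident_hom[OF X(1)]
  have Dh: "Dom E h = z" "Cod E h = X" and Du: "Dom E u = FO I z" "Cod E u = X"
    using h u by (auto simp: hom_def)
  have "pushout_sq E h u (d z) (Ident E X)"
    unfolding pushout_sq_def comm_sq_iff[OF h u] Dh Du
  proof (intro conjI allI ballI impI)
    show "d z \<in> hom E z (FO I z)" using dh X by simp
    show "Ident E X \<in> hom E X X" by (rule iX)
    show "u \<cdot> d z = Ident E X \<cdot> h"
      by (rule uniq) (use comp_hom[OF dh[OF X(2)] u] comp_hom[OF h iX] in auto)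
    fix w p q assume p: "p \<in> hom E (FO I z) w" and q: "q \<in> hom E X w"
    have "q \<cdot> u = p" by (rule uniqI[OF comp_hom[OF u q] p])
    then show "\<exists>!v. v \<in> hom E X w \<and> v \<cdot> u = p \<and> v \<cdot> Ident E X = q"
      using q by (metis comp_ident)
  qed
  moreover have "d X \<cdot> u = FA I h"
  proof (rule uniqI[OF comp_hom[OF u dh[OF X(1)]]])
    show "FA I h \<in> hom E (FO I z) (FO I X)" using I h by (auto simp: is_functor_def hom_def)
  qed
  moreover have "d X \<cdot> Ident E X = d X" using comp_ident dh X by blast
  ultimately show ?thesis
    unfolding leibniz_product_def Dh using dh[OF X(1)] Du by metis
qed

lemma (in presheaves) initial_presheaf: "\<exists>z. is_initial (Psh C) z"
proof -
  define z :: "'v psh" where "z = sub_psh C (terminal_psh C) (\<lambda>x. {})"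
  have "\<not> |UNIV :: 'v set| \<le>o |{} :: 'v set|" using card_of_empty3 by blast
  then have "small ({} :: 'v set)"
    unfolding small_def using ordLess_or_ordLeq[OF card_of_Well_order card_of_Well_order] by blast
  then have z: "presheaf C z"
    by (intro presheafI) (auto simp: z_def sub_psh_def dest: C.hom_Obj C.arr_hom)
  have e: "psh_ob z x = {}" if "x \<in> Obj C" for x using that by (simp add: z_def sub_psh_def)
  have "is_initial (Psh C) z"
    unfolding is_initial_def
  proof (intro conjI ballI)
    fix X assume "X \<in> Obj (Psh C)"
    then have X: "presheaf C X" by simp
    have "nt C z X (\<lambda>x a. a) \<in> hom (Psh C) z X"
      by (rule nt_hom[OF z X]) (use e C.hom_Obj in blast)+
    moreover have "u = v" if "u \<in> hom (Psh C) z X" "v \<in> hom (Psh C) z X" for u v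
      using Psh_ext[OF that] e by blast
    ultimately show "\<exists>!h. h \<in> hom (Psh C) z X" by blast
  qed (use z in simp)
  then show ?thesis by blast
qed

text \<open>The endpoint inclusion at \<open>X\<close> is the Leibniz product with \<open>0 \<rightarrow> X\<close>, because a left adjoint
  preserves initial objects. It is therefore a monomorphism in the class with domain \<open>X\<close>, and
  its pullback along itself is the identity of \<open>X\<close>.\<close>

lemma (in presheaves) admissible_monic_class:
  assumes cyl: "functorial_cylinder (Psh C) I \<delta>" and adj: "has_right_adjoint (Psh C) (Psh C) I"
    and adm: "admissible TYPE('v) (Psh C) I \<delta> M"
  shows "monic_class C M"
proof unfold_locales
  have M: "M \<subseteq> Arr (Psh C)" "\<And>m. m \<in> M \<Longrightarrow> monic (Psh C) m"
    "\<And>z x h. is_initial (Psh C) z \<Longrightarrow> h \<in> hom (Psh C) z x \<Longrightarrow> h \<in> M"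
    "\<And>m n s t. n \<in> M \<Longrightarrow> pullback_sq (Psh C) m n s t \<Longrightarrow> m \<in> M"
    "\<And>i l. i \<in> M \<Longrightarrow> leibniz_product (Psh C) I (\<delta> 0) i l \<Longrightarrow> l \<in> M"
    "has_small_colimits TYPE('v) (full_subcat (cart_arrows (Psh C)) M)"
    using adm unfolding admissible_def by blast+
  show "m \<in> M \<Longrightarrow> monic (Psh C) m" for m by (rule M)
  show "n \<in> M \<Longrightarrow> pullback_sq (Psh C) m n s g \<Longrightarrow> m \<in> M" for m n s g by (rule M)
  show "has_small_colimits TYPE('v) (full_subcat (cart_arrows (Psh C)) M)" by (rule M)
  fix X assume X: "presheaf C X"
  obtain z where z: "is_initial (Psh C) z" using initial_presheaf by blast
  have "X \<in> Obj (Psh C)" using X by simp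
  then have "\<exists>!h. h \<in> hom (Psh C) z X" using z unfolding is_initial_def by blast
  then obtain h where h: "h \<in> hom (Psh C) z X" by (elim ex1E)
  have I: "is_functor (Psh C) (Psh C) I" "nat_transf (Psh C) (Psh C) id_funct I (\<delta> 0)"
    using cyl unfolding functorial_cylinder_def by auto
  have "is_initial (Psh C) (FO I z)"
    using adj left_adjoint_initial[OF Psh_category Psh_category _ z] unfolding has_right_adjoint_def by blast
  from E.initial_leibniz_product[OF z this I h]
  have dM: "\<delta> 0 X \<in> M" using M(3)[OF z h] M(5) by blast
  have d: "\<delta> 0 X \<in> hom (Psh C) X (FO I X)"
    using I(2) X by (auto simp: nat_transf_def id_funct_def)
  note i = Psh_ident_hom[OF X]
  have "pullback_sq (Psh C) (Ident (Psh C) X) (\<delta> 0 X) (Ident (Psh C) X) (\<delta> 0 X)"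
    unfolding E.pullback_sq_iff[OF i d]
  proof (intro conjI allI ballI impI)
    fix w u v assume u: "u \<in> hom (Psh C) w X" and v: "v \<in> hom (Psh C) w X"
      and "\<delta> 0 X \<cdot>\<^bsub>Psh C\<^esub> u = \<delta> 0 X \<cdot>\<^bsub>Psh C\<^esub> v"
    then have "u = v" using E.monicD[OF M(2)[OF dM] d] by simp
    then show "\<exists>!a. a \<in> hom (Psh C) w X \<and> Ident (Psh C) X \<cdot>\<^bsub>Psh C\<^esub> a = u \<and> Ident (Psh C) X \<cdot>\<^bsub>Psh C\<^esub> a = v"
      using E.ident_comp u by metis
  qed (use i d in auto)
  then show "Ident (Psh C) X \<in> M" using M(4) dM by blast
qed

section \<open>Uniform fillers from a generic filler\<close>

text \<open>A representability argument: \<open>\<eta>\<close> is terminal among the elements of \<open>M\<close> equipped with a square to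
  \<open>f\<close>, with pullback squares as arrows between them, so that a uniform choice of fillers is
  determined by its value at \<open>\<eta>\<close>, and that value is arbitrary.\<close>

lemma (in cat) generic_filler_bij:
  assumes M: "M \<subseteq> Arr E" and f: "f \<in> hom E X Y" and \<eta>: "\<eta> \<in> hom E X Z" "\<eta> \<in> M"
    and P: "P \<in> hom E Z Y" "P \<cdot> \<eta> = f"
    and univ: "\<And>m A B s b. m \<in> M \<Longrightarrow> m \<in> hom E A B \<Longrightarrow> s \<in> hom E A X \<Longrightarrow> b \<in> hom E B Y \<Longrightarrow>
       f \<cdot> s = b \<cdot> m \<Longrightarrow> \<exists>!c. c \<in> hom E B Z \<and> P \<cdot> c = b \<and> pullback_sq E m \<eta> s c"
  shows "bij_betw (\<lambda>\<phi>. \<phi> \<eta> (Ident E X) P) (right_map_structures E M f) (fillers E \<eta> f (Ident E X) P)"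
proof -
  have XZ: "X \<in> Obj E" "Z \<in> Obj E" using hom_Obj[OF \<eta>(1)] by auto
  note iX = ident_hom[OF XZ(1)] and iZ = ident_hom[OF XZ(2)]
  have gen: "comm_sq E \<eta> f (Ident E X) P"
    unfolding comm_sq_iff[OF \<eta>(1) f] using iX P comp_ident[OF f] by simp
  \<comment> \<open>The characteristic map of \<open>m\<close> relative to the square \<open>(s, t)\<close>.\<close>
  define char where "char m s t = (THE c. c \<in> hom E (Cod E m) Z \<and> P \<cdot> c = t \<and> pullback_sq E m \<eta> s c)"
    for m s t
  have sq: "s \<in> hom E (Dom E m) X" "t \<in> hom E (Cod E m) Y" "f \<cdot> s = t \<cdot> m" "m \<in> hom E (Dom E m) (Cod E m)"
    if "comm_sq E m f s t" for m s t
    using that f unfolding comm_sq_def by (auto simp: hom_def)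
  have ex: "\<exists>!c. c \<in> hom E (Cod E m) Z \<and> P \<cdot> c = t \<and> pullback_sq E m \<eta> s c"
    if "m \<in> M" "comm_sq E m f s t" for m s t
    using univ[OF that(1) sq(4,1,2,3)[OF that(2)]] .
  have char: "char m s t \<in> hom E (Cod E m) Z" "P \<cdot> char m s t = t" "pullback_sq E m \<eta> s (char m s t)"
    if "m \<in> M" "comm_sq E m f s t" for m s t
    using theI'[OF ex[OF that]] unfolding char_def by blast+
  have char_eq: "c = char m s t"
    if "m \<in> M" "comm_sq E m f s t" "c \<in> hom E (Cod E m) Z" "P \<cdot> c = t" "pullback_sq E m \<eta> s c" for m s t c
    using ex[OF that(1,2)] char[OF that(1,2)] that(3-5) by blast
  define ext where "ext d m s t = (if m \<in> M \<and> comm_sq E m f s t then d \<cdot> char m s t else undefined)"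
    for d m s t
  have "pullback_sq E \<eta> \<eta> (Ident E X) (Ident E Z)"
    unfolding pullback_sq_iff[OF \<eta>(1) \<eta>(1)]
  proof (intro conjI allI ballI impI)
    show "\<eta> \<cdot> Ident E X = Ident E Z \<cdot> \<eta>" using comp_ident[OF \<eta>(1)] ident_comp[OF \<eta>(1)] by simp
    fix w u v assume u: "u \<in> hom E w X" and v: "v \<in> hom E w Z" and "\<eta> \<cdot> u = Ident E Z \<cdot> v"
    then have "\<eta> \<cdot> u = v" using ident_comp[OF v] by simp
    then show "\<exists>!a. a \<in> hom E w X \<and> Ident E X \<cdot> a = u \<and> \<eta> \<cdot> a = v"
      using u ident_comp by metis
  qed (rule iX iZ)+
  then have char_gen: "char \<eta> (Ident E X) P = Ident E Z"
    using char_eq[OF \<eta>(2) gen, of "Ident E Z"] iZ \<eta>(1) comp_ident[OF P(1)] by (simp add: hom_def)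
  show ?thesis
  proof (rule bij_betw_byWitness[where f' = ext])
    show "\<forall>\<phi>\<in>right_map_structures E M f. ext (\<phi> \<eta> (Ident E X) P) = \<phi>"
    proof (intro ballI ext)
      fix \<phi> m s t assume \<phi>: "\<phi> \<in> right_map_structures E M f"
      show "ext (\<phi> \<eta> (Ident E X) P) m s t = \<phi> m s t"
      proof (cases "m \<in> M \<and> comm_sq E m f s t")
        case True
        then have m: "m \<in> M" "comm_sq E m f s t" by auto
        have "\<phi> \<eta> (Ident E X) P \<cdot> char m s t = \<phi> m (Ident E X \<cdot> s) (P \<cdot> char m s t)"
          using \<phi> m(1) \<eta>(2) char(3)[OF m] gen unfolding right_map_structures_def by blast
        then show ?thesis using True char(2)[OF m] ident_comp[OF sq(1)[OF m(2)]] by (simp add: ext_def)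
      next
        case False
        then have "\<phi> m s t = undefined" using \<phi> unfolding right_map_structures_def by (auto split: if_splits)
        then show ?thesis using False by (auto simp: ext_def)
      qed
    qed
    show "(\<lambda>\<phi>. \<phi> \<eta> (Ident E X) P) ` right_map_structures E M f \<subseteq> fillers E \<eta> f (Ident E X) P"
      using gen \<eta>(2) unfolding right_map_structures_def by auto
    have d: "d \<in> hom E Z X \<and> d \<cdot> \<eta> = Ident E X \<and> f \<cdot> d = P" if "d \<in> fillers E \<eta> f (Ident E X) P" for d
      using that \<eta>(1) f by (auto simp: fillers_def hom_def)
    show "\<forall>d\<in>fillers E \<eta> f (Ident E X) P. ext d \<eta> (Ident E X) P = d"
    proof
      fix d assume "d \<in> fillers E \<eta> f (Ident E X) P"
      then have "d \<in> hom E Z X" using d by blast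
      then show "ext d \<eta> (Ident E X) P = d" using comp_ident gen \<eta>(2) by (simp add: ext_def char_gen)
    qed
    show "ext ` fillers E \<eta> f (Ident E X) P \<subseteq> right_map_structures E M f"
    proof
      fix \<phi> assume "\<phi> \<in> ext ` fillers E \<eta> f (Ident E X) P"
      then obtain d where d: "\<phi> = ext d" "d \<in> hom E Z X" "d \<cdot> \<eta> = Ident E X" "f \<cdot> d = P" using d by blast
      have fill: "d \<cdot> char m s t \<in> fillers E m f s t" if m: "m \<in> M" "comm_sq E m f s t" for m s t
      proof -
        note c = char[OF m] and q = sq[OF m(2)]
        have "\<eta> \<cdot> s = char m s t \<cdot> m" using c(3) unfolding pullback_sq_iff[OF q(4) \<eta>(1)] by blast
        then have "(d \<cdot> char m s t) \<cdot> m = s"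
          using comp_assoc[OF q(4) c(1) d(2)] comp_assoc[OF q(1) \<eta>(1) d(2)] d(3) ident_comp[OF q(1)] by simp
        moreover have "f \<cdot> (d \<cdot> char m s t) = t" using comp_assoc[OF c(1) d(2) f] d(4) c(2) by simp
        moreover have "Dom E f = X" using f by (simp add: hom_def)
        ultimately show ?thesis using comp_hom[OF c(1) d(2)] by (simp add: fillers_def)
      qed
      have unif: "(d \<cdot> char m' s t) \<cdot> b = d \<cdot> char m (s \<cdot> a) (t \<cdot> b) \<and> comm_sq E m f (s \<cdot> a) (t \<cdot> b)"
        if m: "m \<in> M" "m' \<in> M" "pullback_sq E m m' a b" "comm_sq E m' f s t" for m m' a b s t
      proof -
        note c = char[OF m(2,4)] and q = sq[OF m(4)]
        have ab: "a \<in> hom E (Dom E m) (Dom E m')" "b \<in> hom E (Cod E m) (Cod E m')" "m' \<cdot> a = b \<cdot> m"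
          and mh: "m \<in> hom E (Dom E m) (Cod E m)"
          using m(3) arr_hom unfolding pullback_sq_def comm_sq_def by auto
        have s': "comm_sq E m f (s \<cdot> a) (t \<cdot> b)"
          unfolding comm_sq_iff[OF mh f]
          using comp_hom[OF ab(1) q(1)] comp_hom[OF ab(2) q(2)] comp_assoc[OF ab(1) q(1) f]
            comp_assoc[OF ab(1) q(4) q(2)] comp_assoc[OF mh ab(2) q(2)] q(3) ab(3) by simp
        \<comment> \<open>Pasting shows that \<open>char m' s t \<cdot> b\<close> has the property that defines \<open>char m (s \<cdot> a) (t \<cdot> b)\<close>.\<close>
        have "char m' s t \<cdot> b = char m (s \<cdot> a) (t \<cdot> b)"
          by (rule char_eq[OF m(1) s' comp_hom[OF ab(2) c(1)] _ pullback_paste[OF m(3) c(3)]])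
            (use comp_assoc[OF ab(2) c(1) P(1)] c(2) in simp)
        then show ?thesis using s' comp_assoc[OF ab(2) c(1) d(2)] by simp
      qed
      show "\<phi> \<in> right_map_structures E M f"
        unfolding right_map_structures_def d(1)
        by (intro CollectI conjI allI ballI impI) (use fill unif in \<open>simp_all add: ext_def\<close>)
    qed
  qed
qed

section \<open>Uniform trivial fibrations as algebras of the partial map classifier\<close>

theorem theorem8p8:
  fixes C :: "('v, 'v) cat"
    and I :: "('v psh, 'v psh_arr, 'v psh, 'v psh_arr) funct"
    and \<delta> :: "nat \<Rightarrow> 'v psh \<Rightarrow> 'v psh_arr"
    and \<epsilon> :: "'v psh \<Rightarrow> 'v psh_arr"
    and c :: "nat \<Rightarrow> 'v psh \<Rightarrow> 'v psh_arr"
    and M :: "'v psh_arr set"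
    and X Y :: "'v psh"
    and f :: "'v psh_arr"
    and T R :: "('v psh_arr, 'v psh_arr \<times> 'v psh_arr \<times> 'v psh_arr,
                 'v psh_arr, 'v psh_arr \<times> 'v psh_arr \<times> 'v psh_arr) funct"
    and pr :: "'v psh_arr \<Rightarrow> 'v psh_arr"
    and unit counit :: "'v psh_arr \<Rightarrow> 'v psh_arr \<times> 'v psh_arr \<times> 'v psh_arr"
    and P \<eta> :: "'v psh_arr"
  assumes "universe TYPE('v)"
    and "small_category C"
    and "functorial_cylinder (Psh C) I \<delta>"
    and "contractions (Psh C) I \<delta> \<epsilon>"
    and "connections (Psh C) I \<delta> \<epsilon> c"
    and "has_right_adjoint (Psh C) (Psh C) I"
    and C1: "preserves_pullbacks (Psh C) (Psh C) I"
    and C2: "\<forall>k\<in>{0, 1}. cartesian_transf (Psh C) (Psh C) id_funct I (\<delta> k)"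
    and M1_5: "admissible TYPE('v) (Psh C) I \<delta> M"
    and f: "f \<in> hom (Psh C) X Y"
    and t_pullback: "pullback_functor (Psh C) (t_map C M Y) T pr"
    and t_adjoint: "adjunction (slice (Psh C) (prod_psh C (K_psh C M) Y)) (slice (Psh C) Y)
                      T R unit counit"
    and P: "P = FO (pmc C M Y R) f"
    and \<eta>: "\<eta> = pmc_unit (Psh C) pr R counit f"
  shows "(f, P, \<eta>) \<in> hom (slice (Psh C) Y) f P \<and>
    \<eta> \<in> M \<and>
    bij_betw (\<lambda>\<phi>. \<phi> \<eta> (Ident (Psh C) X) P)
      (right_map_structures (Psh C) M f)
      (fillers (Psh C) \<eta> f (Ident (Psh C) X) P) \<and>
    bij_betw (\<lambda>d. (P, f, d))
      (fillers (Psh C) \<eta> f (Ident (Psh C) X) P)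
      (retractions (slice (Psh C) Y) (f, P, \<eta>))"
proof -
  interpret presheaves C by (rule presheaves.intro) fact+
  interpret monic_class C M by (rule admissible_monic_class) fact+
  have Y: "presheaf C Y" using Psh_homD[OF f] by simp
  note t = t_map_hom[OF Y] and pi = pi_map(1)[OF Y]
  interpret rc: relative_classifier "Psh C" "t_map C M Y" Y "prod_psh C (K_psh C M) Y" T R pr unit counit f X
    by unfold_locales (use t t_map_monic[OF Y] t_pullback t_adjoint f in auto)
  define Z where "Z = rc.Z"
  define \<rho> where "\<rho> = rc.rho"
  have \<eta>_eq: "\<eta> = rc.eta" by (simp add: \<eta> rc.eta_def)
  have \<eta>_hom: "\<eta> \<in> hom (Psh C) X Z" using rc.eta_hom by (simp add: \<eta>_eq Z_def)
  have \<rho>_hom: "\<rho> \<in> hom (Psh C) Z (prod_psh C (K_psh C M) Y)"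
    using rc.rho_hom by (simp add: \<rho>_def Z_def)
  have pb: "pullback_sq (Psh C) \<eta> (t_map C M Y) f \<rho>" using rc.eta_pullback by (simp add: \<eta>_eq \<rho>_def)
  have P_eq: "P = pi_map C M Y \<cdot>\<^bsub>Psh C\<^esub> \<rho>"
    by (simp add: P pmc_def comp_funct_def postcomp_def \<rho>_def rc.rho_def)
  have P_hom: "P \<in> hom (Psh C) Z Y" using Psh_comp_hom[OF \<rho>_hom pi] by (simp add: P_eq)
  have "\<rho> \<cdot>\<^bsub>Psh C\<^esub> \<eta> = t_map C M Y \<cdot>\<^bsub>Psh C\<^esub> f"
    using pb unfolding E.pullback_sq_iff[OF \<eta>_hom t] by simp
  then have P\<eta>: "P \<cdot>\<^bsub>Psh C\<^esub> \<eta> = f"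
    using E.comp_assoc[OF \<eta>_hom \<rho>_hom pi] E.comp_assoc[OF f t pi] pi_t[OF Y] E.ident_comp[OF f]
    by (simp add: P_eq)
  have \<eta>M: "\<eta> \<in> M" using M_pullback[OF t_map_in_M[OF Y] pb] .
  \<comment> \<open>The universal property of \<open>\<eta>\<close>: first \<open>m\<close> is classified by a unique \<open>g : B \<rightarrow> K \<times> Y\<close> over \<open>b\<close>,
    and then \<open>s\<close> determines the lift of \<open>g\<close> through \<open>\<rho>\<close>.\<close>
  have univ: "\<exists>!c. c \<in> hom (Psh C) B Z \<and> P \<cdot>\<^bsub>Psh C\<^esub> c = b \<and> pullback_sq (Psh C) m \<eta> s c"
    if m: "m \<in> M" "m \<in> hom (Psh C) A B" and s: "s \<in> hom (Psh C) A X" and b: "b \<in> hom (Psh C) B Y"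
      and sq: "f \<cdot>\<^bsub>Psh C\<^esub> s = b \<cdot>\<^bsub>Psh C\<^esub> m" for m A B s b
  proof -
    from M_classified[OF Y m(2,1) b]
    obtain g where g: "g \<in> hom (Psh C) B (prod_psh C (K_psh C M) Y)" "pi_map C M Y \<cdot>\<^bsub>Psh C\<^esub> g = b"
        "pullback_sq (Psh C) m (t_map C M Y) (f \<cdot>\<^bsub>Psh C\<^esub> s) g"
      and gu: "\<And>g'. g' \<in> hom (Psh C) B (prod_psh C (K_psh C M) Y) \<Longrightarrow> pi_map C M Y \<cdot>\<^bsub>Psh C\<^esub> g' = b \<Longrightarrow>
        pullback_sq (Psh C) m (t_map C M Y) (f \<cdot>\<^bsub>Psh C\<^esub> s) g' \<Longrightarrow> g' = g"
      unfolding sq[symmetric] by blast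
    obtain c where c: "c \<in> hom (Psh C) B Z" "\<rho> \<cdot>\<^bsub>Psh C\<^esub> c = g" "c \<cdot>\<^bsub>Psh C\<^esub> m = \<eta> \<cdot>\<^bsub>Psh C\<^esub> s"
      and cu: "\<And>c'. c' \<in> hom (Psh C) B Z \<Longrightarrow> \<rho> \<cdot>\<^bsub>Psh C\<^esub> c' = g \<Longrightarrow>
        c' \<cdot>\<^bsub>Psh C\<^esub> m = \<eta> \<cdot>\<^bsub>Psh C\<^esub> s \<Longrightarrow> c' = c"
      using rc.classify[OF E.pullback_sq_transpose[OF g(3)] m(2) s refl]
      unfolding Z_def[symmetric] \<rho>_def[symmetric] \<eta>_eq[symmetric] by blast
    show ?thesis
    proof (rule ex1I[of _ c], intro conjI)
      show "P \<cdot>\<^bsub>Psh C\<^esub> c = b" using E.comp_assoc[OF c(1) \<rho>_hom pi] c(2) g(2) by (simp add: P_eq)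
      show "pullback_sq (Psh C) m \<eta> s c"
        by (rule E.pullback_cancel[OF _ pb])
          (use g(3) c s E.comm_sq_iff[OF m(2) \<eta>_hom] in auto)
      fix c' assume a: "c' \<in> hom (Psh C) B Z \<and> P \<cdot>\<^bsub>Psh C\<^esub> c' = b \<and> pullback_sq (Psh C) m \<eta> s c'"
      then have c': "c' \<in> hom (Psh C) B Z" by simp
      have "\<rho> \<cdot>\<^bsub>Psh C\<^esub> c' = g"
        using gu[OF Psh_comp_hom[OF c' \<rho>_hom]] a E.comp_assoc[OF c' \<rho>_hom pi]
          E.pullback_paste[OF _ pb, of m s c'] by (simp add: P_eq)
      moreover have "c' \<cdot>\<^bsub>Psh C\<^esub> m = \<eta> \<cdot>\<^bsub>Psh C\<^esub> s"
        using a unfolding E.pullback_sq_iff[OF m(2) \<eta>_hom] by simp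
      ultimately show "c' = c" using cu c' by blast
    qed (rule c)
  qed
  have "(f, P, \<eta>) \<in> hom (slice (Psh C) Y) f P"
    unfolding slice_hom_iff[OF f P_hom] using \<eta>_hom P\<eta> by blast
  moreover have "bij_betw (\<lambda>\<phi>. \<phi> \<eta> (Ident (Psh C) X) P) (right_map_structures (Psh C) M f)
      (fillers (Psh C) \<eta> f (Ident (Psh C) X) P)"
  proof (rule E.generic_filler_bij[OF _ f \<eta>_hom \<eta>M P_hom P\<eta>])
    show "M \<subseteq> Arr (Psh C)" using M1_5 unfolding admissible_def by blast
  qed (rule univ)
  moreover have "bij_betw (\<lambda>d. (P, f, d)) (fillers (Psh C) \<eta> f (Ident (Psh C) X) P)
      (retractions (slice (Psh C) Y) (f, P, \<eta>))"
  proof -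
    have d: "Dom (Psh C) f = X" "Cod (Psh C) \<eta> = Z" using f \<eta>_hom by (auto simp: hom_def)
    have "x \<in> retractions (slice (Psh C) Y) (f, P, \<eta>) \<longleftrightarrow>
        (\<exists>d. d \<in> hom (Psh C) Z X \<and> d \<cdot>\<^bsub>Psh C\<^esub> \<eta> = Ident (Psh C) X \<and> f \<cdot>\<^bsub>Psh C\<^esub> d = P \<and> x = (P, f, d))" for x
      unfolding retractions_def slice_simps mem_Collect_eq slice_hom_iff[OF P_hom f] Bex_def
      by (cases x) (simp add: slice_simps d, blast)
    moreover have "x \<in> (\<lambda>d. (P, f, d)) ` fillers (Psh C) \<eta> f (Ident (Psh C) X) P \<longleftrightarrow>
        (\<exists>d. d \<in> hom (Psh C) Z X \<and> d \<cdot>\<^bsub>Psh C\<^esub> \<eta> = Ident (Psh C) X \<and> f \<cdot>\<^bsub>Psh C\<^esub> d = P \<and> x = (P, f, d))" for x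
      unfolding fillers_def d image_iff Bex_def mem_Collect_eq by blast
    ultimately have "retractions (slice (Psh C) Y) (f, P, \<eta>)
        = (\<lambda>d. (P, f, d)) ` fillers (Psh C) \<eta> f (Ident (Psh C) X) P"
      by blast
    then show ?thesis by (auto simp: bij_betw_def inj_on_def)
  qed
  ultimately show ?thesis using \<eta>M by blast
qed

end
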